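(* There exists a unique Nash equilibrium for the functionals $J_1,\dots,J_N$ (with common weights $\rho$ and $\eta$), i.e. a unique $u=(u_1,\dots,u_N)\in{\mathcal U}$ such that, for every $i\in\{1,\dots,N\}$, $$J_i(u_1,\dots,u_N)\le J_i(u_1,\dots,u_{i-1},v_i,u_{i+1},\dots,u_N)\qquad\text{for all } v_i\in{\mathcal U}_i.$$
   Context: Let $T>0$, $d\in\{1,2,3\}$, $\Omega\subset\mathbb{R}^d$ a bounded and smooth open set, $\Gamma_1,\Gamma_2\subset\partial\Omega$ (measurable) with $\partial\Omega=\Gamma_1\cup\Gamma_2$. Put $Q=\Omega\times(0,T)$, $\Sigma_1=\Gamma_1\times(0,T)$, $\Sigma_2=\Gamma_2\times(0,T)$. Let $N\in\mathbb{N}$, $N\geq 1$, and for $i\in\{1,\dots,N\}$ let $\omega_i\subset\Omega$ be (measurable) sets with $\omega_i\cap\omega_j=\emptyset$ if $i\ne j$. The control Hilbert spaces are ${\mathcal U}_i=L^2(\omega_i\times(0,T))$ and ${\mathcal U}={\mathcal U}_1\times\cdots\times{\mathcal U}_N$. For each $i$ let $\alpha_i>0$, and let $\rho,\eta\in L^\infty(\Omega)$ with $\rho,\eta\ge 0$ (the same for all $i$). For $v=(v_1,\dots,v_N)\in{\mathcal U}$, $y=y(v)$ is the solution of $$\frac{\partial y}{\partial t}-\Delta y=f+\sum_{i=1}^N v_i\chi_{\omega_i}\ \text{in }Q,\quad y(0)=y_0\ \text{in }\Omega,\quad y=g_1\ \text{on }\Sigma_1,\quad \frac{\partial y}{\partial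 n}=g_2\ \text{on }\Sigma_2,$$ where $v_i\chi_{\omega_i}$ is the extension of $v_i$ by zero to $Q$ and $\partial/\partial n$ is the outward normal derivative. The data $f,g_1,g_2,y_0$ and the targets $y_{i,{\rm d}}$ (defined on $Q$), $y_{i,{\rm T}}$ (defined on $\Omega$) are smooth enough functions: in particular $y_{i,{\rm d}}\in L^2(Q)$, $y_{i,{\rm T}}\in L^2(\Omega)$, and the problem for $y$ has a unique solution $y(v)\in C([0,T];L^2(\Omega))$ for each $v\in{\mathcal U}$. Solutions are understood in the standard weak (variational) sense, with test functions in $V=\{\varphi\in H^1(\Omega):\varphi=0\text{ on }\Gamma_1\}$; the difference $y(v)-y(0)$ is the weak solution, in $\{z\in L^2(0,T;V):\partial_t z\in L^2(0,T;V')\}$, of the same problem with $f=0$, $y_0=0$, $g_1=0$, $g_2=0$. The functionals $J_i:{\mathcal U}\to\mathbb{R}$, $i\in\{1,\dots,N\}$, are $$J_i(v)=\frac{\alpha_i}{2}\int_{\omega_i\times(0,T)}|v_i|^2\,dx\,dt+\frac12\int_Q\rho(x)|y(v)-y_{i,{\rm d}}|^2\,dx\,dt+\frac12\int_\Omega\eta(x)|y(T;v)-y_{i,{\rm T}}|^2\,dx,$$ where $y(T;v)$ denotes $y(v)$ at time $T$. *)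

theory Defs
  imports "HOL-Analysis.Analysis"
begin

section \<open>Smooth functions and smooth domains\<close>

text \<open>Both notions below are meant for open sets \<open>S\<close>.\<close>

primrec Ck_on :: "nat \<Rightarrow> 'a::euclidean_space set \<Rightarrow> ('a \<Rightarrow> real) \<Rightarrow> bool" where
  "Ck_on 0 S f \<longleftrightarrow> continuous_on S f"
| "Ck_on (Suc k) S f \<longleftrightarrow>
     (\<exists>g. (\<forall>x\<in>S. GDERIV f x :> g x) \<and> (\<forall>b\<in>Basis. Ck_on k S (\<lambda>x. g x \<bullet> b)))"

definition smooth_on :: "'a::euclidean_space set \<Rightarrow> ('a \<Rightarrow> real) \<Rightarrow> bool" where
  "smooth_on S f \<longleftrightarrow> (\<forall>k. Ck_on k S f)"

definition grad :: "('a::euclidean_space \<Rightarrow> real) \<Rightarrow> 'a \<Rightarrow> 'a" where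
  "grad f x = (THE D. GDERIV f x :> D)"

definition test_function :: "'a::euclidean_space set \<Rightarrow> ('a \<Rightarrow> real) \<Rightarrow> bool" where
  "test_function S \<psi> \<longleftrightarrow>
     smooth_on UNIV \<psi> \<and> compact (closure {x. \<psi> x \<noteq> 0}) \<and> closure {x. \<psi> x \<noteq> 0} \<subseteq> S"

text \<open>Near each boundary point the set is the negativity region of a smooth function with
  nonvanishing gradient; in particular it lies locally on one side of its boundary.\<close>

definition smooth_domain :: "'a::euclidean_space set \<Rightarrow> bool" where
  "smooth_domain \<Omega> \<longleftrightarrow> open \<Omega> \<and>
     (\<forall>p\<in>frontier \<Omega>. \<exists>U \<psi>. open U \<and> p \<in> U \<and> smooth_on U \<psi> \<and>
        (\<forall>x\<in>U. \<not> (GDERIV \<psi> x :> 0)) \<and> \<Omega> \<inter> U = {x \<in> U. \<psi> x < 0})"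

section \<open>Surface measure\<close>

text \<open>The \<open>s\<close>-dimensional Hausdorff measure, normalised so that it is the counting measure for
  \<open>s = 0\<close> and the usual surface measure on smooth \<open>s\<close>-dimensional hypersurfaces.  The empty set
  is treated separately because \<open>0 ^ 0 = 1\<close>.\<close>

definition hausdorff_content :: "nat \<Rightarrow> real \<Rightarrow> 'a::euclidean_space set \<Rightarrow> ennreal" where
  "hausdorff_content s \<delta> A =
     (INF C \<in> {C :: nat \<Rightarrow> 'a set. A \<subseteq> (\<Union>n. C n) \<and> (\<forall>n. bounded (C n) \<and> diameter (C n) \<le> \<delta>)}.
        \<Sum>n. if C n = {} then 0
            else ennreal (unit_ball_vol (real s) * (diameter (C n) / 2) ^ s))"

definition hausdorff_measure :: "nat \<Rightarrow> 'a::euclidean_space measure" where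
  "hausdorff_measure s =
     measure_of UNIV (sets borel) (\<lambda>A. SUP \<delta>\<in>{0<..}. hausdorff_content s \<delta> A)"

definition boundary_measure :: "'a::euclidean_space set \<Rightarrow> 'a measure" where
  "boundary_measure \<Omega> =
     completion (restrict_space (hausdorff_measure (DIM('a) - 1)) (frontier \<Omega>))"

text \<open>The measure on \<open>\<Gamma> \<times> (0,T)\<close> for a part \<open>\<Gamma>\<close> of the boundary.\<close>

definition lateral_measure ::
    "'a::euclidean_space set \<Rightarrow> 'a set \<Rightarrow> real \<Rightarrow> ('a \<times> real) measure" where
  "lateral_measure \<Omega> \<Gamma> T =
     completion (restrict_space (boundary_measure \<Omega>) \<Gamma> \<Otimes>\<^sub>M lebesgue_on {0<..<T})"

section \<open>Function spaces\<close>

text \<open>Elements of the spaces are functions; almost everywhere equal ones are to be identified.\<close>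

definition L2 :: "'a measure \<Rightarrow> ('a \<Rightarrow> 'b::euclidean_space) set" where
  "L2 M = {f \<in> borel_measurable M. integrable M (\<lambda>x. (norm (f x))\<^sup>2)}"

definition L2_tendsto ::
    "'a measure \<Rightarrow> ('i \<Rightarrow> 'a \<Rightarrow> 'b::euclidean_space) \<Rightarrow> ('a \<Rightarrow> 'b) \<Rightarrow> 'i filter \<Rightarrow> bool" where
  "L2_tendsto M u v F \<longleftrightarrow>
     ((\<lambda>i. \<integral>\<^sup>+ x. ennreal ((norm (u i x - v x))\<^sup>2) \<partial>M) \<longlongrightarrow> 0) F"

definition Linf :: "'a measure \<Rightarrow> ('a \<Rightarrow> real) set" where
  "Linf M = {f \<in> borel_measurable M. \<exists>C. AE x in M. \<bar>f x\<bar> \<le> C}"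

text \<open>\<open>weak_gradient \<Omega> u G\<close> says that \<open>u\<close> belongs to \<open>H\<^sup>1(\<Omega>)\<close> with distributional
  gradient \<open>G\<close>.\<close>

definition weak_gradient ::
    "'a::euclidean_space set \<Rightarrow> ('a \<Rightarrow> real) \<Rightarrow> ('a \<Rightarrow> 'a) \<Rightarrow> bool" where
  "weak_gradient \<Omega> u G \<longleftrightarrow>
     u \<in> L2 (lebesgue_on \<Omega>) \<and> G \<in> L2 (lebesgue_on \<Omega>) \<and>
     (\<forall>\<psi>. test_function \<Omega> \<psi> \<longrightarrow> (\<forall>b\<in>Basis.
        (LINT x|lebesgue_on \<Omega>. u x * (grad \<psi> x \<bullet> b)) =
        - (LINT x|lebesgue_on \<Omega>. (G x \<bullet> b) * \<psi> x)))"

definition H1_norm ::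
    "'a::euclidean_space set \<Rightarrow> ('a \<Rightarrow> real) \<Rightarrow> ('a \<Rightarrow> 'a) \<Rightarrow> real" where
  "H1_norm \<Omega> u G = sqrt ((LINT x|lebesgue_on \<Omega>. (u x)\<^sup>2) + (LINT x|lebesgue_on \<Omega>. (norm (G x))\<^sup>2))"

text \<open>The graph of the trace operator \<open>H\<^sup>1(\<Omega>) \<rightarrow> L\<^sup>2(\<partial>\<Omega>)\<close>: the closure of the restriction
  of functions that are smooth up to the boundary.\<close>

definition has_trace :: "'a::euclidean_space set \<Rightarrow> ('a \<Rightarrow> real) \<Rightarrow> ('a \<Rightarrow> real) \<Rightarrow> bool" where
  "has_trace \<Omega> u h \<longleftrightarrow> h \<in> L2 (boundary_measure \<Omega>) \<and>
     (\<exists>G (\<phi> :: nat \<Rightarrow> 'a \<Rightarrow> real). weak_gradient \<Omega> u G \<and> (\<forall>n. smooth_on UNIV (\<phi> n)) \<and>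
        L2_tendsto (lebesgue_on \<Omega>) \<phi> u sequentially \<and>
        L2_tendsto (lebesgue_on \<Omega>) (\<lambda>n. grad (\<phi> n)) G sequentially \<and>
        L2_tendsto (boundary_measure \<Omega>) \<phi> h sequentially)"

text \<open>\<open>V_space \<Omega> \<Gamma>\<close> is the space of all \<open>\<phi> \<in> H\<^sup>1(\<Omega>)\<close> with \<open>\<phi> = 0\<close> on \<open>\<Gamma>\<close>.\<close>

definition V_space :: "'a::euclidean_space set \<Rightarrow> 'a set \<Rightarrow> ('a \<Rightarrow> real) set" where
  "V_space \<Omega> \<Gamma> =
     {\<phi>. \<exists>h. has_trace \<Omega> \<phi> h \<and> (AE x in restrict_space (boundary_measure \<Omega>) \<Gamma>. h x = 0)}"

text \<open>\<open>L\<^sup>2(0,T;V')\<close>.  As \<open>V\<close> is separable and reflexive, Bochner measurability is measurability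
  against every \<open>\<phi> \<in> V\<close>, and square integrability of the dual norm amounts to its being dominated
  by a square integrable \<open>c\<close>.  The norm bound also makes \<open>w t\<close> respect equality almost everywhere.\<close>

definition L2_dual ::
    "'a::euclidean_space set \<Rightarrow> 'a set \<Rightarrow> real \<Rightarrow> (real \<Rightarrow> ('a \<Rightarrow> real) \<Rightarrow> real) \<Rightarrow> bool" where
  "L2_dual \<Omega> \<Gamma> T w \<longleftrightarrow>
     (\<forall>\<phi>\<in>V_space \<Omega> \<Gamma>. (\<lambda>t. w t \<phi>) \<in> borel_measurable (lebesgue_on {0<..<T})) \<and>
     (AE t in lebesgue_on {0<..<T}. \<forall>\<phi>\<in>V_space \<Omega> \<Gamma>. \<forall>\<psi>\<in>V_space \<Omega> \<Gamma>. \<forall>a b.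
        w t (\<lambda>x. a * \<phi> x + b * \<psi> x) = a * w t \<phi> + b * w t \<psi>) \<and>
     (\<exists>c \<in> L2 (lebesgue_on {0<..<T}). AE t in lebesgue_on {0<..<T}.
        \<forall>\<phi>\<in>V_space \<Omega> \<Gamma>. \<forall>\<Phi>. weak_gradient \<Omega> \<phi> \<Phi> \<longrightarrow> \<bar>w t \<phi>\<bar> \<le> c t * H1_norm \<Omega> \<phi> \<Phi>)"

text \<open>\<open>C([0,T]; L\<^sup>2(\<Omega>))\<close>, together with the choice of a representative that is jointly measurable
  on \<open>\<Omega> \<times> (0,T)\<close>.\<close>

definition C_L2 :: "'a::euclidean_space set \<Rightarrow> real \<Rightarrow> (real \<Rightarrow> 'a \<Rightarrow> real) set" where
  "C_L2 \<Omega> T = {y. (\<lambda>(x, t). y t x) \<in> borel_measurable (lebesgue_on (\<Omega> \<times> {0<..<T})) \<and>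
     (\<forall>t\<in>{0..T}. y t \<in> L2 (lebesgue_on \<Omega>) \<and>
        L2_tendsto (lebesgue_on \<Omega>) y (y t) (at t within {0..T}))}"

section \<open>Weak solutions of the heat equation with mixed boundary conditions\<close>

text \<open>\<open>w\<close> is the distributional time derivative of \<open>y\<close> with values in \<open>V'\<close>.\<close>

definition weak_time_derivative ::
    "'a::euclidean_space set \<Rightarrow> 'a set \<Rightarrow> real \<Rightarrow> (real \<Rightarrow> 'a \<Rightarrow> real)
      \<Rightarrow> (real \<Rightarrow> ('a \<Rightarrow> real) \<Rightarrow> real) \<Rightarrow> bool" where
  "weak_time_derivative \<Omega> \<Gamma> T y w \<longleftrightarrow> L2_dual \<Omega> \<Gamma> T w \<and>
     (\<forall>\<phi>\<in>V_space \<Omega> \<Gamma>. \<forall>\<theta>. test_function {0<..<T} \<theta> \<longrightarrow>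
        (LINT t|lebesgue_on {0<..<T}. deriv \<theta> t * (LINT x|lebesgue_on \<Omega>. y t x * \<phi> x)) =
        - (LINT t|lebesgue_on {0<..<T}. \<theta> t * w t \<phi>))"

text \<open>Weak solutions \<open>y \<in> C([0,T]; L\<^sup>2(\<Omega>)) \<inter> L\<^sup>2(0,T; H\<^sup>1(\<Omega>))\<close>, with
  \<open>\<partial>\<^sub>t y \<in> L\<^sup>2(0,T;V')\<close>, of \<open>\<partial>\<^sub>t y - \<Delta> y = F\<close> in \<open>\<Omega> \<times> (0,T)\<close>, \<open>y(0) = y0\<close>,
  \<open>y = g1\<close> on \<open>\<Gamma>1 \<times> (0,T)\<close> in the sense of traces, and \<open>\<partial>y/\<partial>n = g2\<close> on \<open>\<Gamma>2 \<times> (0,T)\<close>;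
  the Neumann condition enters through the boundary integral produced by Green's formula.
  \<open>G t\<close> is the spatial gradient of \<open>y t\<close>, and \<open>h\<close> is the trace of the test function \<open>\<phi>\<close>.\<close>

definition heat_weak_solution ::
    "'a::euclidean_space set \<Rightarrow> 'a set \<Rightarrow> 'a set \<Rightarrow> real \<Rightarrow> ('a \<times> real \<Rightarrow> real)
      \<Rightarrow> ('a \<times> real \<Rightarrow> real) \<Rightarrow> ('a \<times> real \<Rightarrow> real) \<Rightarrow> ('a \<Rightarrow> real)
      \<Rightarrow> (real \<Rightarrow> 'a \<Rightarrow> real) \<Rightarrow> bool" where
  "heat_weak_solution \<Omega> \<Gamma>1 \<Gamma>2 T F g1 g2 y0 y \<longleftrightarrow>
     y \<in> C_L2 \<Omega> T \<and>
     (AE x in lebesgue_on \<Omega>. y 0 x = y0 x) \<and>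
     (AE t in lebesgue_on {0<..<T}. \<exists>h. has_trace \<Omega> (y t) h \<and>
        (AE x in restrict_space (boundary_measure \<Omega>) \<Gamma>1. h x = g1 (x, t))) \<and>
     (\<exists>G w.
        (\<lambda>(x, t). G t x) \<in> L2 (lebesgue_on (\<Omega> \<times> {0<..<T})) \<and>
        (AE t in lebesgue_on {0<..<T}. weak_gradient \<Omega> (y t) (G t)) \<and>
        weak_time_derivative \<Omega> \<Gamma>1 T y w \<and>
        (\<forall>\<phi> \<Phi> h. weak_gradient \<Omega> \<phi> \<Phi> \<and> has_trace \<Omega> \<phi> h \<and>
            (AE x in restrict_space (boundary_measure \<Omega>) \<Gamma>1. h x = 0) \<longrightarrow>
          (AE t in lebesgue_on {0<..<T}.
             w t \<phi> + (LINT x|lebesgue_on \<Omega>. G t x \<bullet> \<Phi> x) =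
             (LINT x|lebesgue_on \<Omega>. F (x, t) * \<phi> x) +
             (LINT x|restrict_space (boundary_measure \<Omega>) \<Gamma>2. g2 (x, t) * h x))))"

section \<open>The differential game\<close>

definition controls ::
    "nat \<Rightarrow> (nat \<Rightarrow> 'a::euclidean_space set) \<Rightarrow> real \<Rightarrow> (nat \<Rightarrow> 'a \<times> real \<Rightarrow> real) set" where
  "controls N \<omega> T = {v. \<forall>i\<in>{1..N}. v i \<in> L2 (lebesgue_on (\<omega> i \<times> {0<..<T}))}"

definition controlled_source ::
    "nat \<Rightarrow> (nat \<Rightarrow> 'a set) \<Rightarrow> ('a \<times> real \<Rightarrow> real) \<Rightarrow> (nat \<Rightarrow> 'a \<times> real \<Rightarrow> real)
      \<Rightarrow> 'a \<times> real \<Rightarrow> real" where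
  "controlled_source N \<omega> f v = (\<lambda>(x, t). f (x, t) + (\<Sum>i=1..N. v i (x, t) * indicator (\<omega> i) x))"

text \<open>The cost of one player, with control \<open>v\<close> on \<open>\<omega> \<times> (0,T)\<close> and with state \<open>y\<close>.\<close>

definition cost ::
    "'a::euclidean_space set \<Rightarrow> real \<Rightarrow> ('a \<Rightarrow> real) \<Rightarrow> ('a \<Rightarrow> real) \<Rightarrow> 'a set \<Rightarrow> real
      \<Rightarrow> ('a \<times> real \<Rightarrow> real) \<Rightarrow> ('a \<Rightarrow> real) \<Rightarrow> ('a \<times> real \<Rightarrow> real) \<Rightarrow> (real \<Rightarrow> 'a \<Rightarrow> real) \<Rightarrow> real" where
  "cost \<Omega> T \<rho> \<eta> \<omega> \<alpha> yd yT v y =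
     \<alpha> / 2 * (LINT p|lebesgue_on (\<omega> \<times> {0<..<T}). \<bar>v p\<bar>\<^sup>2) +
     1 / 2 * (LINT (x, t)|lebesgue_on (\<Omega> \<times> {0<..<T}). \<rho> x * \<bar>y t x - yd (x, t)\<bar>\<^sup>2) +
     1 / 2 * (LINT x|lebesgue_on \<Omega>. \<eta> x * \<bar>y T x - yT x\<bar>\<^sup>2)"

definition nash_equilibrium ::
    "nat \<Rightarrow> (nat \<Rightarrow> 'u set) \<Rightarrow> (nat \<Rightarrow> (nat \<Rightarrow> 'u) \<Rightarrow> real) \<Rightarrow> (nat \<Rightarrow> 'u) \<Rightarrow> bool" where
  "nash_equilibrium N U J u \<longleftrightarrow> (\<forall>i\<in>{1..N}. \<forall>v\<in>U i. J i u \<le> J i (u(i := v)))"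

end

theory Submission
  imports Defs "HOL-Computational_Algebra.Polynomial"
begin

text \<open>
  A Nash equilibrium exists and is unique because all players observe the state with the same
  weights.  The state is affine in the controls: \<open>y(v) = y(0) + S v\<close>, where \<open>S v\<close> solves the heat
  equation with zero data and source \<open>\<Sum>\<^sub>i v\<^sub>i \<chi>\<^sub>i\<close>.  Let
  \<open>B p q = \<integral>\<^sub>Q \<rho> p q + \<integral>\<^sub>\<Omega> \<eta> p(T) q(T)\<close> and let \<open>z\<^sub>i\<close> be the pair of targets of player \<open>i\<close>.  In the
  variable of player \<open>i\<close> the cost is a convex quadratic function, so \<open>u\<close> is an equilibrium if and
  only if \<open>\<alpha>\<^sub>i \<langle>u\<^sub>i, w\<rangle> + B (S u) (S w) = B (z\<^sub>i - y(0)) (S w)\<close> for every player \<open>i\<close> and every control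
  \<open>w\<close> of that player alone (lemma \<open>nash_iff_stationary\<close>).  Since \<open>B\<close> does not depend on \<open>i\<close>, these
  equations add up to the single equation \<open>a u w = l w\<close> with the symmetric form
  \<open>a u w = \<Sum>\<^sub>i \<alpha>\<^sub>i \<langle>u\<^sub>i, w\<^sub>i\<rangle> + B (S u) (S w)\<close> (the constant \<open>energy_form\<close> below).  It dominates the squared norms of the controls, hence
  is definite, which gives uniqueness.  If \<open>S\<close> is bounded, \<open>a\<close> is equivalent to the inner product of the
  control space, and the Riesz representation theorem gives existence.

  What remains is the boundedness of \<open>S\<close>, the energy estimate \<open>heat_energy_estimate\<close>.  It is obtained
  by testing the equation with the solution itself at a frozen time.  For every admissible test
  function \<open>\<phi>\<close> the weak formulation says that \<open>t \<mapsto> (y(t), \<phi>)\<close> is continuous with an integrable weak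
  derivative, so that \<open>(y(t), \<phi>) - (y(s), \<phi>) = \<integral>\<^sub>s\<^sup>t (F(r), \<phi>) - (\<nabla>y(r), \<nabla>\<phi>) dr\<close>
  (lemma \<open>weak_derivative_imp_difference\<close>).  For almost every \<open>t\<close> the choice \<open>\<phi> = y(t)\<close> is
  admissible, and \<open>|y(t)|\<^sup>2 - |y(s)|\<^sup>2 \<le> 2 (y(t) - y(s), y(t))\<close>.  Integrating over \<open>t\<close> in \<open>(a, b)\<close> with
  \<open>s = a\<close> turns the gradient term into
  \<open>-2 \<integral>\<^sub>a\<^sup>b \<integral>\<^sub>a\<^sup>t (\<nabla>y(r), \<nabla>y(t)) dr dt = - |\<integral>\<^sub>a\<^sup>b \<nabla>y|\<^sup>2 \<le> 0\<close> (lemma \<open>Volterra_form_nonneg\<close>).  Hence the continuous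
  function \<open>q(t) = |y(t)|\<^sup>2 - P(t)\<close>, where \<open>P\<close> collects the contribution of \<open>F\<close>, has a mean at most
  \<open>q(a)\<close> on each interval \<open>[a, b]\<close>, and such a function never exceeds \<open>q(0) = 0\<close>
  (lemma \<open>le_initial_if_mean_le\<close>).
\<close>

section \<open>Riesz representation for complete semi-inner products\<close>

lemma quadratic_nonneg_discriminant:
  fixes A B C :: real
  assumes "\<And>s. 0 \<le> A + 2 * s * B + s\<^sup>2 * C" "0 \<le> C"
  shows "B\<^sup>2 \<le> A * C"
proof (cases "C = 0")
  case True
  have "B = 0"
  proof (rule ccontr)
    assume B: "B \<noteq> 0"
    have "0 \<le> A + 2 * (- (A + 1) / (2 * B)) * B" using assms(1)[of "- (A + 1) / (2 * B)"] True by simp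
    moreover have "2 * (- (A + 1) / (2 * B)) * B = - (A + 1)" using B by (simp add: field_simps)
    ultimately show False by simp
  qed
  then show ?thesis using True by simp
next
  case False
  then have C: "C > 0" using assms(2) by simp
  have "0 \<le> A + 2 * (- B / C) * B + (- B / C)\<^sup>2 * C" by (rule assms(1))
  also have "\<dots> = A - B\<^sup>2 / C" using C by (simp add: field_simps power2_eq_square)
  finally have "B\<^sup>2 / C \<le> A" by simp
  then show ?thesis using C by (simp add: pos_divide_le_eq)
qed

lemma quadratic_nonneg_imp_linear_zero:
  fixes B C :: real
  assumes "\<And>s. 0 \<le> s * B + s\<^sup>2 * C"
  shows "B = 0"
proof -
  have C: "0 \<le> C" using assms[of 1] assms[of "-1"] by simp
  have "(B / 2)\<^sup>2 \<le> 0 * C" by (rule quadratic_nonneg_discriminant) (use assms C in auto)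
  then show ?thesis by simp
qed

text \<open>The elements will be functions with almost everywhere equal ones not identified, so the form is only
  semidefinite.  The linear structure enters through the single operation \<open>lc s u t v\<close>, which stands
  for \<open>s u + t v\<close>; equations between elements are replaced by equations between values of the form.\<close>
locale semi_inner =
  fixes X :: "'v set" and lc :: "real \<Rightarrow> 'v \<Rightarrow> real \<Rightarrow> 'v \<Rightarrow> 'v" and a :: "'v \<Rightarrow> 'v \<Rightarrow> real"
  assumes lc: "u \<in> X \<Longrightarrow> v \<in> X \<Longrightarrow> lc s u t v \<in> X"
    and lin: "u \<in> X \<Longrightarrow> v \<in> X \<Longrightarrow> w \<in> X \<Longrightarrow> a (lc s u t v) w = s * a u w + t * a v w"
    and sym: "u \<in> X \<Longrightarrow> v \<in> X \<Longrightarrow> a u v = a v u"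
    and nonneg: "u \<in> X \<Longrightarrow> 0 \<le> a u u"
begin

lemma lin_right: "u \<in> X \<Longrightarrow> v \<in> X \<Longrightarrow> w \<in> X \<Longrightarrow> a w (lc s u t v) = s * a w u + t * a w v"
  by (metis lc lin sym)

lemma square_lc:
  assumes "u \<in> X" "v \<in> X"
  shows "a (lc s u t v) (lc s u t v) = s\<^sup>2 * a u u + 2 * s * t * a u v + t\<^sup>2 * a v v"
  using assms sym[OF assms] by (simp add: lin lin_right lc power2_eq_square algebra_simps)

lemma Cauchy_Schwarz:
  assumes "u \<in> X" "v \<in> X"
  shows "(a u v)\<^sup>2 \<le> a u u * a v v"
proof (rule quadratic_nonneg_discriminant)
  show "0 \<le> a u u + 2 * s * a u v + s\<^sup>2 * a v v" for s
    using nonneg[OF lc[OF assms, of 1 s]] square_lc[OF assms, of 1 s] by simp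
  show "0 \<le> a v v" using assms nonneg by simp
qed

lemma Cauchy_Schwarz_sqrt:
  assumes "u \<in> X" "v \<in> X"
  shows "\<bar>a u v\<bar> \<le> sqrt (a u u) * sqrt (a v v)"
  using Cauchy_Schwarz[OF assms] by (metis real_sqrt_abs real_sqrt_le_iff real_sqrt_mult)

text \<open>The quadratic functional \<open>a u u - 2 l u\<close> is bounded below because \<open>l\<close> is bounded.  By the parallelogram
  identity a minimizing sequence is Cauchy.  Its limit satisfies the Euler equation: the inequality
  between the value at \<open>x\<^sub>n + s w\<close> and the infimum is passed to the limit \<open>n \<rightarrow> \<infinity>\<close> for fixed \<open>s\<close>.\<close>
theorem Riesz_representation:
  assumes ne: "X \<noteq> {}"
    and complete: "\<And>x :: nat \<Rightarrow> 'v. (\<And>n. x n \<in> X) \<Longrightarrow>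
      (\<And>e. e > 0 \<Longrightarrow> \<exists>k. \<forall>m\<ge>k. \<forall>n\<ge>k. a (lc 1 (x m) (-1) (x n)) (lc 1 (x m) (-1) (x n)) < e) \<Longrightarrow>
      \<exists>u\<in>X. (\<lambda>n. a (lc 1 (x n) (-1) u) (lc 1 (x n) (-1) u)) \<longlonglongrightarrow> 0"
    and l_lin: "\<And>u v s t. u \<in> X \<Longrightarrow> v \<in> X \<Longrightarrow> l (lc s u t v) = s * l u + t * l v"
    and l_bdd: "\<And>u. u \<in> X \<Longrightarrow> \<bar>l u\<bar> \<le> C * sqrt (a u u)"
  shows "\<exists>u\<in>X. \<forall>w\<in>X. a u w = l w"
proof -
  define \<Psi> where "\<Psi> u = a u u - 2 * l u" for u
  have \<Psi>_lc: "\<Psi> (lc s u t v) = s\<^sup>2 * a u u + 2 * s * t * a u v + t\<^sup>2 * a v v - 2 * s * l u - 2 * t * l v"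
    if "u \<in> X" "v \<in> X" for s t u v
    using that by (simp add: \<Psi>_def square_lc l_lin)
  have bound: "- (C\<^sup>2) \<le> \<Psi> u" if "u \<in> X" for u
  proof -
    have "0 \<le> (sqrt (a u u) - C)\<^sup>2" by simp
    also have "\<dots> = a u u - 2 * (C * sqrt (a u u)) + C\<^sup>2"
      using nonneg[OF that] by (simp add: power2_diff)
    finally show ?thesis using l_bdd[OF that] by (simp add: \<Psi>_def)
  qed
  define I where "I = Inf (\<Psi> ` X)"
  have bdd: "bdd_below (\<Psi> ` X)" by (rule bdd_belowI2[OF bound])
  have I_le: "I \<le> \<Psi> u" if "u \<in> X" for u
    unfolding I_def using that bdd by (intro cInf_lower) auto
  have "\<exists>u\<in>X. \<Psi> u < I + 1 / (real n + 1)" for n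
  proof -
    have "Inf (\<Psi> ` X) < I + 1 / (real n + 1)" by (simp add: I_def)
    then show ?thesis using ne bdd by (subst (asm) cInf_less_iff) auto
  qed
  then obtain x where x: "x n \<in> X" "\<Psi> (x n) < I + 1 / (real n + 1)" for n by metis
  have diff: "a (lc 1 (x m) (-1) (x n)) (lc 1 (x m) (-1) (x n)) \<le> 2 * (1 / (real m + 1) + 1 / (real n + 1))" for m n
  proof -
    have "I \<le> \<Psi> (lc (1/2) (x m) (1/2) (x n))" by (intro I_le lc x)
    moreover have "4 * \<Psi> (lc (1/2) (x m) (1/2) (x n)) + a (lc 1 (x m) (-1) (x n)) (lc 1 (x m) (-1) (x n))
        = 2 * \<Psi> (x m) + 2 * \<Psi> (x n)"
      using x(1) by (simp add: \<Psi>_lc square_lc) (simp add: \<Psi>_def power2_eq_square)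
    ultimately show ?thesis using x(2)[of m] x(2)[of n] by simp
  qed
  have "\<exists>u\<in>X. (\<lambda>n. a (lc 1 (x n) (-1) u) (lc 1 (x n) (-1) u)) \<longlonglongrightarrow> 0"
  proof (rule complete[OF x(1)])
    fix e :: real assume e: "e > 0"
    obtain k where k: "1 / (real k + 1) < e / 4"
      using nat_approx_posE[of "e / 4"] e by (auto simp: add.commute)
    show "\<exists>k. \<forall>m\<ge>k. \<forall>n\<ge>k. a (lc 1 (x m) (-1) (x n)) (lc 1 (x m) (-1) (x n)) < e"
    proof (intro exI allI impI)
      fix m n assume "m \<ge> k" "n \<ge> k"
      then have "1 / (real m + 1) \<le> 1 / (real k + 1)" "1 / (real n + 1) \<le> 1 / (real k + 1)"
        by (auto intro!: divide_left_mono)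
      then show "a (lc 1 (x m) (-1) (x n)) (lc 1 (x m) (-1) (x n)) < e"
        using diff[of m n] k by simp
    qed
  qed
  then obtain u where u: "u \<in> X"
    and conv: "(\<lambda>n. a (lc 1 (x n) (-1) u) (lc 1 (x n) (-1) u)) \<longlonglongrightarrow> 0" by blast
  have "a u w = l w" if w: "w \<in> X" for w
  proof -
    have "(\<lambda>n. a (x n) w - a u w) \<longlonglongrightarrow> 0"
    proof (rule Lim_null_comparison)
      show "\<forall>\<^sub>F n in sequentially. norm (a (x n) w - a u w)
          \<le> sqrt (a (lc 1 (x n) (-1) u) (lc 1 (x n) (-1) u)) * sqrt (a w w)"
      proof (intro always_eventually allI)
        fix n
        show "norm (a (x n) w - a u w)
            \<le> sqrt (a (lc 1 (x n) (-1) u) (lc 1 (x n) (-1) u)) * sqrt (a w w)"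
          using Cauchy_Schwarz_sqrt[OF lc[OF x(1)[of n] u, of 1 "-1"] w] lin[OF x(1)[of n] u w, of 1 "-1"]
          by simp
      qed
      show "(\<lambda>n. sqrt (a (lc 1 (x n) (-1) u) (lc 1 (x n) (-1) u)) * sqrt (a w w)) \<longlonglongrightarrow> 0"
        using tendsto_mult_right[OF tendsto_real_sqrt[OF conv], of "sqrt (a w w)"] by simp
    qed
    then have lim: "(\<lambda>n. a (x n) w) \<longlonglongrightarrow> a u w" by (simp add: LIM_zero_iff)
    have "0 \<le> s * (2 * (a u w - l w)) + s\<^sup>2 * a w w" for s
    proof (rule LIMSEQ_le)
      show "(\<lambda>n. - (1 / (real n + 1))) \<longlonglongrightarrow> 0"
        using LIMSEQ_inverse_real_of_nat tendsto_minus by (fastforce simp: inverse_eq_divide add.commute)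
      show "(\<lambda>n. s * (2 * (a (x n) w - l w)) + s\<^sup>2 * a w w) \<longlonglongrightarrow> s * (2 * (a u w - l w)) + s\<^sup>2 * a w w"
        by (intro tendsto_intros lim)
      have "- (1 / (real n + 1)) \<le> s * (2 * (a (x n) w - l w)) + s\<^sup>2 * a w w" for n
        using I_le[OF lc[OF x(1) w], of 1 n s] x(2)[of n]
        by (simp add: \<Psi>_lc x(1) w) (simp add: \<Psi>_def algebra_simps)
      then show "\<exists>N. \<forall>n\<ge>N. - (1 / (real n + 1)) \<le> s * (2 * (a (x n) w - l w)) + s\<^sup>2 * a w w"
        by blast
    qed
    from quadratic_nonneg_imp_linear_zero[OF this] show ?thesis by simp
  qed
  then show ?thesis using u by blast
qed

end

section \<open>Square integrable functions\<close>

lemma L2_measurable: "f \<in> L2 M \<Longrightarrow> f \<in> borel_measurable M"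
  and L2_integrable: "f \<in> L2 M \<Longrightarrow> integrable M (\<lambda>x. (norm (f x))\<^sup>2)"
  by (auto simp: L2_def)

lemma L2_integrable_real: "f \<in> L2 M \<Longrightarrow> integrable M (\<lambda>x. (f x :: real)\<^sup>2)"
  by (auto simp: L2_def)

lemma L2_inner_integrable:
  assumes "f \<in> L2 M" "g \<in> L2 M"
  shows "integrable M (\<lambda>x. f x \<bullet> g x)"
proof (rule Bochner_Integration.integrable_bound)
  show "integrable M (\<lambda>x. (norm (f x))\<^sup>2 + (norm (g x))\<^sup>2)"
    using assms by (intro Bochner_Integration.integrable_add L2_integrable)
  show "(\<lambda>x. f x \<bullet> g x) \<in> borel_measurable M"
    using assms[THEN L2_measurable] by measurable
  have "norm (f x \<bullet> g x) \<le> norm ((norm (f x))\<^sup>2 + (norm (g x))\<^sup>2)" for x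
  proof -
    have "\<bar>f x \<bullet> g x\<bar> \<le> norm (f x) * norm (g x)" by (rule Cauchy_Schwarz_ineq2)
    also have "\<dots> \<le> (norm (f x))\<^sup>2 + (norm (g x))\<^sup>2"
      using sum_squares_bound[of "norm (f x)" "norm (g x)"]
        mult_nonneg_nonneg[OF norm_ge_zero[of "f x"] norm_ge_zero[of "g x"]] by linarith
    finally show ?thesis by simp
  qed
  then show "AE x in M. norm (f x \<bullet> g x) \<le> norm ((norm (f x))\<^sup>2 + (norm (g x))\<^sup>2)" by simp
qed

lemma L2_mult_integrable:
  assumes "f \<in> L2 M" "g \<in> L2 M"
  shows "integrable M (\<lambda>x. f x * g x :: real)"
  using L2_inner_integrable[OF assms] by simp

lemma L2_zero: "(\<lambda>_. 0) \<in> L2 M"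
  by (simp add: L2_def)

lemma L2_comb:
  assumes "f \<in> L2 M" "g \<in> L2 M"
  shows "(\<lambda>x. a *\<^sub>R f x + b *\<^sub>R g x) \<in> L2 M"
proof -
  have "(norm (a *\<^sub>R f x + b *\<^sub>R g x))\<^sup>2 = a\<^sup>2 * (norm (f x))\<^sup>2 + 2 * a * b * (f x \<bullet> g x) + b\<^sup>2 * (norm (g x))\<^sup>2" for x
    by (simp only: power2_norm_eq_inner) (simp add: algebra_simps inner_commute power2_eq_square)
  moreover have "(\<lambda>x. a *\<^sub>R f x + b *\<^sub>R g x) \<in> borel_measurable M"
    using assms[THEN L2_measurable] by measurable
  ultimately show ?thesis
    using assms by (auto simp: L2_def intro!: Bochner_Integration.integrable_add
      integrable_mult_right L2_inner_integrable L2_integrable)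
qed

lemma L2_comb_real:
  fixes f g :: "'a \<Rightarrow> real"
  assumes "f \<in> L2 M" "g \<in> L2 M"
  shows "(\<lambda>x. a * f x + b * g x) \<in> L2 M"
  using L2_comb[OF assms, of a b] by simp

lemma L2_diff:
  assumes "f \<in> L2 M" "g \<in> L2 M"
  shows "(\<lambda>x. f x - g x) \<in> L2 M"
  using L2_comb[OF assms, of 1 "-1"] by simp

lemma L2_sum:
  fixes f :: "'i \<Rightarrow> 'a \<Rightarrow> real"
  assumes "finite I" "\<And>i. i \<in> I \<Longrightarrow> f i \<in> L2 M"
  shows "(\<lambda>x. \<Sum>i\<in>I. f i x) \<in> L2 M"
  using assms
proof (induction I)
  case (insert i I)
  then show ?case using L2_comb_real[of "f i" M "\<lambda>x. \<Sum>i\<in>I. f i x" 1 1] by simp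
qed (simp add: L2_zero)

lemma L2_cong_AE:
  assumes "f \<in> L2 M" "g \<in> borel_measurable M" "AE x in M. f x = g x"
  shows "g \<in> L2 M"
proof -
  have "integrable M (\<lambda>x. (norm (f x))\<^sup>2) \<longleftrightarrow> integrable M (\<lambda>x. (norm (g x))\<^sup>2)"
  proof (rule integrable_cong_AE)
    show "(\<lambda>x. (norm (f x))\<^sup>2) \<in> borel_measurable M" using L2_measurable[OF assms(1)] by measurable
    show "(\<lambda>x. (norm (g x))\<^sup>2) \<in> borel_measurable M" using assms(2) by measurable
    show "AE x in M. (norm (f x))\<^sup>2 = (norm (g x))\<^sup>2" using assms(3) by auto
  qed
  then show ?thesis using assms by (simp add: L2_def)
qed

lemma L2_semi_inner:
  "semi_inner (L2 M) (\<lambda>s u t v x. s *\<^sub>R u x + t *\<^sub>R v x) (\<lambda>f g. LINT x|M. f x \<bullet> g x)"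
proof
  fix s t :: real and u v w :: "'a \<Rightarrow> 'b"
  assume uv: "u \<in> L2 M" "v \<in> L2 M"
  show "(\<lambda>x. s *\<^sub>R u x + t *\<^sub>R v x) \<in> L2 M" using uv by (rule L2_comb)
  assume w: "w \<in> L2 M"
  show "(LINT x|M. (s *\<^sub>R u x + t *\<^sub>R v x) \<bullet> w x) = s * (LINT x|M. u x \<bullet> w x) + t * (LINT x|M. v x \<bullet> w x)"
    using L2_inner_integrable[OF uv(1) w] L2_inner_integrable[OF uv(2) w]
    by (simp add: inner_add_left)
qed (simp_all add: inner_commute)

lemma L2_Cauchy_Schwarz:
  assumes "f \<in> L2 M" "g \<in> L2 M"
  shows "\<bar>LINT x|M. f x \<bullet> g x\<bar> \<le> sqrt (LINT x|M. (norm (f x))\<^sup>2) * sqrt (LINT x|M. (norm (g x))\<^sup>2)"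
  using semi_inner.Cauchy_Schwarz_sqrt[OF L2_semi_inner assms] by (simp add: power2_norm_eq_inner)

text \<open>Along a subsequence the squared increments have integrals below \<open>8\<^sup>-\<^sup>j\<close>.  Weighting them with \<open>4\<^sup>j\<close> keeps
  the series of integrals finite and makes the increments decay geometrically at almost every point, so
  the subsequence converges almost everywhere; Fatou's lemma turns this into convergence in the mean.\<close>
theorem L2_complete:
  fixes f :: "nat \<Rightarrow> 'a \<Rightarrow> real"
  assumes f: "\<And>n. f n \<in> L2 M"
    and Cauchy: "\<And>e. e > 0 \<Longrightarrow> \<exists>k. \<forall>m\<ge>k. \<forall>n\<ge>k. (LINT x|M. (f m x - f n x)\<^sup>2) < e"
  shows "\<exists>g\<in>L2 M. (\<lambda>n. LINT x|M. (f n x - g x)\<^sup>2) \<longlonglongrightarrow> 0"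
proof -
  have [measurable]: "f n \<in> borel_measurable M" for n using f by (rule L2_measurable)
  have int: "integrable M (\<lambda>x. (f m x - f n x)\<^sup>2)" for m n
    using L2_integrable_real[OF L2_diff[OF f f]] .
  have "\<exists>k. \<forall>j. \<forall>m\<ge>k j. \<forall>n\<ge>k j. (LINT x|M. (f m x - f n x)\<^sup>2) < (1/8) ^ j"
    using Cauchy by (intro choice allI) simp
  then obtain k where k: "\<And>j m n. m \<ge> k j \<Longrightarrow> n \<ge> k j \<Longrightarrow> (LINT x|M. (f m x - f n x)\<^sup>2) < (1/8) ^ j"
    by blast
  \<comment> \<open>the thresholds \<open>k j\<close> need not be monotone; this choice of indices is, and dominates them\<close>
  define r where "r j = (\<Sum>i\<le>j. k i) + j" for j
  have rk: "k j \<le> r j" for j unfolding r_def by (rule trans_le_add1) (rule member_le_sum, auto)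
  have rmono: "r j \<le> r (Suc j)" for j by (simp add: r_def)
  have rge: "j \<le> r j" for j by (simp add: r_def)
  have small: "(LINT x|M. (f (r (Suc j)) x - f (r j) x)\<^sup>2) < (1/8) ^ j" for j
    using k[of j] rk[of j] rmono[of j] by (meson order_trans)
  \<comment> \<open>the weighted series of squared increments has finite integral, so it converges almost everywhere\<close>
  have "(\<integral>\<^sup>+x. (\<Sum>j. ennreal (4 ^ j * (f (r (Suc j)) x - f (r j) x)\<^sup>2)) \<partial>M) < \<infinity>"
  proof -
    have "(\<integral>\<^sup>+x. (\<Sum>j. ennreal (4 ^ j * (f (r (Suc j)) x - f (r j) x)\<^sup>2)) \<partial>M)
        = (\<Sum>j. \<integral>\<^sup>+x. ennreal (4 ^ j * (f (r (Suc j)) x - f (r j) x)\<^sup>2) \<partial>M)"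
      by (rule nn_integral_suminf) measurable
    also have "\<dots> \<le> (\<Sum>j. ennreal ((1/2) ^ j))"
    proof (rule suminf_le)
      fix j
      have "(\<integral>\<^sup>+x. ennreal (4 ^ j * (f (r (Suc j)) x - f (r j) x)\<^sup>2) \<partial>M)
          = ennreal (4 ^ j * (LINT x|M. (f (r (Suc j)) x - f (r j) x)\<^sup>2))"
        using int by (subst nn_integral_eq_integral) auto
      also have "\<dots> \<le> ennreal (4 ^ j * (1/8) ^ j)"
        using small[of j] by (intro ennreal_leI mult_left_mono) auto
      also have "4 ^ j * (1/8) ^ j = (1/2 :: real) ^ j" by (simp flip: power_mult_distrib)
      finally show "(\<integral>\<^sup>+x. ennreal (4 ^ j * (f (r (Suc j)) x - f (r j) x)\<^sup>2) \<partial>M) \<le> ennreal ((1/2) ^ j)" .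
    qed auto
    also have "\<dots> = ennreal (\<Sum>j. (1/2) ^ j)" by (rule suminf_ennreal2) (auto intro: summable_geometric)
    also have "\<dots> < \<infinity>" by simp
    finally show ?thesis .
  qed
  then have "AE x in M. (\<Sum>j. ennreal (4 ^ j * (f (r (Suc j)) x - f (r j) x)\<^sup>2)) \<noteq> \<infinity>"
    by (intro nn_integral_PInf_AE) auto
  then have conv: "AE x in M. convergent (\<lambda>j. f (r j) x)"
  proof eventually_elim
    case (elim x)
    have "summable (\<lambda>j. 4 ^ j * (f (r (Suc j)) x - f (r j) x)\<^sup>2)"
      using elim by (intro summable_suminf_not_top) auto
    then have "Bseq (\<lambda>j. 4 ^ j * (f (r (Suc j)) x - f (r j) x)\<^sup>2)"
      using summable_LIMSEQ_zero convergentI convergent_imp_Bseq by blast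
    then obtain C where C: "\<And>j. 4 ^ j * (f (r (Suc j)) x - f (r j) x)\<^sup>2 \<le> C"
      by (auto simp: Bseq_def)
    have bd: "\<bar>f (r (Suc j)) x - f (r j) x\<bar> \<le> sqrt C * (1/2) ^ j" for j
    proof -
      have "(2 ^ j)\<^sup>2 = (4 :: real) ^ j" by (simp add: power2_eq_square flip: power_mult_distrib)
      then have "(2 ^ j * \<bar>f (r (Suc j)) x - f (r j) x\<bar>)\<^sup>2 \<le> C"
        using C[of j] by (simp add: power_mult_distrib)
      then have "2 ^ j * \<bar>f (r (Suc j)) x - f (r j) x\<bar> \<le> sqrt C" by (rule real_le_rsqrt)
      then show ?thesis by (simp add: field_simps power_divide)
    qed
    have "summable (\<lambda>j. f (r (Suc j)) x - f (r j) x)"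
    proof (rule summable_comparison_test')
      show "summable (\<lambda>j. sqrt C * (1/2) ^ j)" by (intro summable_mult summable_geometric) simp
    qed (use bd in auto)
    then have "convergent (\<lambda>n. \<Sum>j<n. f (r (Suc j)) x - f (r j) x)" by (simp add: summable_iff_convergent)
    then have "convergent (\<lambda>n. f (r n) x - f (r 0) x)" by (simp only: sum_lessThan_telescope[of "\<lambda>j. f (r j) x"])
    then show ?case by (simp add: convergent_diff_const_right_iff)
  qed
  define g where "g x = lim (\<lambda>j. f (r j) x)" for x
  have [measurable]: "g \<in> borel_measurable M" unfolding g_def by measurable
  have lim: "AE x in M. (\<lambda>j. f (r j) x) \<longlonglongrightarrow> g x"
    using conv by eventually_elim (simp add: g_def convergent_LIMSEQ_iff)
  have Fatou: "(\<integral>\<^sup>+x. ennreal ((f n x - g x)\<^sup>2) \<partial>M) \<le> ennreal ((1/8) ^ j)" if n: "n \<ge> k j" for n j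
  proof -
    have "(\<integral>\<^sup>+x. ennreal ((f n x - g x)\<^sup>2) \<partial>M)
        = (\<integral>\<^sup>+x. liminf (\<lambda>i. ennreal ((f n x - f (r i) x)\<^sup>2)) \<partial>M)"
    proof (rule nn_integral_cong_AE)
      show "AE x in M. ennreal ((f n x - g x)\<^sup>2) = liminf (\<lambda>i. ennreal ((f n x - f (r i) x)\<^sup>2))"
        using lim
      proof eventually_elim
        case (elim x)
        have "(\<lambda>i. ennreal ((f n x - f (r i) x)\<^sup>2)) \<longlonglongrightarrow> ennreal ((f n x - g x)\<^sup>2)"
          by (intro tendsto_intros elim)
        then show ?case by (intro lim_imp_Liminf[symmetric]) auto
      qed
    qed
    also have "\<dots> \<le> liminf (\<lambda>i. \<integral>\<^sup>+x. ennreal ((f n x - f (r i) x)\<^sup>2) \<partial>M)"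
      by (rule nn_integral_liminf) measurable
    also have "\<dots> \<le> liminf (\<lambda>i. ennreal ((1/8) ^ j))"
    proof (rule Liminf_mono)
      have "(\<integral>\<^sup>+x. ennreal ((f n x - f (r i) x)\<^sup>2) \<partial>M) \<le> ennreal ((1/8) ^ j)" if "i \<ge> k j" for i
      proof -
        have "(\<integral>\<^sup>+x. ennreal ((f n x - f (r i) x)\<^sup>2) \<partial>M) = ennreal (LINT x|M. (f n x - f (r i) x)\<^sup>2)"
          using int by (intro nn_integral_eq_integral) auto
        also have "\<dots> \<le> ennreal ((1/8) ^ j)"
          using k[OF n, of "r i"] rge[of i] that by (intro ennreal_leI) auto
        finally show ?thesis .
      qed
      then show "\<forall>\<^sub>F i in sequentially. (\<integral>\<^sup>+x. ennreal ((f n x - f (r i) x)\<^sup>2) \<partial>M) \<le> ennreal ((1/8) ^ j)"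
        using eventually_sequentially by blast
    qed
    also have "\<dots> = ennreal ((1/8) ^ j)" by (simp add: Liminf_const)
    finally show ?thesis .
  qed
  have diffL2: "(\<lambda>x. f (k 0) x - g x) \<in> L2 M"
  proof -
    have "integrable M (\<lambda>x. (f (k 0) x - g x)\<^sup>2)"
    proof (rule integrableI_nonneg)
      show "(\<integral>\<^sup>+x. ennreal ((f (k 0) x - g x)\<^sup>2) \<partial>M) < \<infinity>"
        using Fatou[of 0 "k 0"] by (simp add: order_le_less_trans)
    qed auto
    then show ?thesis by (simp add: L2_def)
  qed
  have g: "g \<in> L2 M" using L2_diff[OF f[of "k 0"] diffL2] by simp
  have "(\<lambda>n. LINT x|M. (f n x - g x)\<^sup>2) \<longlonglongrightarrow> 0"
  proof (rule LIMSEQ_I)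
    fix e :: real assume "e > 0"
    then obtain j where j: "(1/8) ^ j < e" using real_arch_pow_inv[of e "1/8"] by auto
    have "(LINT x|M. (f n x - g x)\<^sup>2) < e" if "n \<ge> k j" for n
    proof -
      have "ennreal (LINT x|M. (f n x - g x)\<^sup>2) = (\<integral>\<^sup>+x. ennreal ((f n x - g x)\<^sup>2) \<partial>M)"
        using L2_integrable_real[OF L2_diff[OF f g]] by (intro nn_integral_eq_integral[symmetric]) auto
      also have "\<dots> \<le> ennreal ((1/8) ^ j)" by (rule Fatou[OF that])
      finally have "(LINT x|M. (f n x - g x)\<^sup>2) \<le> (1/8) ^ j" by (simp add: ennreal_le_iff)
      then show ?thesis using j by simp
    qed
    then show "\<exists>no. \<forall>n\<ge>no. norm ((LINT x|M. (f n x - g x)\<^sup>2) - 0) < e"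
      by (auto intro!: exI[of _ "k j"])
  qed
  then show ?thesis using g by blast
qed

section \<open>Smooth functions\<close>

lemma Ck_on_comb:
  assumes "Ck_on k S f" "Ck_on k S g"
  shows "Ck_on k S (\<lambda>x. a * f x + b * g x)"
  using assms
proof (induction k arbitrary: f g)
  case 0
  then show ?case by (auto intro!: continuous_intros)
next
  case (Suc k)
  obtain f' g' where f': "\<forall>x\<in>S. GDERIV f x :> f' x" "\<forall>b\<in>Basis. Ck_on k S (\<lambda>x. f' x \<bullet> b)"
    and g': "\<forall>x\<in>S. GDERIV g x :> g' x" "\<forall>b\<in>Basis. Ck_on k S (\<lambda>x. g' x \<bullet> b)"
    using Suc.prems by auto
  have "GDERIV (\<lambda>x. a * f x + b * g x) x :> a *\<^sub>R f' x + b *\<^sub>R g' x" if "x \<in> S" for x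
    using f'(1)[rule_format, OF that] g'(1)[rule_format, OF that] unfolding gderiv_def
    by (auto intro!: derivative_eq_intros simp: inner_add_right)
  moreover have "Ck_on k S (\<lambda>x. (a *\<^sub>R f' x + b *\<^sub>R g' x) \<bullet> c)" if "c \<in> Basis" for c
    using Suc.IH[OF f'(2)[rule_format, OF that] g'(2)[rule_format, OF that]]
    by (simp add: inner_add_left)
  ultimately show ?case by (auto intro!: exI[of _ "\<lambda>x. a *\<^sub>R f' x + b *\<^sub>R g' x"])
qed

lemma smooth_on_comb:
  "smooth_on S f \<Longrightarrow> smooth_on S g \<Longrightarrow> smooth_on S (\<lambda>x. a * f x + b * g x)"
  by (simp add: smooth_on_def Ck_on_comb)

lemma grad_eqI:
  assumes "GDERIV f x :> D"
  shows "grad f x = D"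
  unfolding grad_def
proof (rule the_equality)
  fix D' assume "GDERIV f x :> D'"
  then have "(\<lambda>h. h \<bullet> D') = (\<lambda>h. h \<bullet> D)"
    using assms unfolding gderiv_def by (rule has_derivative_unique)
  then show "D' = D" by (metis vector_eq_ldot)
qed (rule assms)

lemma smooth_on_GDERIV:
  assumes "smooth_on S f" "x \<in> S"
  shows "GDERIV f x :> grad f x"
proof -
  obtain g where "\<forall>x\<in>S. GDERIV f x :> g x"
    using assms(1) unfolding smooth_on_def by (metis Ck_on.simps(2))
  then show ?thesis using assms(2) grad_eqI by metis
qed

lemma grad_comb:
  assumes "smooth_on UNIV f" "smooth_on UNIV g"
  shows "grad (\<lambda>x. a * f x + b * g x) x = a *\<^sub>R grad f x + b *\<^sub>R grad g x"
  by (rule grad_eqI, use smooth_on_GDERIV[OF assms(1), of x] smooth_on_GDERIV[OF assms(2), of x] in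
    \<open>auto simp: gderiv_def inner_add_right intro!: derivative_eq_intros\<close>)

lemma smooth_on_continuous: "smooth_on S f \<Longrightarrow> continuous_on S f"
  unfolding smooth_on_def by (metis Ck_on.simps(1))

lemma smooth_on_continuous_grad:
  assumes "smooth_on UNIV f"
  shows "continuous_on UNIV (grad f)"
proof -
  obtain g where g: "\<forall>x\<in>UNIV. GDERIV f x :> g x" "\<forall>b\<in>Basis. Ck_on 0 UNIV (\<lambda>x. g x \<bullet> b)"
    using assms unfolding smooth_on_def by (metis Ck_on.simps(2))
  then have "grad f = g" using grad_eqI by blast
  then show ?thesis using g(2) by (subst continuous_on_componentwise) auto
qed

lemma Ck_on_real_SucI:
  fixes f g :: "real \<Rightarrow> real"
  assumes "\<And>x. (f has_real_derivative g x) (at x)" "Ck_on k UNIV g"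
  shows "Ck_on (Suc k) UNIV f"
  using assms by (auto intro!: exI[of _ g])

section \<open>A smooth step\<close>

text \<open>The derivatives of \<open>exp (- 1 / (x (1 - x)))\<close> on \<open>(0, 1)\<close> are all of this form, so that smoothness can
  be proved by one induction over the whole family.\<close>
definition flat_bump :: "real poly \<Rightarrow> nat \<Rightarrow> real \<Rightarrow> real" where
  "flat_bump P k x = (if 0 < x \<and> x < 1
     then poly P x * inverse (x * (1 - x)) ^ k * exp (- inverse (x * (1 - x))) else 0)"

text \<open>The exponential series gives \<open>exp (- u) \<le> (k + 2)! / u ^ (k + 2)\<close>, so the exponential absorbs the
  power \<open>u ^ k\<close> and leaves the square of \<open>x (1 - x)\<close>, which is what differentiability at the two end points
  requires.\<close>
lemma flat_bump_bound:
  "\<exists>C. \<forall>x. \<bar>flat_bump P k x\<bar> \<le> C * x\<^sup>2 \<and> \<bar>flat_bump P k x\<bar> \<le> C * (x - 1)\<^sup>2"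
proof -
  have "bounded (poly P ` {0..1})"
    by (intro compact_imp_bounded compact_continuous_image continuous_intros) auto
  then obtain B where B: "\<And>x. 0 \<le> x \<Longrightarrow> x \<le> 1 \<Longrightarrow> \<bar>poly P x\<bar> \<le> B"
    unfolding bounded_iff by (metis atLeastAtMost_iff image_eqI real_norm_def)
  have B0: "B \<ge> 0" using B[of 0] by simp
  have main: "\<bar>flat_bump P k x\<bar> \<le> B * fact (k + 2) * (x * (1 - x))\<^sup>2" for x
  proof (cases "0 < x \<and> x < 1")
    case True
    define w where "w = x * (1 - x)"
    have w: "w > 0" using True by (simp add: w_def)
    have "inverse w ^ (k + 2) / fact (k + 2) \<le> (\<Sum>n. inverse w ^ n /\<^sub>R fact n)"
    proof -
      have "(\<Sum>n\<in>{k + 2}. inverse w ^ n /\<^sub>R fact n) \<le> (\<Sum>n. inverse w ^ n /\<^sub>R fact n)"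
        using w by (intro sum_le_suminf summable_exp_generic) auto
      then show ?thesis by (simp add: divide_inverse mult.commute)
    qed
    then have "inverse w ^ (k + 2) \<le> fact (k + 2) * exp (inverse w)"
      by (simp add: exp_def pos_divide_le_eq mult.commute)
    then have "inverse w ^ (k + 2) * exp (- inverse w) \<le> fact (k + 2) * exp (inverse w) * exp (- inverse w)"
      by (intro mult_right_mono) auto
    then have "inverse w ^ (k + 2) * exp (- inverse w) \<le> fact (k + 2)"
      by (simp add: exp_minus mult.assoc)
    then have "w\<^sup>2 * (inverse w ^ (k + 2) * exp (- inverse w)) \<le> w\<^sup>2 * fact (k + 2)"
      by (intro mult_left_mono) auto
    moreover have "w\<^sup>2 * (inverse w ^ (k + 2) * exp (- inverse w)) = inverse w ^ k * exp (- inverse w)"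
      using w by (simp add: power_add power2_eq_square field_simps)
    ultimately have le: "inverse w ^ k * exp (- inverse w) \<le> fact (k + 2) * w\<^sup>2"
      by (metis mult.commute)
    have "\<bar>flat_bump P k x\<bar> = \<bar>poly P x\<bar> * (inverse w ^ k * exp (- inverse w))"
      using True w by (simp add: flat_bump_def w_def[symmetric] abs_mult mult.assoc)
    also have "\<dots> \<le> B * (fact (k + 2) * w\<^sup>2)"
    proof (rule mult_mono)
      show "\<bar>poly P x\<bar> \<le> B" using B True by simp
    qed (use le B0 w in auto)
    finally show ?thesis by (simp add: w_def mult.assoc)
  next
    case False
    then show ?thesis using B0 by (auto simp: flat_bump_def)
  qed
  have "\<bar>flat_bump P k x\<bar> \<le> B * fact (k + 2) * x\<^sup>2 \<and> \<bar>flat_bump P k x\<bar> \<le> B * fact (k + 2) * (x - 1)\<^sup>2" for x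
  proof (cases "0 < x \<and> x < 1")
    case True
    have "(x * (1 - x))\<^sup>2 \<le> x\<^sup>2" "(x * (1 - x))\<^sup>2 \<le> (1 - x)\<^sup>2"
      using True by (auto intro!: power_mono simp: mult_left_le mult_left_le_one_le)
    then show ?thesis using main[of x] B0
      by (smt (verit) fact_ge_zero mult_left_mono mult_nonneg_nonneg power2_commute)
  next
    case False
    then show ?thesis using B0 by (auto simp: flat_bump_def)
  qed
  then show ?thesis by blast
qed

lemma DERIV_zero_if_quadratic:
  fixes f :: "real \<Rightarrow> real"
  assumes "\<And>x. \<bar>f x\<bar> \<le> C * (x - a)\<^sup>2"
  shows "(f has_real_derivative 0) (at a)"
proof -
  have fa: "f a = 0" using assms[of a] by simp
  have "((\<lambda>x. f x / (x - a)) \<longlongrightarrow> 0) (at a)"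
  proof (rule Lim_null_comparison)
    show "\<forall>\<^sub>F x in at a. norm (f x / (x - a)) \<le> C * \<bar>x - a\<bar>"
    proof (rule eventually_mono[OF eventually_at_filter[THEN iffD2, OF always_eventually]])
      show "\<forall>x. x \<noteq> a \<longrightarrow> x \<in> UNIV \<longrightarrow> x \<noteq> a" by simp
      fix x assume "x \<noteq> a"
      then have "\<bar>f x\<bar> / \<bar>x - a\<bar> \<le> C * \<bar>x - a\<bar>"
        using assms[of x] by (simp add: pos_divide_le_eq power2_eq_square mult.assoc flip: abs_mult)
      then show "norm (f x / (x - a)) \<le> C * \<bar>x - a\<bar>" by simp
    qed
    have "((\<lambda>x. C * \<bar>x - a\<bar>) \<longlongrightarrow> C * \<bar>a - a\<bar>) (at a)" by (intro tendsto_intros)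
    then show "((\<lambda>x. C * \<bar>x - a\<bar>) \<longlongrightarrow> 0) (at a)" by simp
  qed
  then show ?thesis by (simp add: has_field_derivative_iff fa)
qed

lemma DERIV_flat_bump:
  "\<exists>Q. \<forall>x. (flat_bump P k has_real_derivative flat_bump Q (k + 2) x) (at x)"
proof -
  define W :: "real poly" where "W = [:0, 1, -1:]"
  define W' :: "real poly" where "W' = [:1, -2:]"
  define Q where "Q = pderiv P * W ^ 2 - smult (real k) (P * W' * W) + P * W'"
  obtain C where C: "\<And>x. \<bar>flat_bump P k x\<bar> \<le> C * x\<^sup>2" "\<And>x. \<bar>flat_bump P k x\<bar> \<le> C * (x - 1)\<^sup>2"
    using flat_bump_bound by blast
  have "(flat_bump P k has_real_derivative flat_bump Q (k + 2) x) (at x)" for x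
  proof -
    consider "x = 0" | "x = 1" | "x < 0 \<or> x > 1" | "0 < x" "x < 1" by linarith
    then show ?thesis
    proof cases
      case 1
      then show ?thesis using DERIV_zero_if_quadratic[of "flat_bump P k" C 0] C(1)
        by (simp add: flat_bump_def)
    next
      case 2
      then show ?thesis using DERIV_zero_if_quadratic[of "flat_bump P k" C 1] C(2)
        by (simp add: flat_bump_def)
    next
      case 3
      have "((\<lambda>_. 0) has_real_derivative flat_bump Q (k + 2) x) (at x)"
        using 3 by (auto simp: flat_bump_def)
      then show ?thesis
      proof (rule has_field_derivative_transform_within_open[where S = "- {0..1}"])
        show "x \<in> - {0..1}" using 3 by auto
        show "0 = flat_bump P k y" if "y \<in> - {0..1}" for y using that by (auto simp: flat_bump_def)
      qed auto
    next
      case 4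
      define w where "w = x * (1 - x)"
      define u where "u = inverse w"
      have w: "w \<noteq> 0" using 4 by (simp add: w_def)
      have wu: "w * u = 1" using w by (simp add: u_def)
      have du: "((\<lambda>x. inverse (x * (1 - x))) has_real_derivative - ((1 - 2 * x) * u\<^sup>2)) (at x)"
      proof -
        have "((\<lambda>x. x * (1 - x)) has_real_derivative 1 - 2 * x) (at x)"
          by (auto intro!: derivative_eq_intros)
        from DERIV_inverse_fun[OF this] w show ?thesis
          by (simp add: w_def u_def power_inverse numeral_2_eq_2)
      qed
      have dk: "((\<lambda>x. inverse (x * (1 - x)) ^ k) has_real_derivative - (real k * (1 - 2 * x) * u ^ (k + 1))) (at x)"
      proof (cases k)
        case (Suc j)
        show ?thesis unfolding Suc by (rule derivative_eq_intros du refl)+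
            (simp add: u_def[unfolded w_def] w_def power2_eq_square algebra_simps)
      qed simp
      have "((\<lambda>x. poly P x * inverse (x * (1 - x)) ^ k * exp (- inverse (x * (1 - x)))) has_real_derivative
          (poly (pderiv P) x * u ^ k + poly P x * (- (real k * (1 - 2 * x) * u ^ (k + 1)))) * exp (- u)
            + poly P x * u ^ k * (exp (- u) * ((1 - 2 * x) * u\<^sup>2))) (at x)"
        by (rule derivative_eq_intros du dk poly_DERIV refl)+ (simp add: u_def w_def algebra_simps)
      also have "(poly (pderiv P) x * u ^ k + poly P x * (- (real k * (1 - 2 * x) * u ^ (k + 1)))) * exp (- u)
            + poly P x * u ^ k * (exp (- u) * ((1 - 2 * x) * u\<^sup>2)) = flat_bump Q (k + 2) x"
      proof -
        have Qx: "poly Q x = poly (pderiv P) x * w\<^sup>2 - real k * (poly P x * (1 - 2 * x) * w) + poly P x * (1 - 2 * x)"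
          by (simp add: Q_def W_def W'_def w_def algebra_simps)
        have wu2: "w\<^sup>2 * u ^ (k + 2) = u ^ k"
          using wu by (metis (no_types, lifting) mult.left_commute mult.right_neutral power_add power_mult_distrib power_one)
        have wu1: "w * u ^ (k + 2) = u ^ (k + 1)"
          using wu by (simp add: mult.assoc[symmetric])
        have "flat_bump Q (k + 2) x = poly Q x * u ^ (k + 2) * exp (- u)"
          using 4 by (simp add: flat_bump_def u_def w_def)
        also have "\<dots> = (poly (pderiv P) x * (w\<^sup>2 * u ^ (k + 2)) - real k * (poly P x * (1 - 2 * x)) * (w * u ^ (k + 2))
            + poly P x * (1 - 2 * x) * u ^ (k + 2)) * exp (- u)"
          unfolding Qx by (simp add: algebra_simps)
        also have "\<dots> = (poly (pderiv P) x * u ^ k + poly P x * (- (real k * (1 - 2 * x) * u ^ (k + 1)))) * exp (- u)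
            + poly P x * u ^ k * (exp (- u) * ((1 - 2 * x) * u\<^sup>2))"
          unfolding wu1 wu2 by (simp add: power_add algebra_simps power2_eq_square)
        finally show ?thesis by simp
      qed
      finally have "((\<lambda>x. poly P x * inverse (x * (1 - x)) ^ k * exp (- inverse (x * (1 - x))))
          has_real_derivative flat_bump Q (k + 2) x) (at x)" .
      then show ?thesis
        by (rule has_field_derivative_transform_within_open[where S = "{0<..<1}"])
          (use 4 in \<open>auto simp: flat_bump_def\<close>)
    qed
  qed
  then show ?thesis by blast
qed

lemma Ck_on_flat_bump: "Ck_on n UNIV (\<lambda>x. flat_bump P k (a * x + b))"
proof (induction n arbitrary: P k)
  case 0
  obtain Q where Q: "\<And>x. (flat_bump P k has_real_derivative flat_bump Q (k + 2) x) (at x)"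
    using DERIV_flat_bump by blast
  have "continuous_on UNIV (flat_bump P k)"
    using Q by (intro DERIV_continuous_on) (auto intro: has_field_derivative_at_within)
  moreover have "continuous_on UNIV (\<lambda>x. a * x + b)" by (intro continuous_intros)
  ultimately have "continuous_on UNIV (\<lambda>x. flat_bump P k (a * x + b))"
    by (rule continuous_on_compose2) auto
  then show ?case by simp
next
  case (Suc n)
  obtain Q where Q: "\<And>x. (flat_bump P k has_real_derivative flat_bump Q (k + 2) x) (at x)"
    using DERIV_flat_bump by blast
  show ?case
  proof (rule Ck_on_real_SucI)
    show "((\<lambda>x. flat_bump P k (a * x + b)) has_real_derivative flat_bump (smult a Q) (k + 2) (a * x + b)) (at x)" for x
      by (rule DERIV_chain2[OF Q, THEN DERIV_cong])
        (auto intro!: derivative_eq_intros simp: flat_bump_def)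
  qed (rule Suc)
qed

text \<open>The normalised antiderivative of the bump supported in \<open>[0, 1]\<close>.  Smoothness is stated for all affine
  rescalings because these are what the cutoff functions below are made of.\<close>
lemma smooth_step:
  obtains \<sigma> \<eta> :: "real \<Rightarrow> real"
  where "\<And>x. (\<sigma> has_real_derivative \<eta> x) (at x)"
    and "\<And>a b. smooth_on UNIV (\<lambda>x. \<sigma> (a * x + b))"
    and "\<And>x. x \<le> 0 \<Longrightarrow> \<sigma> x = 0" and "\<And>x. x \<ge> 1 \<Longrightarrow> \<sigma> x = 1"
    and "\<And>x. 0 \<le> \<sigma> x" and "\<And>x. \<sigma> x \<le> 1"
    and "continuous_on UNIV \<eta>" and "\<And>x. x \<notin> {0..1} \<Longrightarrow> \<eta> x = 0"
proof -
  define \<beta> where "\<beta> = flat_bump 1 0"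
  have cont: "continuous_on UNIV \<beta>" using Ck_on_flat_bump[of 0 1 0 1 0] by (simp add: \<beta>_def)
  have "\<exists>F. \<forall>x::real. -\<infinity> < ereal x \<longrightarrow> ereal x < \<infinity> \<longrightarrow> (F has_vector_derivative \<beta> x) (at x)"
    using cont by (intro einterval_antiderivative) (auto simp: continuous_on_eq_continuous_at)
  then obtain F where F: "\<And>x. (F has_real_derivative \<beta> x) (at x)"
    by (auto simp: has_real_derivative_iff_has_vector_derivative)
  have \<beta>0: "\<beta> x = 0" if "x \<notin> {0<..<1}" for x using that by (auto simp: \<beta>_def flat_bump_def)
  have \<beta>nn: "0 \<le> \<beta> x" for x by (auto simp: \<beta>_def flat_bump_def)
  have mono: "F x \<le> F y" if "x \<le> y" for x y
    using that F \<beta>nn by (intro DERIV_nonneg_imp_nondecreasing[of x y F]) blast+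
  have const: "F x = F y" if "x \<le> y" "y \<le> 0 \<or> x \<ge> 1" for x y
  proof (cases "x = y")
    case False
    then have "x < y" using that by simp
    then obtain z where "x < z" "z < y" "F y - F x = (y - x) * \<beta> z"
      using MVT2[of x y F \<beta>] F by blast
    then show ?thesis using that(2) \<beta>0[of z] by auto
  qed simp
  have "\<exists>z>0. z < 1 \<and> F 1 - F 0 = (1 - 0) * \<beta> z" using F by (intro MVT2) auto
  then obtain z where "0 < z" "z < 1" "F 1 - F 0 = \<beta> z" by auto
  moreover from this have "\<beta> z > 0" by (simp add: \<beta>_def flat_bump_def)
  ultimately have c: "F 1 - F 0 > 0" by simp
  define \<sigma> where "\<sigma> x = (F x - F 0) / (F 1 - F 0)" for x
  define \<eta> where "\<eta> x = \<beta> x / (F 1 - F 0)" for x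
  have d: "(\<sigma> has_real_derivative \<eta> x) (at x)" for x
    unfolding \<sigma>_def \<eta>_def by (rule derivative_eq_intros F refl)+ (use c in auto)
  show ?thesis
  proof (rule that[of \<sigma> \<eta>])
    show "smooth_on UNIV (\<lambda>x. \<sigma> (a * x + b))" for a b
      unfolding smooth_on_def
    proof
      fix k
      have "continuous_on UNIV \<sigma>"
        using d by (intro DERIV_continuous_on) (auto intro: has_field_derivative_at_within)
      moreover have "continuous_on UNIV (\<lambda>x. a * x + b)" by (intro continuous_intros)
      ultimately have "continuous_on UNIV (\<lambda>x. \<sigma> (a * x + b))"
        by (rule continuous_on_compose2) auto
      then have cont: "Ck_on 0 UNIV (\<lambda>x. \<sigma> (a * x + b))" by simp
      show "Ck_on k UNIV (\<lambda>x. \<sigma> (a * x + b))"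
      proof (cases k)
        case 0
        then show ?thesis using cont by simp
      next
        case (Suc j)
        have "Ck_on j UNIV (\<lambda>x. a * \<eta> (a * x + b))"
          using Ck_on_comb[OF Ck_on_flat_bump Ck_on_flat_bump, of j "a / (F 1 - F 0)" 1 0 a b 0 1 0 1 0]
          by (simp add: \<eta>_def \<beta>_def)
        moreover have "((\<lambda>x. \<sigma> (a * x + b)) has_real_derivative a * \<eta> (a * x + b)) (at x)" for x
          by (rule DERIV_chain2[OF d, THEN DERIV_cong]) (auto intro!: derivative_eq_intros)
        ultimately show ?thesis unfolding Suc by (intro Ck_on_real_SucI)
      qed
    qed
    show "\<sigma> x = 0" if "x \<le> 0" for x using const[of x 0] that by (simp add: \<sigma>_def)
    show "\<sigma> x = 1" if "x \<ge> 1" for x using const[of 1 x] that c by (simp add: \<sigma>_def)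
    show "0 \<le> \<sigma> x" for x
    proof -
      have "F 0 \<le> F x" by (cases "x \<ge> 0") (use mono const[of x 0] in auto)
      then show ?thesis using c by (simp add: \<sigma>_def)
    qed
    show "\<sigma> x \<le> 1" for x
    proof -
      have "F x \<le> F 1" by (cases "x \<le> 1") (use mono const[of 1 x] in auto)
      then show ?thesis using c by (simp add: \<sigma>_def)
    qed
    show "continuous_on UNIV \<eta>" unfolding \<eta>_def using c by (intro continuous_intros cont) auto
    show "\<eta> x = 0" if "x \<notin> {0..1}" for x using \<beta>0[of x] that by (auto simp: \<eta>_def)
  qed (rule d)
qed

section \<open>Functions with a weak derivative\<close>

lemma lebesgue_on_integral_lborel:
  fixes f :: "'a::euclidean_space \<Rightarrow> 'b::euclidean_space"
  assumes S: "S \<in> sets borel" and f: "f \<in> borel_measurable borel" and f0: "\<And>x. x \<notin> S \<Longrightarrow> f x = 0"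
  shows "(LINT x|lebesgue_on S. f x) = (LINT x|lborel. f x)"
proof -
  have "(LINT x|lebesgue_on S. f x) = (LINT x|lebesgue. indicator S x *\<^sub>R f x)"
    using S by (subst integral_restrict_space) auto
  also have "(\<lambda>x. indicator S x *\<^sub>R f x) = f" using f0 by (auto simp: indicator_def)
  also have "(LINT x|lebesgue. f x) = (LINT x|lborel. f x)"
    using f by (intro integral_completion) auto
  finally show ?thesis .
qed

text \<open>After the substitution \<open>u = n (r - s) + c\<close> the integrand is \<open>\<eta> u * m (s + (u - c) / n)\<close>, to which
  dominated convergence applies.  The shift \<open>c\<close> moves the support of the kernel to one side of \<open>s\<close>.\<close>
lemma integral_mollifier:
  fixes m \<eta> :: "real \<Rightarrow> real"
  assumes \<eta>: "continuous_on UNIV \<eta>" "\<And>x. x \<notin> {0..1} \<Longrightarrow> \<eta> x = 0"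
    and m: "continuous_on UNIV m" "\<And>x. \<bar>m x\<bar> \<le> B"
  shows "(\<lambda>n. LINT r|lborel. real n * \<eta> (real n * (r - s) + c) * m r) \<longlonglongrightarrow> (LINT u|lborel. \<eta> u) * m s"
proof -
  let ?c = "\<lambda>n r. real n * (r - s) + c"
  have [measurable]: "\<eta> \<in> borel_measurable borel" "m \<in> borel_measurable borel"
    using \<eta>(1) m(1) by (auto intro: borel_measurable_continuous_onI)
  have int: "integrable lborel \<eta>"
  proof -
    have "set_integrable lborel {0..1} \<eta>"
      by (rule borel_integrable_atLeastAtMost') (rule continuous_on_subset[OF \<eta>(1)], simp)
    moreover have "(\<lambda>x. indicator {0..1} x *\<^sub>R \<eta> x) = \<eta>"
    proof
      show "indicator {0..1} x *\<^sub>R \<eta> x = \<eta> x" for x using \<eta>(2)[of x] by (cases "x \<in> {0..1}") auto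
    qed
    ultimately show ?thesis by (simp add: set_integrable_def)
  qed
  have "(\<lambda>n. LINT u|lborel. \<eta> u * m (s + (u - c) / real n)) \<longlonglongrightarrow> (LINT u|lborel. \<eta> u * m s)"
  proof (rule integral_dominated_convergence)
    show "integrable lborel (\<lambda>u. \<bar>\<eta> u\<bar> * B)" using int by simp
    show "AE u in lborel. (\<lambda>n. \<eta> u * m (s + (u - c) / real n)) \<longlonglongrightarrow> \<eta> u * m s"
    proof (intro AE_I2 tendsto_mult_left)
      fix u
      have "(\<lambda>n. s + (u - c) / real n) \<longlonglongrightarrow> s + 0"
        by (intro tendsto_add tendsto_const real_tendsto_divide_at_top[OF tendsto_const] filterlim_real_sequentially)
      then have "(\<lambda>n. s + (u - c) / real n) \<longlonglongrightarrow> s" by simp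
      then show "(\<lambda>n. m (s + (u - c) / real n)) \<longlonglongrightarrow> m s"
        using m(1) by (intro isCont_tendsto_compose[where g = m]) (auto simp: continuous_on_eq_continuous_at)
    qed
    show "AE u in lborel. norm (\<eta> u * m (s + (u - c) / real n)) \<le> \<bar>\<eta> u\<bar> * B" for n
      using m(2) by (auto simp: abs_mult intro!: mult_left_mono)
  qed measurable
  moreover have "\<forall>\<^sub>F n in sequentially. (LINT u|lborel. \<eta> u * m (s + (u - c) / real n))
      = (LINT r|lborel. real n * \<eta> (?c n r) * m r)"
    using eventually_gt_at_top[of 0]
  proof eventually_elim
    case (elim n)
    have "(LINT r|lborel. real n * \<eta> (?c n r) * m r)
        = \<bar>1 / real n\<bar> *\<^sub>R (LINT u|lborel. real n * \<eta> (real n * ((s - c / real n + 1 / real n * u) - s) + c)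
            * m (s - c / real n + 1 / real n * u))"
      using elim by (intro lborel_integral_real_affine) auto
    also have "\<dots> = (LINT u|lborel. \<eta> u * m (s + (u - c) / real n))"
    proof -
      have "real n * ((s - c / real n + 1 / real n * u) - s) + c = u" for u
        using elim by (simp add: algebra_simps)
      moreover have "s - c / real n + 1 / real n * u = s + (u - c) / real n" for u
        by (simp add: diff_divide_distrib)
      ultimately have "(LINT u|lborel. real n * \<eta> (real n * ((s - c / real n + 1 / real n * u) - s) + c)
            * m (s - c / real n + 1 / real n * u)) = real n * (LINT u|lborel. \<eta> u * m (s + (u - c) / real n))"
        by (simp only: mult.assoc integral_mult_right_zero)
      then show ?thesis using elim by simp
    qed
    finally show ?case by simp
  qed
  ultimately show ?thesis by (simp add: Lim_transform_eventually)
qed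

text \<open>The indicator function of \<open>(s, t)\<close> is approximated by smooth cutoff functions that rise from \<open>0\<close> to
  \<open>1\<close> on \<open>[s + 1/n, s + 2/n]\<close> and fall back on \<open>[t - 2/n, t - 1/n]\<close>.  Their supports stay away from \<open>s\<close> and
  \<open>t\<close>, so that the end points \<open>0\<close> and \<open>T\<close> are included.\<close>
theorem weak_derivative_imp_difference:
  fixes m k :: "real \<Rightarrow> real"
  assumes m: "continuous_on {0..T} m" and k: "integrable (lebesgue_on {0<..<T}) k"
    and weak: "\<And>\<theta>. test_function {0<..<T} \<theta> \<Longrightarrow>
      (LINT t|lebesgue_on {0<..<T}. deriv \<theta> t * m t) = - (LINT t|lebesgue_on {0<..<T}. \<theta> t * k t)"
    and st: "0 \<le> s" "s < t" "t \<le> T"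
  shows "m t - m s = (LINT r|lebesgue_on {s<..<t}. k r)"
proof -
  let ?I = "lebesgue_on {0<..<T}"
  obtain \<sigma> \<eta> :: "real \<Rightarrow> real" where \<sigma>: "\<And>x. (\<sigma> has_real_derivative \<eta> x) (at x)"
      "\<And>a b. smooth_on UNIV (\<lambda>x. \<sigma> (a * x + b))"
      "\<And>x. x \<le> 0 \<Longrightarrow> \<sigma> x = 0" "\<And>x. x \<ge> 1 \<Longrightarrow> \<sigma> x = 1" "\<And>x. 0 \<le> \<sigma> x" "\<And>x. \<sigma> x \<le> 1"
    and \<eta>: "continuous_on UNIV \<eta>" "\<And>x. x \<notin> {0..1} \<Longrightarrow> \<eta> x = 0"
    by (rule smooth_step) blast
  have int\<eta>: "(LINT u|lborel. \<eta> u) = 1"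
  proof -
    have "(LINT u|lborel. \<eta> u * indicator {0..1} u) = \<sigma> 1 - \<sigma> 0"
      using \<eta>(1) by (intro integral_FTC_Icc_real \<sigma>(1)) (auto simp: continuous_on_eq_continuous_at)
    moreover have "(\<lambda>u. \<eta> u * indicator {0..1} u) = \<eta>"
    proof
      show "\<eta> u * indicator {0..1} u = \<eta> u" for u using \<eta>(2)[of u] by (cases "u \<in> {0..1}") auto
    qed
    ultimately show ?thesis using \<sigma>(3)[of 0] \<sigma>(4)[of 1] by simp
  qed
  \<comment> \<open>\<open>m\<close> is extended continuously to the whole line\<close>
  define M where "M r = m (max 0 (min T r))" for r
  have M: "continuous_on UNIV M" unfolding M_def
    by (rule continuous_on_compose2[OF m]) (intro continuous_intros, use st in auto)
  have "bounded (m ` {0..T})" by (intro compact_imp_bounded compact_continuous_image m) auto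
  then obtain B where "\<And>x. x \<in> {0..T} \<Longrightarrow> \<bar>m x\<bar> \<le> B"
    unfolding bounded_iff by (metis image_eqI real_norm_def)
  then have B: "\<bar>M x\<bar> \<le> B" for x using st by (simp add: M_def)
  have MT: "M r = m r" if "r \<in> {0..T}" for r using that by (simp add: M_def)
  have [measurable]: "\<eta> \<in> borel_measurable borel" "M \<in> borel_measurable borel"
    using \<eta>(1) M by (auto intro: borel_measurable_continuous_onI)
  have \<sigma>cont: "continuous_on UNIV \<sigma>"
    using \<sigma>(1) by (intro DERIV_continuous_on) (auto intro: has_field_derivative_at_within)
  then have [measurable]: "\<sigma> \<in> borel_measurable borel" by (rule borel_measurable_continuous_onI)
  define \<theta> where "\<theta> n r = \<sigma> (real n * (r - s) + -1) - \<sigma> (real n * (r - t) + 2)" for n r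
  define \<theta>' where "\<theta>' n r = real n * \<eta> (real n * (r - s) + -1) - real n * \<eta> (real n * (r - t) + 2)" for n r
  have [measurable]: "\<theta> n \<in> borel_measurable borel" "\<theta>' n \<in> borel_measurable borel" for n
    unfolding \<theta>_def \<theta>'_def by measurable
  have d\<theta>: "(\<theta> n has_real_derivative \<theta>' n r) (at r)" for n r
    unfolding \<theta>_def \<theta>'_def by (rule derivative_eq_intros DERIV_chain2[OF \<sigma>(1)] refl)+ simp
  have \<theta>_le: "\<bar>\<theta> n r\<bar> \<le> 1" for n r
    using \<sigma>(5,6)[of "real n * (r - s) + -1"] \<sigma>(5,6)[of "real n * (r - t) + 2"] by (simp add: \<theta>_def)
  \<comment> \<open>from this index on the rising and the falling part of \<open>\<theta> n\<close> do not overlap\<close>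
  define n0 where "n0 = nat \<lceil>3 / (t - s)\<rceil> + 1"
  have n0: "real n * (t - s) \<ge> 3" "n > 0" if "n \<ge> n0" for n
  proof -
    have "3 / (t - s) \<le> real n" using that unfolding n0_def by linarith
    then show "real n * (t - s) \<ge> 3" using st by (simp add: field_simps)
    show "n > 0" using that by (simp add: n0_def)
  qed
  have left: "\<theta> n r = 0" "\<theta>' n r = 0" if "n \<ge> n0" "r < s + 1 / real n" for n r
  proof -
    have a: "real n * (r - s) < 1" using that n0(2)[of n] by (simp add: field_simps)
    then have b: "real n * (r - t) + 2 < 0" using n0(1)[OF that(1)] by (simp add: algebra_simps)
    show "\<theta> n r = 0" using a b by (simp add: \<theta>_def \<sigma>(3))
    show "\<theta>' n r = 0" using a b by (simp add: \<theta>'_def \<eta>(2))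
  qed
  have right: "\<theta> n r = 0" "\<theta>' n r = 0" if "n \<ge> n0" "r > t - 1 / real n" for n r
  proof -
    have a: "real n * (r - t) > -1" using that n0(2)[of n] by (simp add: field_simps)
    then have b: "real n * (r - s) + -1 > 1" using n0(1)[OF that(1)] by (simp add: algebra_simps)
    show "\<theta> n r = 0" using a b by (simp add: \<theta>_def \<sigma>(4))
    show "\<theta>' n r = 0" using a b by (simp add: \<theta>'_def \<eta>(2))
  qed
  have out: "r \<in> {0<..<T}" if "n \<ge> n0" "s + 1 / real n \<le> r" "r \<le> t - 1 / real n" for n r
  proof -
    have "1 / real n > 0" using n0(2)[OF that(1)] by simp
    then have "0 < r" "r < T" using that(2,3) st by linarith+
    then show ?thesis by simp
  qed
  have test: "test_function {0<..<T} (\<theta> n)" if n: "n \<ge> n0" for n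
    unfolding test_function_def
  proof (intro conjI)
    have "smooth_on UNIV (\<lambda>r. 1 * \<sigma> (real n * r + (- real n * s - 1)) + (-1) * \<sigma> (real n * r + (- real n * t + 2)))"
      by (intro smooth_on_comb \<sigma>(2))
    moreover have "(\<lambda>r. 1 * \<sigma> (real n * r + (- real n * s - 1)) + (-1) * \<sigma> (real n * r + (- real n * t + 2))) = \<theta> n"
      by (auto simp: \<theta>_def algebra_simps)
    ultimately show "smooth_on UNIV (\<theta> n)" by simp
    have sub: "closure {r. \<theta> n r \<noteq> 0} \<subseteq> {s + 1 / real n..t - 1 / real n}"
      by (rule closure_minimal) (use left(1)[OF n] right(1)[OF n] in \<open>force simp: not_le\<close>, simp)
    then show "compact (closure {r. \<theta> n r \<noteq> 0})"
      by (meson bounded_subset closed_closure compact_eq_bounded_closed compact_Icc)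
    show "closure {r. \<theta> n r \<noteq> 0} \<subseteq> {0<..<T}" using sub out[OF n] by fastforce
  qed
  have supp: "\<theta>' n r = 0" if "n \<ge> n0" "r \<notin> {0<..<T}" for n r
    using that left(2)[of n r] right(2)[of n r] out[of n r] by (meson not_le)
  have "(\<lambda>n. (LINT r|lborel. real n * \<eta> (real n * (r - s) + -1) * M r)
        - (LINT r|lborel. real n * \<eta> (real n * (r - t) + 2) * M r)) \<longlonglongrightarrow> 1 * M s - 1 * M t"
    unfolding int\<eta>[symmetric] by (intro tendsto_diff integral_mollifier[OF \<eta> M B])
  moreover have "\<forall>\<^sub>F n in sequentially. (LINT r|lborel. real n * \<eta> (real n * (r - s) + -1) * M r)
        - (LINT r|lborel. real n * \<eta> (real n * (r - t) + 2) * M r)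
      = - (LINT r|?I. \<theta> n r * k r)"
    using eventually_ge_at_top[of n0]
  proof eventually_elim
    case (elim n)
    have n: "real n \<noteq> 0" using n0(2)[OF elim] by simp
    have ints: "integrable lborel (\<lambda>r. real n * \<eta> (real n * (r - s') + c) * M r)" for s' c
    proof -
      have "set_integrable lborel {s' - c / real n..s' + (1 - c) / real n} (\<lambda>r. real n * \<eta> (real n * (r - s') + c) * M r)"
      proof (rule borel_integrable_atLeastAtMost')
        have "continuous_on UNIV (\<lambda>r. \<eta> (real n * (r - s') + c))"
          by (rule continuous_on_compose2[OF \<eta>(1)]) (intro continuous_intros, simp)
        then have "continuous_on UNIV (\<lambda>r. real n * \<eta> (real n * (r - s') + c) * M r)"
          by (intro continuous_intros M)
        then show "continuous_on {s' - c / real n..s' + (1 - c) / real n} (\<lambda>r. real n * \<eta> (real n * (r - s') + c) * M r)"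
          by (rule continuous_on_subset) simp
      qed
      moreover have "(\<lambda>r. indicator {s' - c / real n..s' + (1 - c) / real n} r *\<^sub>R (real n * \<eta> (real n * (r - s') + c) * M r))
          = (\<lambda>r. real n * \<eta> (real n * (r - s') + c) * M r)"
      proof
        fix r
        have "\<eta> (real n * (r - s') + c) = 0" if "r \<notin> {s' - c / real n..s' + (1 - c) / real n}"
        proof (rule \<eta>(2))
          show "real n * (r - s') + c \<notin> {0..1}"
            using that n0(2)[OF elim] by (auto simp: field_simps)
        qed
        then show "indicator {s' - c / real n..s' + (1 - c) / real n} r *\<^sub>R (real n * \<eta> (real n * (r - s') + c) * M r)
            = real n * \<eta> (real n * (r - s') + c) * M r"
          by (auto simp: indicator_def)
      qed
      ultimately show ?thesis by (simp add: set_integrable_def)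
    qed
    have "(LINT r|lborel. real n * \<eta> (real n * (r - s) + -1) * M r)
        - (LINT r|lborel. real n * \<eta> (real n * (r - t) + 2) * M r) = (LINT r|lborel. \<theta>' n r * M r)"
      unfolding \<theta>'_def left_diff_distrib by (rule Bochner_Integration.integral_diff[OF ints ints, symmetric])
    also have "\<dots> = (LINT r|?I. \<theta>' n r * M r)"
      using supp[OF elim] by (intro lebesgue_on_integral_lborel[symmetric]) auto
    also have "\<dots> = (LINT r|?I. deriv (\<theta> n) r * m r)"
      by (rule Bochner_Integration.integral_cong) (auto simp: MT DERIV_imp_deriv[OF d\<theta>])
    also have "\<dots> = - (LINT r|?I. \<theta> n r * k r)" by (rule weak[OF test[OF elim]])
    finally show ?case .
  qed
  ultimately have "(\<lambda>n. - (LINT r|?I. \<theta> n r * k r)) \<longlonglongrightarrow> M s - M t"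
    by (simp add: Lim_transform_eventually)
  moreover have "(\<lambda>n. - (LINT r|?I. \<theta> n r * k r))
      \<longlonglongrightarrow> - (LINT r|?I. indicator {s<..<t} r * k r)"
  proof (rule tendsto_minus, rule integral_dominated_convergence)
    have [measurable]: "k \<in> borel_measurable ?I" using k by simp
    have [measurable]: "\<theta> n \<in> borel_measurable ?I" for n
      by (intro measurable_restrict_space1 measurable_completion) measurable
    have [measurable]: "indicator {s<..<t} \<in> borel_measurable ?I"
      by (intro measurable_restrict_space1 measurable_completion) measurable
    show "(\<lambda>r. indicator {s<..<t} r * k r) \<in> borel_measurable ?I" by measurable
    show "(\<lambda>r. \<theta> n r * k r) \<in> borel_measurable ?I" for n by measurable
    show "integrable ?I (\<lambda>r. \<bar>k r\<bar>)" using k by simp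
    show "AE r in ?I. norm (\<theta> n r * k r) \<le> \<bar>k r\<bar>" for n
      using \<theta>_le by (auto simp: abs_mult intro!: mult_left_le_one_le)
    have "(\<lambda>n. \<theta> n r) \<longlonglongrightarrow> indicator {s<..<t} r" for r
    proof (rule tendsto_eventually)
      consider "r \<le> s" | "r \<ge> t" | "s < r" "r < t" by linarith
      then show "\<forall>\<^sub>F n in sequentially. \<theta> n r = indicator {s<..<t} r"
      proof cases
        case 1
        then have "\<theta> n r = indicator {s<..<t} r" if "n \<ge> n0" for n
          using left(1)[OF that, of r] n0(2)[OF that] by (simp add: order_le_less_trans)
        then show ?thesis using eventually_sequentially by blast
      next
        case 2
        then have "\<theta> n r = indicator {s<..<t} r" if "n \<ge> n0" for n
        proof -
          have "1 / real n > 0" using n0(2)[OF that] by simp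
          then have "t - 1 / real n < r" using 2 by linarith
          then show ?thesis using right(1)[OF that] 2 by simp
        qed
        then show ?thesis using eventually_sequentially by blast
      next
        case 3
        have "\<theta> n r = indicator {s<..<t} r" if "n \<ge> nat \<lceil>2 / (r - s)\<rceil> + nat \<lceil>2 / (t - r)\<rceil>" for n
        proof -
          have "2 / (r - s) \<le> real n" "2 / (t - r) \<le> real n" using that by linarith+
          then have "real n * (r - s) + -1 \<ge> 1" "real n * (r - t) + 2 \<le> 0"
            using 3 by (auto simp: field_simps)
          then show ?thesis using 3 by (simp add: \<theta>_def \<sigma>(3,4))
        qed
        then show ?thesis using eventually_sequentially by blast
      qed
    qed
    then show "AE r in ?I. (\<lambda>n. \<theta> n r * k r) \<longlonglongrightarrow> indicator {s<..<t} r * k r"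
      by (intro AE_I2 tendsto_mult_right)
  qed
  ultimately have "M s - M t = - (LINT r|?I. indicator {s<..<t} r * k r)"
    by (rule LIMSEQ_unique)
  moreover have "(LINT r|?I. indicator {s<..<t} r * k r) = (LINT r|lebesgue_on {s<..<t}. k r)"
  proof -
    have "(\<lambda>r. indicator {0<..<T} r *\<^sub>R (indicator {s<..<t} r * k r)) = (\<lambda>r. indicator {s<..<t} r *\<^sub>R k r)"
      using st by (auto simp: indicator_def fun_eq_iff)
    moreover have "(LINT r|?I. indicator {s<..<t} r * k r)
        = (LINT r|lebesgue. indicator {0<..<T} r *\<^sub>R (indicator {s<..<t} r * k r))"
      by (rule integral_restrict_space) simp
    moreover have "(LINT r|lebesgue_on {s<..<t}. k r) = (LINT r|lebesgue. indicator {s<..<t} r *\<^sub>R k r)"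
      by (rule integral_restrict_space) simp
    ultimately show ?thesis by simp
  qed
  ultimately show ?thesis using MT[of s] MT[of t] st by simp
qed

section \<open>Iterated Lebesgue integrals\<close>

text \<open>Completeness of Lebesgue measure.\<close>
lemma lebesgue_on_measurable_AE:
  fixes f g :: "'a::euclidean_space \<Rightarrow> 'b::euclidean_space"
  assumes S: "S \<in> sets lebesgue" and f: "f \<in> borel_measurable (lebesgue_on S)"
    and ae: "AE x in lebesgue_on S. f x = g x"
  shows "g \<in> borel_measurable (lebesgue_on S)"
proof -
  let ?f = "\<lambda>x. if x \<in> S then f x else 0" and ?g = "\<lambda>x. if x \<in> S then g x else 0"
  have f': "?f \<in> borel_measurable lebesgue" using f S by (simp add: borel_measurable_if)
  have ae': "AE x in lebesgue. ?f x = ?g x"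
    using ae S by (subst (asm) AE_restrict_space_iff) (auto elim: eventually_mono)
  have "?g \<in> borel_measurable lebesgue"
  proof (rule measurableI)
    fix A :: "'b set" assume A: "A \<in> sets borel"
    show "?g -` A \<inter> space lebesgue \<in> sets lebesgue"
    proof (rule completion.in_sets_AE)
      show "AE x in lebesgue. x \<in> ?f -` A \<inter> space lebesgue \<longleftrightarrow> x \<in> ?g -` A \<inter> space lebesgue"
        using ae' by eventually_elim auto
      show "?f -` A \<inter> space lebesgue \<in> sets lebesgue" using f' A by (rule measurable_sets)
    qed simp
  qed simp
  then show ?thesis using S by (simp add: borel_measurable_if)
qed

lemma lebesgue_on_borel_measurable:
  "f \<in> borel_measurable borel \<Longrightarrow> f \<in> borel_measurable (lebesgue_on S)"
  by (intro measurable_restrict_space1 measurable_completion) simp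

lemma AE_lebesgue_on_iff:
  fixes S :: "'a::euclidean_space set"
  assumes "S \<in> sets borel"
  shows "(AE x in lebesgue_on S. P x) \<longleftrightarrow> (AE x in lborel. x \<in> S \<longrightarrow> P x)"
  using assms by (subst AE_restrict_space_iff) (auto simp: AE_completion_iff)

lemma lborel_pair_sigma_finite:
  "pair_sigma_finite (lborel :: 'a::euclidean_space measure) (lborel :: 'b::euclidean_space measure)" ..

lemma AE_lborel_section:
  fixes P :: "'a::euclidean_space \<times> 'b::euclidean_space \<Rightarrow> bool"
  assumes "AE p in lborel. P p"
  shows "AE t in lborel. AE x in lborel. P (x, t)"
proof -
  obtain N where N: "N \<in> null_sets (lborel :: ('a \<times> 'b) measure)" "\<And>p. p \<notin> N \<Longrightarrow> P p"
    using assms unfolding eventually_ae_filter by auto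
  have NS: "N \<in> sets (lborel \<Otimes>\<^sub>M lborel :: ('a \<times> 'b) measure)"
    unfolding lborel_prod using N(1) by (rule null_setsD2)
  have "AE p in lborel \<Otimes>\<^sub>M lborel. p \<notin> N" unfolding lborel_prod using N(1) by (rule AE_not_in)
  then have "AE x in lborel. AE t in lborel. (x, t) \<notin> N" by (rule lborel_pair.AE_pair)
  moreover have "{p \<in> space (lborel \<Otimes>\<^sub>M lborel). (fst p, snd p) \<notin> N} \<in> sets (lborel \<Otimes>\<^sub>M lborel)"
    using sets.compl_sets[OF NS] by (simp add: Diff_eq Compl_eq Collect_conj_eq)
  ultimately have "AE t in lborel. AE x in lborel. (x, t) \<notin> N"
    by (subst (asm) lborel_pair.AE_commute) auto
  then show ?thesis using N(2) by (auto elim!: eventually_mono)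
qed

lemma AE_lebesgue_on_section:
  fixes A :: "'a::euclidean_space set" and I :: "'b::euclidean_space set"
  assumes "A \<in> sets borel" "I \<in> sets borel" "AE p in lebesgue_on (A \<times> I). P p"
  shows "AE t in lebesgue_on I. AE x in lebesgue_on A. P (x, t)"
proof -
  have AI: "A \<times> I \<in> sets borel" using assms by (intro borel_Times)
  have "AE p in lborel. p \<in> A \<times> I \<longrightarrow> P p"
    using assms(3) unfolding AE_lebesgue_on_iff[OF AI] .
  from AE_lborel_section[OF this]
  have "AE t in lborel. t \<in> I \<longrightarrow> (AE x in lborel. x \<in> A \<longrightarrow> P (x, t))"
    by (auto elim!: eventually_mono)
  then show ?thesis using assms by (simp add: AE_lebesgue_on_iff)
qed

text \<open>Functions on a space-time cylinder are measurable for the Lebesgue sets of the product, which is larger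
  than the product of the two families of Lebesgue sets.  Fubini's theorem is therefore applied to a
  Borel representative, and holds for the function itself on almost every section.\<close>
lemma lebesgue_on_borel_representative:
  fixes f :: "'a::euclidean_space \<Rightarrow> 'b::euclidean_space"
  assumes S: "S \<in> sets borel" and f: "f \<in> borel_measurable (lebesgue_on S)"
  obtains g where "g \<in> borel_measurable borel" "\<And>x. x \<notin> S \<Longrightarrow> g x = 0" "AE x in lebesgue_on S. f x = g x"
proof -
  let ?f = "\<lambda>x. if x \<in> S then f x else 0"
  have f': "?f \<in> borel_measurable lebesgue" using f S by (simp add: borel_measurable_if)
  have "\<exists>g\<in>borel_measurable lborel. AE x in lborel. ?f x \<bullet> b = g x" for b
    by (intro completion_ex_borel_measurable_real borel_measurable_inner f') simp
  then obtain g where g: "\<And>b. g b \<in> borel_measurable lborel" "\<And>b. AE x in lborel. ?f x \<bullet> b = g b x"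
    by metis
  have [measurable]: "g b \<in> borel_measurable borel" for b using g(1)[of b] by simp
  define h where "h x = indicator S x *\<^sub>R (\<Sum>b\<in>Basis. g b x *\<^sub>R b)" for x
  have "AE x in lborel. \<forall>b\<in>Basis. ?f x \<bullet> b = g b x"
    using g(2) by (intro AE_finite_allI) auto
  then have "AE x in lborel. x \<in> S \<longrightarrow> f x = h x"
  proof eventually_elim
    case (elim x)
    show ?case
    proof
      assume "x \<in> S"
      then have "h x = (\<Sum>b\<in>Basis. (f x \<bullet> b) *\<^sub>R b)"
        using elim by (auto simp: h_def intro!: sum.cong)
      then show "f x = h x" by (simp add: euclidean_representation)
    qed
  qed
  moreover have "h \<in> borel_measurable borel" unfolding h_def using S by measurable
  ultimately show ?thesis using S by (intro that[of h]) (auto simp: h_def AE_lebesgue_on_iff)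
qed

lemma nn_integral_lebesgue_on:
  assumes "S \<in> sets borel"
  shows "(\<integral>\<^sup>+x. f x \<partial>lebesgue_on S) = (\<integral>\<^sup>+x. f x * indicator S x \<partial>lborel)"
  using assms by (subst nn_integral_restrict_space) (auto simp: nn_integral_completion)

lemma L2_borel_representative:
  fixes f :: "'a::euclidean_space \<times> 'c::euclidean_space \<Rightarrow> 'b::euclidean_space"
  assumes A: "A \<in> sets borel" and I: "I \<in> sets borel" and f: "f \<in> L2 (lebesgue_on (A \<times> I))"
  obtains g where "g \<in> borel_measurable borel" "\<And>p. p \<notin> A \<times> I \<Longrightarrow> g p = 0"
    "AE t in lebesgue_on I. AE x in lebesgue_on A. f (x, t) = g (x, t)"
    "integrable lborel (\<lambda>p. (norm (g p))\<^sup>2)"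
    "(LINT p|lborel. (norm (g p))\<^sup>2) = (LINT p|lebesgue_on (A \<times> I). (norm (f p))\<^sup>2)"
proof -
  have AI: "A \<times> I \<in> sets borel" using A I by (rule borel_Times)
  obtain g where g: "g \<in> borel_measurable borel" "\<And>p. p \<notin> A \<times> I \<Longrightarrow> g p = 0"
      "AE p in lebesgue_on (A \<times> I). f p = g p"
    using lebesgue_on_borel_representative[OF AI L2_measurable[OF f]] by blast
  have g': "(\<lambda>p. (norm (g p))\<^sup>2) \<in> borel_measurable borel" using g(1) by measurable
  have gL2: "g \<in> L2 (lebesgue_on (A \<times> I))"
    by (rule L2_cong_AE[OF f lebesgue_on_borel_measurable[OF g(1)] g(3)])
  have "(\<integral>\<^sup>+p. ennreal ((norm (g p))\<^sup>2) \<partial>lborel) = (\<integral>\<^sup>+p. ennreal ((norm (g p))\<^sup>2) * indicator (A \<times> I) p \<partial>lborel)"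
    using g(2) by (intro nn_integral_cong) (auto simp: indicator_def)
  also have "\<dots> = (\<integral>\<^sup>+p. ennreal ((norm (g p))\<^sup>2) \<partial>lebesgue_on (A \<times> I))"
    by (rule nn_integral_lebesgue_on[OF AI, symmetric])
  also have "\<dots> < \<infinity>"
    using L2_integrable[OF gL2] by (subst nn_integral_eq_integral) auto
  finally have int: "integrable lborel (\<lambda>p. (norm (g p))\<^sup>2)" using g' by (intro integrableI_nonneg) auto
  have "(LINT p|lborel. (norm (g p))\<^sup>2) = (LINT p|lebesgue_on (A \<times> I). (norm (g p))\<^sup>2)"
    using g(2) by (intro lebesgue_on_integral_lborel[OF AI g', symmetric]) auto
  also have "\<dots> = (LINT p|lebesgue_on (A \<times> I). (norm (f p))\<^sup>2)"
    using g(3) L2_measurable[OF f] L2_measurable[OF gL2] by (intro integral_cong_AE) auto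
  finally show ?thesis
    using that[OF g(1,2) AE_lebesgue_on_section[OF A I g(3)] int] by blast
qed

lemma nn_integral_lborel_iterated:
  fixes h :: "'a::euclidean_space \<times> 'b::euclidean_space \<Rightarrow> ennreal"
  assumes "h \<in> borel_measurable borel"
  shows "(\<integral>\<^sup>+p. h p \<partial>lborel) = (\<integral>\<^sup>+t. (\<integral>\<^sup>+x. h (x, t) \<partial>lborel) \<partial>lborel)"
proof -
  have "case_prod (\<lambda>x t. h (x, t)) \<in> borel_measurable (lborel \<Otimes>\<^sub>M lborel)"
    using assms by (simp add: lborel_prod)
  from lborel_pair.nn_integral_snd[OF this] show ?thesis by (simp add: lborel_prod)
qed

lemma nn_integral_lebesgue_on_iterated:
  fixes f :: "'a::euclidean_space \<times> 'c::euclidean_space \<Rightarrow> 'b::euclidean_space"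
  assumes A: "A \<in> sets borel" and I: "I \<in> sets borel" and f: "f \<in> borel_measurable (lebesgue_on (A \<times> I))"
  shows "(\<integral>\<^sup>+p. ennreal ((norm (f p))\<^sup>2) \<partial>lebesgue_on (A \<times> I))
    = (\<integral>\<^sup>+t. (\<integral>\<^sup>+x. ennreal ((norm (f (x, t)))\<^sup>2) \<partial>lebesgue_on A) \<partial>lebesgue_on I)"
proof -
  have AI: "A \<times> I \<in> sets borel" using A I by (rule borel_Times)
  obtain g where g[measurable]: "g \<in> borel_measurable borel" and g0: "\<And>p. p \<notin> A \<times> I \<Longrightarrow> g p = 0"
      and fg: "AE p in lebesgue_on (A \<times> I). f p = g p"
    using lebesgue_on_borel_representative[OF AI f] by blast
  have "(\<integral>\<^sup>+p. ennreal ((norm (f p))\<^sup>2) \<partial>lebesgue_on (A \<times> I)) = (\<integral>\<^sup>+p. ennreal ((norm (g p))\<^sup>2) \<partial>lebesgue_on (A \<times> I))"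
    using fg by (intro nn_integral_cong_AE) auto
  also have "\<dots> = (\<integral>\<^sup>+p. ennreal ((norm (g p))\<^sup>2) \<partial>lborel)"
    unfolding nn_integral_lebesgue_on[OF AI]
    using g0 by (intro nn_integral_cong) (auto simp: indicator_def)
  also have "\<dots> = (\<integral>\<^sup>+t. (\<integral>\<^sup>+x. ennreal ((norm (g (x, t)))\<^sup>2) \<partial>lborel) \<partial>lborel)"
    by (rule nn_integral_lborel_iterated) measurable
  also have "\<dots> = (\<integral>\<^sup>+t. (\<integral>\<^sup>+x. ennreal ((norm (g (x, t)))\<^sup>2) \<partial>lebesgue_on A) \<partial>lebesgue_on I)"
  proof -
    have "(\<integral>\<^sup>+x. ennreal ((norm (g (x, t)))\<^sup>2) * indicator A x \<partial>lborel) * indicator I t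
        = (\<integral>\<^sup>+x. ennreal ((norm (g (x, t)))\<^sup>2) \<partial>lborel)" for t
    proof (cases "t \<in> I")
      case True
      then show ?thesis using g0 by (auto simp: indicator_def intro!: nn_integral_cong)
    next
      case False
      then show ?thesis using g0 by simp
    qed
    then show ?thesis unfolding nn_integral_lebesgue_on[OF I] nn_integral_lebesgue_on[OF A] by simp
  qed
  also have "\<dots> = (\<integral>\<^sup>+t. (\<integral>\<^sup>+x. ennreal ((norm (f (x, t)))\<^sup>2) \<partial>lebesgue_on A) \<partial>lebesgue_on I)"
  proof (rule nn_integral_cong_AE)
    show "AE t in lebesgue_on I. (\<integral>\<^sup>+x. ennreal ((norm (g (x, t)))\<^sup>2) \<partial>lebesgue_on A)
        = (\<integral>\<^sup>+x. ennreal ((norm (f (x, t)))\<^sup>2) \<partial>lebesgue_on A)"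
      using AE_lebesgue_on_section[OF A I fg]
    proof eventually_elim
      case (elim t)
      then show ?case by (intro nn_integral_cong_AE) auto
    qed
  qed
  finally show ?thesis .
qed

lemma L2_lborel_sections:
  fixes g :: "'a::euclidean_space \<times> 'c::euclidean_space \<Rightarrow> 'b::euclidean_space"
  assumes g[measurable]: "g \<in> borel_measurable borel" and int: "integrable lborel (\<lambda>p. (norm (g p))\<^sup>2)"
  shows "AE t in lborel. (\<lambda>x. g (x, t)) \<in> L2 lborel"
    and "integrable lborel (\<lambda>t. LINT x|lborel. (norm (g (x, t)))\<^sup>2)"
    and "(LINT t|lborel. LINT x|lborel. (norm (g (x, t)))\<^sup>2) = (LINT p|lborel. (norm (g p))\<^sup>2)"
proof -
  have *: "integrable (lborel \<Otimes>\<^sub>M lborel) (case_prod (\<lambda>x t. (norm (g (x, t)))\<^sup>2))"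
    using int by (simp add: lborel_prod case_prod_unfold)
  have "AE t in lborel. integrable lborel (\<lambda>x. (norm (g (x, t)))\<^sup>2)" by (rule lborel_pair.AE_integrable_snd[OF *])
  then show "AE t in lborel. (\<lambda>x. g (x, t)) \<in> L2 lborel" by eventually_elim (simp add: L2_def)
  show "integrable lborel (\<lambda>t. LINT x|lborel. (norm (g (x, t)))\<^sup>2)" by (rule lborel_pair.integrable_snd[OF *])
  show "(LINT t|lborel. LINT x|lborel. (norm (g (x, t)))\<^sup>2) = (LINT p|lborel. (norm (g p))\<^sup>2)"
    using lborel_pair.integral_snd[OF *] by (simp add: lborel_prod case_prod_unfold)
qed

section \<open>Positivity of the Volterra form\<close>

text \<open>By the symmetry \<open>r \<leftrightarrow> t\<close> the integral over the triangle \<open>r < t\<close> is half of the integral over the square,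
  which is the squared norm of \<open>\<integral>\<^sub>a\<^sup>b g\<close>.\<close>
lemma Volterra_form_nonneg_scalar:
  fixes g :: "real \<Rightarrow> 'b::euclidean_space"
  assumes g: "integrable lborel (\<lambda>r. indicator {a<..<b} r *\<^sub>R g r)"
  shows "0 \<le> (LINT p|lborel. (case p of (r, t) \<Rightarrow>
      indicator {a<..<b} r * indicator {a<..<b} t * of_bool (r < t) * (g r \<bullet> g t)))"
proof -
  define h where "h r = indicator {a<..<b} r *\<^sub>R g r" for r
  have h: "integrable lborel h" using g by (simp add: h_def[abs_def])
  have [measurable]: "h \<in> borel_measurable borel" using h by (simp add: borel_measurable_integrable)
  define f where "f p = (case p of (r, t) \<Rightarrow> of_bool (r < t) * (h r \<bullet> h t))" for p :: "real \<times> real"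
  have full: "integrable (lborel \<Otimes>\<^sub>M lborel) (\<lambda>(r, t). h r \<bullet> h t)"
    and full_eq: "(LINT p|(lborel \<Otimes>\<^sub>M lborel). (case p of (r, t) \<Rightarrow> h r \<bullet> h t)) = (LINT r|lborel. h r) \<bullet> (LINT t|lborel. h t)"
  proof -
    have "integrable (lborel \<Otimes>\<^sub>M lborel) (\<lambda>(r, t). norm (h r) * norm (h t))"
      using h by (intro lborel_pair.Fubini_integrable) (auto simp: abs_mult)
    then show int: "integrable (lborel \<Otimes>\<^sub>M lborel) (\<lambda>(r, t). h r \<bullet> h t)"
      by (rule Bochner_Integration.integrable_bound) (auto simp: abs_mult Cauchy_Schwarz_ineq2)
    show "(LINT p|(lborel \<Otimes>\<^sub>M lborel). (case p of (r, t) \<Rightarrow> h r \<bullet> h t)) = (LINT r|lborel. h r) \<bullet> (LINT t|lborel. h t)"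
      using lborel_pair.integral_fst[OF int, symmetric] h by simp
  qed
  have f_int: "integrable (lborel \<Otimes>\<^sub>M lborel) f"
    using full unfolding f_def by (rule Bochner_Integration.integrable_bound) (auto simp: f_def)
  have swap: "(LINT p|(lborel \<Otimes>\<^sub>M lborel). f (snd p, fst p)) = (LINT p|(lborel \<Otimes>\<^sub>M lborel). f p)"
    using lborel_pair.integral_product_swap[of "f"] f_int by (simp add: case_prod_unfold)
  have swap_int: "integrable (lborel \<Otimes>\<^sub>M lborel) (\<lambda>p. f (snd p, fst p))"
    using lborel_pair.integrable_product_swap[OF f_int] by (simp add: case_prod_unfold)
  have "2 * (LINT p|(lborel \<Otimes>\<^sub>M lborel). f p) = (LINT p|(lborel \<Otimes>\<^sub>M lborel). f p + f (snd p, fst p))"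
    using f_int swap_int swap by simp
  also have "\<dots> = (LINT p|(lborel \<Otimes>\<^sub>M lborel). (case p of (r, t) \<Rightarrow> h r \<bullet> h t))"
  proof (rule integral_cong_AE)
    have "AE r in lborel. AE t in lborel. r \<noteq> (t :: real)"
      using AE_lborel_singleton by (auto simp: eq_commute)
    then have "AE p in lborel \<Otimes>\<^sub>M (lborel :: real measure). fst p \<noteq> snd p"
    proof (intro lborel_pair.AE_pair_measure)
      have "{p :: real \<times> real. fst p \<noteq> snd p} \<in> sets borel"
        by (intro borel_open open_Collect_neq continuous_intros)
      then show "{p \<in> space (lborel \<Otimes>\<^sub>M (lborel :: real measure)). fst p \<noteq> snd p} \<in> sets (lborel \<Otimes>\<^sub>M lborel)"
        unfolding lborel_prod by simp
    qed simp
    then show "AE p in lborel \<Otimes>\<^sub>M lborel. f p + f (snd p, fst p) = (case p of (r, t) \<Rightarrow> h r \<bullet> h t)"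
      by eventually_elim (auto simp: f_def inner_commute)
  qed (use f_int swap_int full in auto)
  also have "\<dots> \<ge> 0" unfolding full_eq by simp
  finally have "0 \<le> (LINT p|(lborel \<Otimes>\<^sub>M lborel). f p)" by simp
  moreover have "f = (\<lambda>p. case p of (r, t) \<Rightarrow>
      indicator {a<..<b} r * indicator {a<..<b} t * of_bool (r < t) * (g r \<bullet> g t))"
    by (auto simp: f_def h_def fun_eq_iff)
  ultimately show ?thesis by (simp add: lborel_prod)
qed

text \<open>The scalar case holds for almost every \<open>x\<close>; the order of integration is then exchanged.\<close>
lemma Volterra_form_nonneg:
  fixes G :: "'a::euclidean_space \<times> real \<Rightarrow> 'b::euclidean_space" and a b :: real
  assumes G[measurable]: "G \<in> borel_measurable borel" and int: "integrable lborel (\<lambda>p. (norm (G p))\<^sup>2)"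
  defines "K \<equiv> \<lambda>t. indicator {a<..<b} t * (LINT r|lborel. indicator {a<..<t} r * (LINT x|lborel. G (x, r) \<bullet> G (x, t)))"
  shows "integrable lborel K" and "0 \<le> (LINT t|lborel. K t)"
proof -
  define H where "H x p = (case p of (r, t) \<Rightarrow>
      indicator {a<..<b} r * indicator {a<..<b} t * of_bool (r < t) * (G (x, r) \<bullet> G (x, t)))"
    for x and p :: "real \<times> real"
  have ind: "integrable lborel (indicator {a<..<b} :: real \<Rightarrow> real)"
    by (rule integrable_real_indicator) (cases "a \<le> b"; simp)+
  have Hm[measurable]: "(\<lambda>(x, p). H x p) \<in> borel_measurable (lborel \<Otimes>\<^sub>M lborel)"
  proof -
    have [measurable]: "G \<in> borel_measurable (borel \<Otimes>\<^sub>M borel)" using G by (simp add: borel_prod)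
    have "(\<lambda>(x, p). H x p) \<in> borel_measurable (borel \<Otimes>\<^sub>M (borel \<Otimes>\<^sub>M borel))"
      unfolding H_def case_prod_unfold by measurable
    then show ?thesis by (simp add: borel_prod lborel_prod)
  qed
  define \<gamma> where "\<gamma> r = (LINT x|lborel. (norm (G (x, r)))\<^sup>2)" for r
  have \<gamma>: "integrable lborel \<gamma>" unfolding \<gamma>_def by (rule L2_lborel_sections[OF G int])
  have sec: "AE r in lborel. (\<lambda>x. G (x, r)) \<in> L2 lborel" by (rule L2_lborel_sections[OF G int])
  have sec2: "AE p in (lborel :: (real \<times> real) measure). (\<lambda>x. G (x, fst p)) \<in> L2 lborel \<and> (\<lambda>x. G (x, snd p)) \<in> L2 lborel"
  proof -
    have m: "{r. (\<lambda>x. G (x, r)) \<in> L2 lborel} \<in> sets borel"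
    proof -
      have "{r \<in> space lborel. integrable lborel (\<lambda>x. (norm (G (x, r)))\<^sup>2)} \<in> sets lborel" by measurable
      moreover have "{r. (\<lambda>x. G (x, r)) \<in> L2 lborel} = {r \<in> space lborel. integrable lborel (\<lambda>x. (norm (G (x, r)))\<^sup>2)}"
        by (auto simp: L2_def)
      ultimately show ?thesis by simp
    qed
    have "AE p in lborel \<Otimes>\<^sub>M lborel. (\<lambda>x. G (x, fst p)) \<in> L2 lborel \<and> (\<lambda>x. G (x, snd p)) \<in> L2 lborel"
    proof (rule lborel_pair.AE_pair_measure)
      have "{p \<in> space (lborel \<Otimes>\<^sub>M lborel). (\<lambda>x. G (x, fst p)) \<in> L2 lborel \<and> (\<lambda>x. G (x, snd p)) \<in> L2 lborel}
          = {r. (\<lambda>x. G (x, r)) \<in> L2 lborel} \<times> {r. (\<lambda>x. G (x, r)) \<in> L2 lborel}"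
        by (auto simp: space_pair_measure)
      then show "{p \<in> space (lborel \<Otimes>\<^sub>M lborel). (\<lambda>x. G (x, fst p)) \<in> L2 lborel \<and> (\<lambda>x. G (x, snd p)) \<in> L2 lborel}
          \<in> sets (lborel \<Otimes>\<^sub>M lborel)"
        using m by (auto intro!: pair_measureI)
      show "AE r in lborel. AE t in lborel. (\<lambda>x. G (x, fst (r, t))) \<in> L2 lborel \<and> (\<lambda>x. G (x, snd (r, t))) \<in> L2 lborel"
        using sec by (auto elim!: eventually_mono)
    qed
    then show ?thesis unfolding lborel_prod .
  qed
  have bound_int: "integrable (lborel :: (real \<times> real) measure)
      (\<lambda>p. indicator {a<..<b} (snd p) * \<gamma> (fst p) + indicator {a<..<b} (fst p) * \<gamma> (snd p))"
  proof -
    have "integrable (lborel \<Otimes>\<^sub>M lborel) (\<lambda>(r, t). \<gamma> r * indicator {a<..<b} t)"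
      using \<gamma> ind by (intro lborel_pair.Fubini_integrable) (auto simp: abs_mult)
    moreover have "integrable (lborel \<Otimes>\<^sub>M lborel) (\<lambda>(r, t). indicator {a<..<b} r * \<gamma> t)"
      using \<gamma> ind by (intro lborel_pair.Fubini_integrable) (auto simp: abs_mult)
    ultimately show ?thesis by (simp add: lborel_prod case_prod_unfold mult.commute)
  qed
  have norm_bound: "integrable lborel (\<lambda>x. H x p)"
      "(LINT x|lborel. norm (H x p)) \<le> indicator {a<..<b} (snd p) * \<gamma> (fst p) + indicator {a<..<b} (fst p) * \<gamma> (snd p)"
    if L: "(\<lambda>x. G (x, fst p)) \<in> L2 lborel" "(\<lambda>x. G (x, snd p)) \<in> L2 lborel" for p
  proof -
    obtain r t where p: "p = (r, t)" by (cases p)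
    have i: "integrable lborel (\<lambda>x. G (x, r) \<bullet> G (x, t))" using L2_inner_integrable[OF L] p by simp
    then show i2: "integrable lborel (\<lambda>x. H x p)" unfolding H_def p by simp
    have "(LINT x|lborel. norm (H x p)) \<le> (LINT x|lborel. indicator {a<..<b} t * (norm (G (x, r)))\<^sup>2 + indicator {a<..<b} r * (norm (G (x, t)))\<^sup>2)"
    proof (rule integral_mono)
      show "integrable lborel (\<lambda>x. norm (H x p))" using i2 by simp
      show "integrable lborel (\<lambda>x. indicator {a<..<b} t * (norm (G (x, r)))\<^sup>2 + indicator {a<..<b} r * (norm (G (x, t)))\<^sup>2)"
        using L2_integrable[OF L(1)] L2_integrable[OF L(2)] p by simp
      fix x
      have "\<bar>G (x, r) \<bullet> G (x, t)\<bar> \<le> norm (G (x, r)) * norm (G (x, t))" by (rule Cauchy_Schwarz_ineq2)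
      also have "\<dots> \<le> (norm (G (x, r)))\<^sup>2 + (norm (G (x, t)))\<^sup>2"
        using sum_squares_bound[of "norm (G (x, r))" "norm (G (x, t))"]
          mult_nonneg_nonneg[OF norm_ge_zero[of "G (x, r)"] norm_ge_zero[of "G (x, t)"]] by linarith
      finally show "norm (H x p) \<le> indicator {a<..<b} t * (norm (G (x, r)))\<^sup>2 + indicator {a<..<b} r * (norm (G (x, t)))\<^sup>2"
        by (auto simp: H_def p indicator_def)
    qed
    also have "\<dots> = indicator {a<..<b} t * \<gamma> r + indicator {a<..<b} r * \<gamma> t"
      using L2_integrable[OF L(1)] L2_integrable[OF L(2)] p by (simp add: \<gamma>_def)
    finally show "(LINT x|lborel. norm (H x p)) \<le> indicator {a<..<b} (snd p) * \<gamma> (fst p) + indicator {a<..<b} (fst p) * \<gamma> (snd p)"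
      by (simp add: p)
  qed
  have H_int: "integrable (lborel \<Otimes>\<^sub>M lborel) (\<lambda>(x, p). H x p)"
  proof -
    have "integrable (lborel \<Otimes>\<^sub>M lborel) (\<lambda>(p, x). H x p)"
    proof (rule pair_sigma_finite.Fubini_integrable)
      show "pair_sigma_finite (lborel :: (real \<times> real) measure) (lborel :: 'a measure)" ..
      show m: "(\<lambda>(p, x). H x p) \<in> borel_measurable (lborel \<Otimes>\<^sub>M lborel)"
        using measurable_pair_swap[OF Hm] by (simp add: case_prod_unfold)
      show "AE p in lborel. integrable lborel (\<lambda>x. case (p, x) of (p, x) \<Rightarrow> H x p)"
        using sec2 by eventually_elim (simp add: norm_bound)
      show "integrable lborel (\<lambda>p. LINT x|lborel. norm (case (p, x) of (p, x) \<Rightarrow> H x p))"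
        using bound_int
      proof (rule Bochner_Integration.integrable_bound)
        show "(\<lambda>p. LINT x|lborel. norm (case (p, x) of (p, x) \<Rightarrow> H x p)) \<in> borel_measurable lborel"
          by (intro lborel.borel_measurable_lebesgue_integral) (use m in \<open>simp add: case_prod_unfold\<close>)
        show "AE p in lborel. norm (LINT x|lborel. norm (case (p, x) of (p, x) \<Rightarrow> H x p))
            \<le> norm (indicator {a<..<b} (snd p) * \<gamma> (fst p) + indicator {a<..<b} (fst p) * \<gamma> (snd p))"
          using sec2
        proof eventually_elim
          case (elim p)
          then show ?case using norm_bound(2)[of p] by (simp add: abs_le_iff integral_nonneg)
        qed
      qed
    qed
    from pair_sigma_finite.integrable_product_swap[OF _ this] show ?thesis
      by (simp add: case_prod_unfold lborel_pair_sigma_finite)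
  qed
  have slice: "integrable (lborel \<Otimes>\<^sub>M lborel) (case_prod (\<lambda>r t. LINT x|lborel. H x (r, t)))"
    using lborel_pair.integrable_snd[OF H_int] by (simp add: lborel_prod case_prod_unfold)
  have Kint: "integrable lborel (\<lambda>t. LINT r|lborel. LINT x|lborel. H x (r, t))"
    by (rule lborel_pair.integrable_snd[OF slice])
  have "0 \<le> (LINT x|lborel. LINT p|lborel. H x p)"
  proof (rule integral_nonneg_AE)
    have "AE x in lborel. integrable lborel (\<lambda>t. (norm (G (x, t)))\<^sup>2)"
    proof -
      show ?thesis
        using lborel_pair.AE_integrable_fst'[of "\<lambda>p. (norm (G p))\<^sup>2"] int by (simp add: lborel_prod)
    qed
    then show "AE x in lborel. 0 \<le> (LINT p|lborel. H x p)"
    proof eventually_elim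
      case (elim x)
      have "integrable lborel (\<lambda>r. indicator {a<..<b} r *\<^sub>R G (x, r))"
      proof (rule Bochner_Integration.integrable_bound)
        show "integrable lborel (\<lambda>r. indicator {a<..<b} r + (norm (G (x, r)))\<^sup>2)"
          using elim ind by (intro Bochner_Integration.integrable_add)
        have "norm (G (x, r)) \<le> 1 + (norm (G (x, r)))\<^sup>2" for r
        proof -
          have "2 * norm (G (x, r)) \<le> 1 + (norm (G (x, r)))\<^sup>2"
            using sum_squares_bound[of 1 "norm (G (x, r))"] by simp
          then show ?thesis using norm_ge_zero[of "G (x, r)"] by linarith
        qed
        then show "AE r in lborel. norm (indicator {a<..<b} r *\<^sub>R G (x, r)) \<le> norm (indicator {a<..<b} r + (norm (G (x, r)))\<^sup>2)"
          by (auto simp: indicator_def)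
      qed measurable
      then show ?case unfolding H_def by (rule Volterra_form_nonneg_scalar)
    qed
  qed
  also have "\<dots> = (LINT p|lborel. LINT x|lborel. H x p)"
    by (rule lborel_pair.Fubini_integral[symmetric]) (rule H_int)
  also have "\<dots> = (LINT t|lborel. LINT r|lborel. LINT x|lborel. H x (r, t))"
    using lborel_pair.integral_snd[OF slice] by (simp add: lborel_prod case_prod_unfold)
  finally have pos: "0 \<le> (LINT t|lborel. LINT r|lborel. LINT x|lborel. H x (r, t))" .
  have "(LINT r|lborel. LINT x|lborel. H x (r, t)) = K t" for t
  proof -
    have "(LINT x|lborel. H x (r, t)) = indicator {a<..<b} t * (indicator {a<..<t} r * (LINT x|lborel. G (x, r) \<bullet> G (x, t)))" for r
    proof -
      have "H x (r, t) = (indicator {a<..<b} t * indicator {a<..<t} r) * (G (x, r) \<bullet> G (x, t))" for x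
        by (auto simp: H_def indicator_def)
      then show ?thesis by simp
    qed
    then show ?thesis by (simp add: K_def)
  qed
  then show "integrable lborel K" "0 \<le> (LINT t|lborel. K t)" using Kint pos by simp_all
qed

section \<open>Linearity of the weak formulation\<close>

lemma L2_tendsto_LINT:
  assumes "\<forall>\<^sub>F i in F. u i \<in> L2 M" "v \<in> L2 M" "L2_tendsto M u v F"
  shows "((\<lambda>i. LINT x|M. (norm (u i x - v x))\<^sup>2) \<longlongrightarrow> 0) F"
proof -
  have "\<forall>\<^sub>F i in F. (\<integral>\<^sup>+x. ennreal ((norm (u i x - v x))\<^sup>2) \<partial>M) = ennreal (LINT x|M. (norm (u i x - v x))\<^sup>2)"
    using assms(1)
  proof eventually_elim
    case (elim i)
    show ?case
      using L2_integrable[OF L2_diff[OF elim assms(2)]] by (intro nn_integral_eq_integral) auto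
  qed
  then have "((\<lambda>i. ennreal (LINT x|M. (norm (u i x - v x))\<^sup>2)) \<longlongrightarrow> ennreal 0) F"
    using assms(3) unfolding L2_tendsto_def by (subst (asm) tendsto_cong) auto
  then show ?thesis
    by (subst (asm) tendsto_ennreal_iff) (auto intro!: always_eventually integral_nonneg_AE)
qed

lemma L2_tendsto_comb:
  assumes meas: "\<forall>\<^sub>F i in F. u i \<in> borel_measurable M" "\<forall>\<^sub>F i in F. u' i \<in> borel_measurable M"
      "v \<in> borel_measurable M" "v' \<in> borel_measurable M"
    and lim: "L2_tendsto M u v F" "L2_tendsto M u' v' F"
  shows "L2_tendsto M (\<lambda>i x. a *\<^sub>R u i x + b *\<^sub>R u' i x) (\<lambda>x. a *\<^sub>R v x + b *\<^sub>R v' x) F"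
proof -
  let ?e = "\<lambda>u v i. \<integral>\<^sup>+x. ennreal ((norm (u i x - v x))\<^sup>2) \<partial>M"
  let ?n = "\<lambda>i x. norm ((a *\<^sub>R u i x + b *\<^sub>R u' i x) - (a *\<^sub>R v x + b *\<^sub>R v' x))"
  let ?p = "\<lambda>i x. (norm (u i x - v x))\<^sup>2" and ?q = "\<lambda>i x. (norm (u' i x - v' x))\<^sup>2"
  let ?r = "\<lambda>i. ennreal (2 * a\<^sup>2) * ?e u v i + ennreal (2 * b\<^sup>2) * ?e u' v' i"
  have "((\<lambda>i. ?r i) \<longlongrightarrow> ennreal (2 * a\<^sup>2) * 0 + ennreal (2 * b\<^sup>2) * 0) F"
    using lim unfolding L2_tendsto_def by (intro tendsto_add ennreal_tendsto_cmult) auto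
  then have lim0: "((\<lambda>i. ?r i) \<longlongrightarrow> 0) F" by simp
  have le: "\<forall>\<^sub>F i in F. (\<integral>\<^sup>+x. ennreal ((?n i x)\<^sup>2) \<partial>M) \<le> ?r i"
    using meas(1,2)
  proof eventually_elim
    case (elim i)
    note [measurable] = elim meas(3,4)
    have "(\<integral>\<^sup>+x. ennreal ((?n i x)\<^sup>2) \<partial>M)
        \<le> (\<integral>\<^sup>+x. ennreal (2 * a\<^sup>2) * ennreal (?p i x) + ennreal (2 * b\<^sup>2) * ennreal (?q i x) \<partial>M)"
    proof (rule nn_integral_mono)
      fix x
      have "?n i x = norm (a *\<^sub>R (u i x - v x) + b *\<^sub>R (u' i x - v' x))"
        by (simp add: algebra_simps)
      also have "\<dots> \<le> \<bar>a\<bar> * norm (u i x - v x) + \<bar>b\<bar> * norm (u' i x - v' x)"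
        by (rule order_trans[OF norm_triangle_ineq]) simp
      finally have "(?n i x)\<^sup>2 \<le> (\<bar>a\<bar> * norm (u i x - v x) + \<bar>b\<bar> * norm (u' i x - v' x))\<^sup>2"
        by (intro power_mono) auto
      also have "\<dots> \<le> 2 * a\<^sup>2 * ?p i x + 2 * b\<^sup>2 * ?q i x"
        using sum_squares_bound[of "\<bar>a\<bar> * norm (u i x - v x)" "\<bar>b\<bar> * norm (u' i x - v' x)"]
        by (simp add: power2_sum power_mult_distrib)
      finally have le: "ennreal ((?n i x)\<^sup>2) \<le> ennreal (2 * a\<^sup>2 * ?p i x + 2 * b\<^sup>2 * ?q i x)"
        by (rule ennreal_leI)
      have "ennreal (2 * a\<^sup>2 * ?p i x) = ennreal (2 * a\<^sup>2) * ennreal (?p i x)"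
        "ennreal (2 * b\<^sup>2 * ?q i x) = ennreal (2 * b\<^sup>2) * ennreal (?q i x)"
        by (rule ennreal_mult; simp)+
      moreover have "ennreal (2 * a\<^sup>2 * ?p i x + 2 * b\<^sup>2 * ?q i x)
          = ennreal (2 * a\<^sup>2 * ?p i x) + ennreal (2 * b\<^sup>2 * ?q i x)"
        by (rule ennreal_plus; simp)
      ultimately show "ennreal ((?n i x)\<^sup>2)
          \<le> ennreal (2 * a\<^sup>2) * ennreal (?p i x) + ennreal (2 * b\<^sup>2) * ennreal (?q i x)"
        using le by argo
    qed
    also have "\<dots> = ?r i" by (simp add: nn_integral_add nn_integral_cmult)
    finally show ?case .
  qed
  show ?thesis
    unfolding L2_tendsto_def by (rule tendsto_sandwich[OF _ le tendsto_const lim0]) simp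
qed

lemma continuous_L2_lebesgue_on:
  fixes f :: "'a::euclidean_space \<Rightarrow> 'b::euclidean_space"
  assumes S: "bounded S" "S \<in> sets borel" and f: "continuous_on UNIV f"
  shows "f \<in> L2 (lebesgue_on S)"
proof -
  have [measurable]: "f \<in> borel_measurable (lebesgue_on S)"
    using f by (intro lebesgue_on_borel_measurable borel_measurable_continuous_onI)
  have "bounded (f ` closure S)"
    using S by (intro compact_imp_bounded compact_continuous_image continuous_on_subset[OF f]) auto
  then obtain C where C: "\<And>x. x \<in> S \<Longrightarrow> norm (f x) \<le> C"
    unfolding bounded_iff using closure_subset by blast
  have "S \<in> lmeasurable" using S by (intro bounded_set_imp_lmeasurable) auto
  then interpret finite_measure "lebesgue_on S" by (rule finite_measure_lebesgue_on)
  have "integrable (lebesgue_on S) (\<lambda>x. (norm (f x))\<^sup>2)"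
    by (rule integrable_const_bound[of _ "C\<^sup>2"]) (use C in \<open>auto intro!: AE_I2 power_mono\<close>)
  then show ?thesis by (simp add: L2_def)
qed

lemma continuous_L2_interval:
  fixes m :: "real \<Rightarrow> real"
  assumes m: "continuous_on {0..T} m"
  shows "m \<in> L2 (lebesgue_on {0<..<T})"
proof (cases "T > 0")
  case True
  have "continuous_on UNIV (\<lambda>r. m (max 0 (min T r)))"
    by (rule continuous_on_compose2[OF m]) (intro continuous_intros, use True in auto)
  then have *: "(\<lambda>r. m (max 0 (min T r))) \<in> L2 (lebesgue_on {0<..<T})"
    by (intro continuous_L2_lebesgue_on) auto
  moreover have "m \<in> borel_measurable (lebesgue_on {0<..<T})"
    using L2_measurable[OF *] by (subst measurable_lebesgue_cong[where g = "\<lambda>r. m (max 0 (min T r))"]) auto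
  ultimately show ?thesis by (rule L2_cong_AE) auto
next
  case False
  then have "m \<in> borel_measurable (lebesgue_on {0<..<T})" by (subst measurable_lebesgue_cong[where g = "\<lambda>_. 0"]) auto
  then show ?thesis using False by (simp add: L2_def)
qed

lemma C_L2_L2: "y \<in> C_L2 \<Omega> T \<Longrightarrow> t \<in> {0..T} \<Longrightarrow> y t \<in> L2 (lebesgue_on \<Omega>)"
  by (simp add: C_L2_def)

lemma C_L2_comb:
  assumes "y1 \<in> C_L2 \<Omega> T" "y2 \<in> C_L2 \<Omega> T"
  shows "(\<lambda>t x. a * y1 t x + b * y2 t x) \<in> C_L2 \<Omega> T"
proof -
  let ?L = "lebesgue_on \<Omega>"
  have m: "(\<lambda>(x, t). y1 t x) \<in> borel_measurable (lebesgue_on (\<Omega> \<times> {0<..<T}))"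
    "(\<lambda>(x, t). y2 t x) \<in> borel_measurable (lebesgue_on (\<Omega> \<times> {0<..<T}))"
    using assms by (auto simp: C_L2_def)
  have "(\<lambda>(x, t). a * y1 t x + b * y2 t x) \<in> borel_measurable (lebesgue_on (\<Omega> \<times> {0<..<T}))"
    using borel_measurable_add[OF borel_measurable_times[OF borel_measurable_const m(1), of a]
      borel_measurable_times[OF borel_measurable_const m(2), of b]]
    by (simp add: case_prod_unfold)
  moreover have "(\<lambda>x. a * y1 t x + b * y2 t x) \<in> L2 ?L" if "t \<in> {0..T}" for t
    using assms that by (intro L2_comb_real C_L2_L2)
  moreover have "L2_tendsto ?L (\<lambda>t x. a * y1 t x + b * y2 t x) (\<lambda>x. a * y1 t x + b * y2 t x) (at t within {0..T})"
    if t: "t \<in> {0..T}" for t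
  proof -
    have ev: "\<forall>\<^sub>F s in at t within {0..T}. y s \<in> borel_measurable ?L" if "y \<in> C_L2 \<Omega> T" for y
      using that by (auto simp: eventually_at_filter intro!: always_eventually L2_measurable C_L2_L2)
    have "L2_tendsto ?L (\<lambda>t x. a *\<^sub>R y1 t x + b *\<^sub>R y2 t x) (\<lambda>x. a *\<^sub>R y1 t x + b *\<^sub>R y2 t x) (at t within {0..T})"
    proof (rule L2_tendsto_comb[OF ev[OF assms(1)] ev[OF assms(2)]])
      show "y1 t \<in> borel_measurable ?L" "y2 t \<in> borel_measurable ?L"
        using L2_measurable[OF C_L2_L2[OF assms(1) t]] L2_measurable[OF C_L2_L2[OF assms(2) t]] .
      show "L2_tendsto ?L y1 (y1 t) (at t within {0..T})"
        "L2_tendsto ?L y2 (y2 t) (at t within {0..T})"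
        using assms t unfolding C_L2_def by blast+
    qed
    then show ?thesis by simp
  qed
  ultimately show ?thesis by (simp add: C_L2_def)
qed

lemma C_L2_tendsto:
  assumes y: "y \<in> C_L2 \<Omega> T" and t: "t \<in> {0..T}"
  shows "((\<lambda>s. LINT x|lebesgue_on \<Omega>. (y s x - y t x)\<^sup>2) \<longlongrightarrow> 0) (at t within {0..T})"
proof -
  have "\<forall>\<^sub>F s in at t within {0..T}. y s \<in> L2 (lebesgue_on \<Omega>)"
    using y by (auto simp: eventually_at_filter intro!: always_eventually C_L2_L2)
  from L2_tendsto_LINT[OF this C_L2_L2[OF y t]] show ?thesis using y t by (simp add: C_L2_def)
qed

lemma C_L2_continuous_inner:
  assumes y: "y \<in> C_L2 \<Omega> T" and \<phi>: "\<phi> \<in> L2 (lebesgue_on \<Omega>)"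
  shows "continuous_on {0..T} (\<lambda>t. LINT x|lebesgue_on \<Omega>. y t x * \<phi> x)"
  unfolding continuous_on_def
proof
  let ?L = "lebesgue_on \<Omega>"
  fix t assume t: "t \<in> {0..T}"
  let ?d = "\<lambda>s. LINT x|?L. (y s x - y t x)\<^sup>2"
  let ?m = "\<lambda>s. LINT x|?L. y s x * \<phi> x"
  have "((\<lambda>s. ?m s - ?m t) \<longlongrightarrow> 0) (at t within {0..T})"
  proof (rule Lim_null_comparison)
    have "norm (?m s - ?m t) \<le> sqrt (?d s) * sqrt (LINT x|?L. (\<phi> x)\<^sup>2)" if s: "s \<in> {0..T}" for s
    proof -
      have "?m s - ?m t = (LINT x|?L. (y s x - y t x) * \<phi> x)"
        unfolding left_diff_distrib
        by (rule Bochner_Integration.integral_diff[symmetric]) (intro L2_mult_integrable C_L2_L2[OF y] \<phi> s t)+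
      then show ?thesis
        using L2_Cauchy_Schwarz[OF L2_diff[OF C_L2_L2[OF y s] C_L2_L2[OF y t]] \<phi>] by simp
    qed
    then show "\<forall>\<^sub>F s in at t within {0..T}. norm (?m s - ?m t)
        \<le> sqrt (?d s) * sqrt (LINT x|?L. (\<phi> x)\<^sup>2)"
      by (auto simp: eventually_at_filter intro!: always_eventually)
    show "((\<lambda>s. sqrt (?d s) * sqrt (LINT x|?L. (\<phi> x)\<^sup>2)) \<longlongrightarrow> 0) (at t within {0..T})"
      using tendsto_mult_right[OF tendsto_real_sqrt[OF C_L2_tendsto[OF y t]]] by simp
  qed
  then show "((\<lambda>s. ?m s) \<longlongrightarrow> ?m t) (at t within {0..T})" by (simp add: LIM_zero_iff)
qed

text \<open>From \<open>|y(s)|\<^sup>2 = |y(s) - y(t)|\<^sup>2 + 2 (y(s), y(t)) - |y(t)|\<^sup>2\<close>.\<close>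
lemma C_L2_continuous_norm:
  assumes y: "y \<in> C_L2 \<Omega> T"
  shows "continuous_on {0..T} (\<lambda>t. LINT x|lebesgue_on \<Omega>. (y t x)\<^sup>2)"
  unfolding continuous_on_def
proof
  let ?L = "lebesgue_on \<Omega>"
  fix t assume t: "t \<in> {0..T}"
  let ?d = "\<lambda>s. LINT x|?L. (y s x - y t x)\<^sup>2" and ?m = "\<lambda>s. LINT x|?L. y s x * y t x"
    and ?n = "\<lambda>s. LINT x|?L. (y s x)\<^sup>2"
  have "((\<lambda>s. ?m s) \<longlongrightarrow> ?m t) (at t within {0..T})"
    using C_L2_continuous_inner[OF y C_L2_L2[OF y t]] t by (simp add: continuous_on_def)
  then have "((\<lambda>s. ?d s + 2 * ?m s - ?m t) \<longlongrightarrow> 0 + 2 * ?m t - ?m t) (at t within {0..T})"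
    by (intro tendsto_intros C_L2_tendsto[OF y t])
  moreover have "?d s + 2 * ?m s - ?m t = ?n s" if s: "s \<in> {0..T}" for s
  proof -
    have i: "integrable ?L (\<lambda>x. y s x * y t x)" "integrable ?L (\<lambda>x. y t x * y t x)"
        "integrable ?L (\<lambda>x. (y s x)\<^sup>2)"
      by (intro L2_mult_integrable L2_integrable_real C_L2_L2[OF y] s t)+
    have "(y s x - y t x)\<^sup>2 = (y s x)\<^sup>2 - 2 * (y s x * y t x) + y t x * y t x" for x
      by (simp add: power2_eq_square algebra_simps)
    then have "?d s = ?n s - 2 * ?m s + ?m t"
      using i by simp
    then show ?thesis by simp
  qed
  then have "\<forall>\<^sub>F s in at t within {0..T}. ?d s + 2 * ?m s - ?m t = ?n s"
    by (auto simp: eventually_at_filter intro!: always_eventually)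
  ultimately have "((\<lambda>s. ?n s) \<longlongrightarrow> 0 + 2 * ?m t - ?m t) (at t within {0..T})"
    by (rule Lim_transform_eventually)
  then show "((\<lambda>s. ?n s) \<longlongrightarrow> ?n t) (at t within {0..T})" by (simp add: power2_eq_square)
qed

lemma weak_gradient_comb:
  assumes \<Omega>: "bounded \<Omega>" "\<Omega> \<in> sets borel" and G: "weak_gradient \<Omega> u G" "weak_gradient \<Omega> u' G'"
  shows "weak_gradient \<Omega> (\<lambda>x. a * u x + b * u' x) (\<lambda>x. a *\<^sub>R G x + b *\<^sub>R G' x)"
proof -
  let ?L = "lebesgue_on \<Omega>"
  let ?i = "\<lambda>u \<psi> e. LINT x|?L. u x * (grad \<psi> x \<bullet> e)" and ?j = "\<lambda>G \<psi> e. LINT x|?L. G x \<bullet> e * \<psi> x"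
  have L: "u \<in> L2 ?L" "u' \<in> L2 ?L" "G \<in> L2 ?L" "G' \<in> L2 ?L"
    using G by (auto simp: weak_gradient_def)
  have "(LINT x|?L. (a * u x + b * u' x) * (grad \<psi> x \<bullet> e))
      = - (LINT x|?L. (a *\<^sub>R G x + b *\<^sub>R G' x) \<bullet> e * \<psi> x)"
    if \<psi>: "test_function \<Omega> \<psi>" and e: "e \<in> Basis" for \<psi> e
  proof -
    have sm: "smooth_on UNIV \<psi>" using \<psi> by (simp add: test_function_def)
    have g: "(\<lambda>x. grad \<psi> x \<bullet> e) \<in> L2 ?L" "(\<lambda>x. \<psi> x *\<^sub>R e) \<in> L2 ?L"
    proof -
      have "continuous_on UNIV (\<lambda>x. grad \<psi> x \<bullet> e)"
        by (intro continuous_on_inner continuous_on_const smooth_on_continuous_grad[OF sm])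
      then show "(\<lambda>x. grad \<psi> x \<bullet> e) \<in> L2 ?L" by (rule continuous_L2_lebesgue_on[OF \<Omega>])
      have "continuous_on UNIV (\<lambda>x. \<psi> x *\<^sub>R e)"
        by (intro continuous_on_scaleR continuous_on_const smooth_on_continuous[OF sm])
      then show "(\<lambda>x. \<psi> x *\<^sub>R e) \<in> L2 ?L" by (rule continuous_L2_lebesgue_on[OF \<Omega>])
    qed
    have i: "integrable ?L (\<lambda>x. u x * (grad \<psi> x \<bullet> e))" "integrable ?L (\<lambda>x. u' x * (grad \<psi> x \<bullet> e))"
      using L g by (auto intro: L2_mult_integrable)
    have j: "integrable ?L (\<lambda>x. G x \<bullet> e * \<psi> x)" "integrable ?L (\<lambda>x. G' x \<bullet> e * \<psi> x)"
      using L2_inner_integrable[OF L(3) g(2)] L2_inner_integrable[OF L(4) g(2)] by (simp_all add: mult.commute)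
    have "(LINT x|?L. (a * u x + b * u' x) * (grad \<psi> x \<bullet> e)) = a * ?i u \<psi> e + b * ?i u' \<psi> e"
      using i by (simp add: distrib_right mult.assoc)
    also have "\<dots> = - (a * ?j G \<psi> e + b * ?j G' \<psi> e)"
      using G \<psi> e by (simp add: weak_gradient_def)
    also have "a * ?j G \<psi> e + b * ?j G' \<psi> e = (LINT x|?L. (a *\<^sub>R G x + b *\<^sub>R G' x) \<bullet> e * \<psi> x)"
      using j by (simp add: distrib_right mult.assoc inner_add_left)
    finally show ?thesis .
  qed
  then show ?thesis using L by (simp add: weak_gradient_def L2_comb L2_comb_real)
qed

lemma borel_measurable_boundary_measure:
  fixes f :: "'a::euclidean_space \<Rightarrow> 'b::euclidean_space"
  shows "f \<in> borel_measurable borel \<Longrightarrow> f \<in> borel_measurable (boundary_measure \<Omega>)"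
proof -
  assume f: "f \<in> borel_measurable borel"
  have "sets (hausdorff_measure (DIM('a) - 1) :: 'a measure) = sets borel"
    unfolding hausdorff_measure_def using sets.sigma_sets_eq[of "borel :: 'a measure"]
    by (subst sets_measure_of) simp_all
  then have "f \<in> borel_measurable (hausdorff_measure (DIM('a) - 1))"
    using f by (subst measurable_cong_sets[OF _ refl])
  then show ?thesis
    unfolding boundary_measure_def by (intro measurable_completion measurable_restrict_space1)
qed

lemma has_trace_comb:
  assumes \<Omega>: "bounded \<Omega>" "\<Omega> \<in> sets borel" and h: "has_trace \<Omega> u h" "has_trace \<Omega> u' h'"
  shows "has_trace \<Omega> (\<lambda>x. a * u x + b * u' x) (\<lambda>x. a * h x + b * h' x)"
proof -
  let ?L = "lebesgue_on \<Omega>"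
  obtain G \<phi> where G: "weak_gradient \<Omega> u G" and \<phi>: "\<And>n :: nat. smooth_on UNIV (\<phi> n)"
      "L2_tendsto ?L \<phi> u sequentially"
      "L2_tendsto ?L (\<lambda>n. grad (\<phi> n)) G sequentially"
      "L2_tendsto (boundary_measure \<Omega>) \<phi> h sequentially"
    using h(1) unfolding has_trace_def by blast
  obtain G' \<phi>' where G': "weak_gradient \<Omega> u' G'" and \<phi>': "\<And>n :: nat. smooth_on UNIV (\<phi>' n)"
      "L2_tendsto ?L \<phi>' u' sequentially"
      "L2_tendsto ?L (\<lambda>n. grad (\<phi>' n)) G' sequentially"
      "L2_tendsto (boundary_measure \<Omega>) \<phi>' h' sequentially"
    using h(2) unfolding has_trace_def by blast
  have hL: "h \<in> L2 (boundary_measure \<Omega>)" "h' \<in> L2 (boundary_measure \<Omega>)"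
    using h by (auto simp: has_trace_def)
  have L: "u \<in> L2 ?L" "u' \<in> L2 ?L" "G \<in> L2 ?L" "G' \<in> L2 ?L"
    using G G' by (auto simp: weak_gradient_def)
  have bm: "\<phi> n \<in> borel_measurable borel" "\<phi>' n \<in> borel_measurable borel"
      "grad (\<phi> n) \<in> borel_measurable borel" "grad (\<phi>' n) \<in> borel_measurable borel" for n
    using \<phi>(1) \<phi>'(1) by (auto intro!: borel_measurable_continuous_onI smooth_on_continuous smooth_on_continuous_grad)
  have "L2_tendsto ?L (\<lambda>n x. a *\<^sub>R \<phi> n x + b *\<^sub>R \<phi>' n x) (\<lambda>x. a *\<^sub>R u x + b *\<^sub>R u' x) sequentially"
    using L \<phi>(2) \<phi>'(2) by (intro L2_tendsto_comb always_eventually allI lebesgue_on_borel_measurable bm L2_measurable)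
  moreover have "L2_tendsto ?L (\<lambda>n x. a *\<^sub>R grad (\<phi> n) x + b *\<^sub>R grad (\<phi>' n) x) (\<lambda>x. a *\<^sub>R G x + b *\<^sub>R G' x) sequentially"
    using L \<phi>(3) \<phi>'(3) by (intro L2_tendsto_comb always_eventually allI lebesgue_on_borel_measurable bm L2_measurable)
  moreover have "L2_tendsto (boundary_measure \<Omega>) (\<lambda>n x. a *\<^sub>R \<phi> n x + b *\<^sub>R \<phi>' n x) (\<lambda>x. a *\<^sub>R h x + b *\<^sub>R h' x) sequentially"
    using hL \<phi>(4) \<phi>'(4) by (intro L2_tendsto_comb always_eventually allI borel_measurable_boundary_measure bm L2_measurable)
  moreover have "(\<lambda>n. grad (\<lambda>x. a * \<phi> n x + b * \<phi>' n x)) = (\<lambda>n x. a *\<^sub>R grad (\<phi> n) x + b *\<^sub>R grad (\<phi>' n) x)"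
    using \<phi>(1) \<phi>'(1) by (auto simp: grad_comb fun_eq_iff)
  ultimately show ?thesis
    unfolding has_trace_def
    using weak_gradient_comb[OF \<Omega> G G', of a b] \<phi>(1) \<phi>'(1) L2_comb_real[OF hL, of a b]
    by (intro conjI exI[of _ "\<lambda>x. a *\<^sub>R G x + b *\<^sub>R G' x"] exI[of _ "\<lambda>n x. a * \<phi> n x + b * \<phi>' n x"])
      (auto intro: smooth_on_comb)
qed

lemma V_space_weak_gradient:
  assumes "\<phi> \<in> V_space \<Omega> \<Gamma>"
  obtains \<Phi> where "weak_gradient \<Omega> \<phi> \<Phi>"
  using assms unfolding V_space_def has_trace_def by blast

lemma V_space_L2: "\<phi> \<in> V_space \<Omega> \<Gamma> \<Longrightarrow> \<phi> \<in> L2 (lebesgue_on \<Omega>)"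
  by (erule V_space_weak_gradient) (simp add: weak_gradient_def)

lemma L2_dual_L2:
  assumes w: "L2_dual \<Omega> \<Gamma> T w" and \<phi>: "\<phi> \<in> V_space \<Omega> \<Gamma>"
  shows "(\<lambda>t. w t \<phi>) \<in> L2 (lebesgue_on {0<..<T})"
proof -
  let ?I = "lebesgue_on {0<..<T}"
  obtain \<Phi> where \<Phi>: "weak_gradient \<Omega> \<phi> \<Phi>" using \<phi> by (rule V_space_weak_gradient)
  have m: "(\<lambda>t. w t \<phi>) \<in> borel_measurable ?I" using w \<phi> by (simp add: L2_dual_def)
  obtain c where c: "c \<in> L2 ?I"
    and bd': "AE t in ?I. \<forall>\<phi>\<in>V_space \<Omega> \<Gamma>. \<forall>\<Phi>. weak_gradient \<Omega> \<phi> \<Phi> \<longrightarrow> \<bar>w t \<phi>\<bar> \<le> c t * H1_norm \<Omega> \<phi> \<Phi>"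
    using w unfolding L2_dual_def by blast
  have bd: "AE t in ?I. \<bar>w t \<phi>\<bar> \<le> c t * H1_norm \<Omega> \<phi> \<Phi>"
    using bd' by eventually_elim (use \<phi> \<Phi> in blast)
  have "integrable ?I (\<lambda>t. (w t \<phi>)\<^sup>2)"
  proof (rule Bochner_Integration.integrable_bound)
    show "integrable ?I (\<lambda>t. (c t)\<^sup>2 * (H1_norm \<Omega> \<phi> \<Phi>)\<^sup>2)"
      using L2_integrable_real[OF c] by simp
    show "AE t in ?I. norm ((w t \<phi>)\<^sup>2) \<le> norm ((c t)\<^sup>2 * (H1_norm \<Omega> \<phi> \<Phi>)\<^sup>2)"
      using bd
    proof eventually_elim
      case (elim t)
      then have "(\<bar>w t \<phi>\<bar>)\<^sup>2 \<le> (c t * H1_norm \<Omega> \<phi> \<Phi>)\<^sup>2" by (intro power_mono) auto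
      then show ?case by (simp add: power_mult_distrib)
    qed
  qed (use m in measurable)
  then show ?thesis using m by (simp add: L2_def)
qed

lemma L2_dual_comb:
  assumes "L2_dual \<Omega> \<Gamma> T w" "L2_dual \<Omega> \<Gamma> T w'"
  shows "L2_dual \<Omega> \<Gamma> T (\<lambda>t \<phi>. a * w t \<phi> + b * w' t \<phi>)"
proof -
  let ?I = "lebesgue_on {0<..<T}"
  obtain c c' where c: "c \<in> L2 ?I" "c' \<in> L2 ?I"
    and bd: "AE t in ?I. \<forall>\<phi>\<in>V_space \<Omega> \<Gamma>. \<forall>\<Phi>. weak_gradient \<Omega> \<phi> \<Phi> \<longrightarrow> \<bar>w t \<phi>\<bar> \<le> c t * H1_norm \<Omega> \<phi> \<Phi>"
      "AE t in ?I. \<forall>\<phi>\<in>V_space \<Omega> \<Gamma>. \<forall>\<Phi>. weak_gradient \<Omega> \<phi> \<Phi> \<longrightarrow> \<bar>w' t \<phi>\<bar> \<le> c' t * H1_norm \<Omega> \<phi> \<Phi>"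
    using assms unfolding L2_dual_def by blast
  have lin: "AE t in ?I. \<forall>\<phi>\<in>V_space \<Omega> \<Gamma>. \<forall>\<psi>\<in>V_space \<Omega> \<Gamma>. \<forall>a b.
        w t (\<lambda>x. a * \<phi> x + b * \<psi> x) = a * w t \<phi> + b * w t \<psi>"
      "AE t in ?I. \<forall>\<phi>\<in>V_space \<Omega> \<Gamma>. \<forall>\<psi>\<in>V_space \<Omega> \<Gamma>. \<forall>a b.
        w' t (\<lambda>x. a * \<phi> x + b * \<psi> x) = a * w' t \<phi> + b * w' t \<psi>"
    using assms unfolding L2_dual_def by blast+
  show ?thesis
    unfolding L2_dual_def
  proof (intro conjI ballI bexI)
    show "(\<lambda>t. a * w t \<phi> + b * w' t \<phi>) \<in> borel_measurable ?I" if "\<phi> \<in> V_space \<Omega> \<Gamma>" for \<phi>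
      using assms that by (intro borel_measurable_add borel_measurable_times) (auto simp: L2_dual_def)
    show "AE t in ?I. \<forall>\<phi>\<in>V_space \<Omega> \<Gamma>. \<forall>\<psi>\<in>V_space \<Omega> \<Gamma>. \<forall>c d.
        a * w t (\<lambda>x. c * \<phi> x + d * \<psi> x) + b * w' t (\<lambda>x. c * \<phi> x + d * \<psi> x)
          = c * (a * w t \<phi> + b * w' t \<phi>) + d * (a * w t \<psi> + b * w' t \<psi>)"
      using lin
    proof eventually_elim
      case (elim t)
      then show ?case by (simp add: algebra_simps)
    qed
    show "(\<lambda>t. \<bar>a\<bar> * c t + \<bar>b\<bar> * c' t) \<in> L2 ?I" using c by (rule L2_comb_real)
    show "AE t in ?I. \<forall>\<phi>\<in>V_space \<Omega> \<Gamma>. \<forall>\<Phi>. weak_gradient \<Omega> \<phi> \<Phi> \<longrightarrow>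
        \<bar>a * w t \<phi> + b * w' t \<phi>\<bar> \<le> (\<bar>a\<bar> * c t + \<bar>b\<bar> * c' t) * H1_norm \<Omega> \<phi> \<Phi>"
      using bd
    proof eventually_elim
      case (elim t)
      show ?case
      proof (intro ballI allI impI)
        fix \<phi> \<Phi> assume "\<phi> \<in> V_space \<Omega> \<Gamma>" "weak_gradient \<Omega> \<phi> \<Phi>"
        then have "\<bar>w t \<phi>\<bar> \<le> c t * H1_norm \<Omega> \<phi> \<Phi>" "\<bar>w' t \<phi>\<bar> \<le> c' t * H1_norm \<Omega> \<phi> \<Phi>" using elim by auto
        then have "\<bar>a\<bar> * \<bar>w t \<phi>\<bar> + \<bar>b\<bar> * \<bar>w' t \<phi>\<bar> \<le> \<bar>a\<bar> * (c t * H1_norm \<Omega> \<phi> \<Phi>) + \<bar>b\<bar> * (c' t * H1_norm \<Omega> \<phi> \<Phi>)"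
          by (intro add_mono mult_left_mono) auto
        moreover have "\<bar>a * w t \<phi> + b * w' t \<phi>\<bar> \<le> \<bar>a\<bar> * \<bar>w t \<phi>\<bar> + \<bar>b\<bar> * \<bar>w' t \<phi>\<bar>"
          by (rule order_trans[OF abs_triangle_ineq]) (simp add: abs_mult)
        ultimately show "\<bar>a * w t \<phi> + b * w' t \<phi>\<bar> \<le> (\<bar>a\<bar> * c t + \<bar>b\<bar> * c' t) * H1_norm \<Omega> \<phi> \<Phi>"
          by (simp add: algebra_simps)
      qed
    qed
  qed
qed

lemma test_function_deriv_L2:
  assumes "test_function {0<..<T} \<theta>"
  shows "deriv \<theta> \<in> L2 (lebesgue_on {0<..<T})" "\<theta> \<in> L2 (lebesgue_on {0<..<T})"
proof -
  have sm: "smooth_on UNIV \<theta>" using assms by (simp add: test_function_def)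
  have "deriv \<theta> = grad \<theta>"
    using smooth_on_GDERIV[OF sm] by (auto simp: fun_eq_iff intro!: DERIV_imp_deriv)
  then show "deriv \<theta> \<in> L2 (lebesgue_on {0<..<T})" "\<theta> \<in> L2 (lebesgue_on {0<..<T})"
    using sm by (auto intro!: continuous_L2_lebesgue_on smooth_on_continuous smooth_on_continuous_grad)
qed

lemma weak_time_derivative_comb:
  assumes y: "y1 \<in> C_L2 \<Omega> T" "y2 \<in> C_L2 \<Omega> T"
    and w: "weak_time_derivative \<Omega> \<Gamma> T y1 w1" "weak_time_derivative \<Omega> \<Gamma> T y2 w2"
  shows "weak_time_derivative \<Omega> \<Gamma> T (\<lambda>t x. a * y1 t x + b * y2 t x) (\<lambda>t \<phi>. a * w1 t \<phi> + b * w2 t \<phi>)"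
  unfolding weak_time_derivative_def
proof (intro conjI ballI allI impI)
  let ?L = "lebesgue_on \<Omega>"
  have d: "L2_dual \<Omega> \<Gamma> T w1" "L2_dual \<Omega> \<Gamma> T w2" using w by (auto simp: weak_time_derivative_def)
  then show "L2_dual \<Omega> \<Gamma> T (\<lambda>t \<phi>. a * w1 t \<phi> + b * w2 t \<phi>)" by (rule L2_dual_comb)
  fix \<phi> \<theta> assume \<phi>: "\<phi> \<in> V_space \<Omega> \<Gamma>" and \<theta>: "test_function {0<..<T} \<theta>"
  have \<phi>L: "\<phi> \<in> L2 ?L" using \<phi> by (rule V_space_L2)
  let ?I = "lebesgue_on {0<..<T}"
  let ?m = "\<lambda>y t. LINT x|?L. y t x * \<phi> x"
  have m: "integrable ?I (\<lambda>t. deriv \<theta> t * ?m y1 t)" "integrable ?I (\<lambda>t. deriv \<theta> t * ?m y2 t)"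
    by (rule L2_mult_integrable[OF test_function_deriv_L2(1)[OF \<theta>] continuous_L2_interval[OF C_L2_continuous_inner[OF y(1) \<phi>L]]],
        rule L2_mult_integrable[OF test_function_deriv_L2(1)[OF \<theta>] continuous_L2_interval[OF C_L2_continuous_inner[OF y(2) \<phi>L]]])
  have k: "integrable ?I (\<lambda>t. \<theta> t * w1 t \<phi>)" "integrable ?I (\<lambda>t. \<theta> t * w2 t \<phi>)"
    by (rule L2_mult_integrable[OF test_function_deriv_L2(2)[OF \<theta>] L2_dual_L2[OF d(1) \<phi>]],
        rule L2_mult_integrable[OF test_function_deriv_L2(2)[OF \<theta>] L2_dual_L2[OF d(2) \<phi>]])
  have "(LINT t|?I. deriv \<theta> t * (LINT x|?L. (a * y1 t x + b * y2 t x) * \<phi> x))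
      = (LINT t|?I. a * (deriv \<theta> t * ?m y1 t) + b * (deriv \<theta> t * ?m y2 t))"
  proof (rule Bochner_Integration.integral_cong)
    fix t assume "t \<in> space ?I"
    then have t: "t \<in> {0..T}" by simp
    have "(LINT x|?L. (a * y1 t x + b * y2 t x) * \<phi> x) = a * ?m y1 t + b * ?m y2 t"
      using L2_mult_integrable[OF C_L2_L2[OF y(1) t] \<phi>L] L2_mult_integrable[OF C_L2_L2[OF y(2) t] \<phi>L]
      by (simp add: distrib_right mult.assoc)
    then show "deriv \<theta> t * (LINT x|?L. (a * y1 t x + b * y2 t x) * \<phi> x)
        = a * (deriv \<theta> t * ?m y1 t) + b * (deriv \<theta> t * ?m y2 t)"
      by (simp add: algebra_simps)
  qed simp
  also have "\<dots> = a * (LINT t|?I. deriv \<theta> t * ?m y1 t) + b * (LINT t|?I. deriv \<theta> t * ?m y2 t)"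
    using m by simp
  also have "\<dots> = a * (- (LINT t|?I. \<theta> t * w1 t \<phi>)) + b * (- (LINT t|?I. \<theta> t * w2 t \<phi>))"
    using w \<phi> \<theta> by (simp add: weak_time_derivative_def)
  also have "\<dots> = - (LINT t|?I. a * (\<theta> t * w1 t \<phi>) + b * (\<theta> t * w2 t \<phi>))"
    using k by simp
  also have "\<dots> = - (LINT t|?I. \<theta> t * (a * w1 t \<phi> + b * w2 t \<phi>))" by (simp add: algebra_simps)
  finally show "(LINT t|?I. deriv \<theta> t * (LINT x|?L. (a * y1 t x + b * y2 t x) * \<phi> x))
      = - (LINT t|?I. \<theta> t * (a * w1 t \<phi> + b * w2 t \<phi>))" .
qed

lemma L2_sections:
  fixes f :: "'a::euclidean_space \<times> 'c::euclidean_space \<Rightarrow> 'b::euclidean_space"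
  assumes A: "A \<in> sets borel" and I: "I \<in> sets borel" and f: "f \<in> L2 (lebesgue_on (A \<times> I))"
  shows "AE t in lebesgue_on I. (\<lambda>x. f (x, t)) \<in> L2 (lebesgue_on A)"
proof -
  obtain g where g: "g \<in> borel_measurable borel" "\<And>p. p \<notin> A \<times> I \<Longrightarrow> g p = 0"
    "AE t in lebesgue_on I. AE x in lebesgue_on A. f (x, t) = g (x, t)"
    "integrable lborel (\<lambda>p. (norm (g p))\<^sup>2)"
    using L2_borel_representative[OF A I f] by blast
  have "AE t in lebesgue_on I. (\<lambda>x. g (x, t)) \<in> L2 lborel"
    using L2_lborel_sections(1)[OF g(1,4)] I by (auto simp: AE_lebesgue_on_iff elim!: eventually_mono)
  then show ?thesis using g(3)
  proof eventually_elim
    case (elim t)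
    have m: "(\<lambda>x. g (x, t)) \<in> borel_measurable (lebesgue_on A)"
      using elim(1) by (intro lebesgue_on_borel_measurable) (simp add: L2_def)
    have "integrable lebesgue (\<lambda>x. (norm (g (x, t)))\<^sup>2)"
      using L2_integrable[OF elim(1)] borel_measurable_integrable[OF L2_integrable[OF elim(1)]]
      by (simp add: integrable_completion)
    then have "integrable (lebesgue_on A) (\<lambda>x. (norm (g (x, t)))\<^sup>2)"
      using A by (intro integrable_restrict_space[THEN iffD2] integrable_mult_indicator) auto
    then have gL: "(\<lambda>x. g (x, t)) \<in> L2 (lebesgue_on A)" using m by (simp add: L2_def)
    have ae: "AE x in lebesgue_on A. g (x, t) = f (x, t)" using elim(2) by eventually_elim simp
    show ?case
      by (rule L2_cong_AE[OF gL lebesgue_on_measurable_AE[OF _ m ae] ae]) (use A in simp)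
  qed
qed

text \<open>The data of the two solutions are multiples of the same functions.  This covers the affine combinations
  (\<open>c = 1\<close>) and the differences (\<open>c = 0\<close>) of states, and the boundary integrals combine as multiples of one
  number, whether or not their integrand is integrable.\<close>
theorem heat_weak_solution_comb:
  assumes \<Omega>: "bounded \<Omega>" "\<Omega> \<in> sets borel"
    and F: "F1 \<in> L2 (lebesgue_on (\<Omega> \<times> {0<..<T}))" "F2 \<in> L2 (lebesgue_on (\<Omega> \<times> {0<..<T}))"
    and y1: "heat_weak_solution \<Omega> \<Gamma>1 \<Gamma>2 T F1 (\<lambda>p. c1 * g1 p) (\<lambda>p. c1 * g2 p) (\<lambda>x. c1 * y0 x) y1"
    and y2: "heat_weak_solution \<Omega> \<Gamma>1 \<Gamma>2 T F2 (\<lambda>p. c2 * g1 p) (\<lambda>p. c2 * g2 p) (\<lambda>x. c2 * y0 x) y2"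
    and c: "c = a * c1 + b * c2"
  shows "heat_weak_solution \<Omega> \<Gamma>1 \<Gamma>2 T (\<lambda>p. a * F1 p + b * F2 p) (\<lambda>p. c * g1 p) (\<lambda>p. c * g2 p) (\<lambda>x. c * y0 x)
    (\<lambda>t x. a * y1 t x + b * y2 t x)"
proof -
  let ?B2 = "restrict_space (boundary_measure \<Omega>) \<Gamma>2"
  let ?B1 = "restrict_space (boundary_measure \<Omega>) \<Gamma>1"
  let ?L = "lebesgue_on \<Omega>"
  let ?I = "lebesgue_on {0<..<T}" and ?Q = "lebesgue_on (\<Omega> \<times> {0<..<T})"
  obtain G1 w1 where C1: "y1 \<in> C_L2 \<Omega> T" and init1: "AE x in ?L. y1 0 x = c1 * y0 x"
    and tr1: "AE t in ?I. \<exists>h. has_trace \<Omega> (y1 t) h \<and> (AE x in ?B1. h x = c1 * g1 (x, t))"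
    and G1: "(\<lambda>(x, t). G1 t x) \<in> L2 ?Q" "AE t in ?I. weak_gradient \<Omega> (y1 t) (G1 t)"
    and w1: "weak_time_derivative \<Omega> \<Gamma>1 T y1 w1"
    and eq1: "\<And>\<phi> \<Phi> h. weak_gradient \<Omega> \<phi> \<Phi> \<Longrightarrow> has_trace \<Omega> \<phi> h \<Longrightarrow> AE x in ?B1. h x = 0 \<Longrightarrow>
      AE t in ?I. w1 t \<phi> + (LINT x|?L. G1 t x \<bullet> \<Phi> x) = (LINT x|?L. F1 (x, t) * \<phi> x)
        + (LINT x|?B2. c1 * g2 (x, t) * h x)"
    using y1 unfolding heat_weak_solution_def by blast
  obtain G2 w2 where C2: "y2 \<in> C_L2 \<Omega> T" and init2: "AE x in ?L. y2 0 x = c2 * y0 x"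
    and tr2: "AE t in ?I. \<exists>h. has_trace \<Omega> (y2 t) h \<and> (AE x in ?B1. h x = c2 * g1 (x, t))"
    and G2: "(\<lambda>(x, t). G2 t x) \<in> L2 ?Q" "AE t in ?I. weak_gradient \<Omega> (y2 t) (G2 t)"
    and w2: "weak_time_derivative \<Omega> \<Gamma>1 T y2 w2"
    and eq2: "\<And>\<phi> \<Phi> h. weak_gradient \<Omega> \<phi> \<Phi> \<Longrightarrow> has_trace \<Omega> \<phi> h \<Longrightarrow> AE x in ?B1. h x = 0 \<Longrightarrow>
      AE t in ?I. w2 t \<phi> + (LINT x|?L. G2 t x \<bullet> \<Phi> x) = (LINT x|?L. F2 (x, t) * \<phi> x)
        + (LINT x|?B2. c2 * g2 (x, t) * h x)"
    using y2 unfolding heat_weak_solution_def by blast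
  have sec: "AE t in ?I. (\<lambda>x. F1 (x, t)) \<in> L2 ?L" "AE t in ?I. (\<lambda>x. F2 (x, t)) \<in> L2 ?L"
    by (rule L2_sections[OF \<Omega>(2) _ F(1)], simp, rule L2_sections[OF \<Omega>(2) _ F(2)], simp)
  show ?thesis
    unfolding heat_weak_solution_def
  proof (intro conjI exI allI impI)
    show "(\<lambda>t x. a * y1 t x + b * y2 t x) \<in> C_L2 \<Omega> T" using C1 C2 by (rule C_L2_comb)
    show "AE x in ?L. a * y1 0 x + b * y2 0 x = c * y0 x"
      using init1 init2 by eventually_elim (simp add: c algebra_simps)
    show "AE t in ?I. \<exists>h. has_trace \<Omega> (\<lambda>x. a * y1 t x + b * y2 t x) h \<and>
        (AE x in ?B1. h x = c * g1 (x, t))"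
      using tr1 tr2
    proof eventually_elim
      case (elim t)
      then obtain h1 h2 where h: "has_trace \<Omega> (y1 t) h1" "has_trace \<Omega> (y2 t) h2"
        and b: "AE x in ?B1. h1 x = c1 * g1 (x, t)"
          "AE x in ?B1. h2 x = c2 * g1 (x, t)" by blast
      have "AE x in ?B1. a * h1 x + b * h2 x = c * g1 (x, t)"
        using b by eventually_elim (simp add: c algebra_simps)
      then show ?case using has_trace_comb[OF \<Omega> h, of a b] by blast
    qed
    show "(\<lambda>(x, t). a *\<^sub>R G1 t x + b *\<^sub>R G2 t x) \<in> L2 ?Q"
      using L2_comb[OF G1(1) G2(1), of a b] by (simp add: case_prod_unfold)
    show "AE t in ?I. weak_gradient \<Omega> (\<lambda>x. a * y1 t x + b * y2 t x) (\<lambda>x. a *\<^sub>R G1 t x + b *\<^sub>R G2 t x)"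
      using G1(2) G2(2) by eventually_elim (rule weak_gradient_comb[OF \<Omega>])
    show "weak_time_derivative \<Omega> \<Gamma>1 T (\<lambda>t x. a * y1 t x + b * y2 t x) (\<lambda>t \<phi>. a * w1 t \<phi> + b * w2 t \<phi>)"
      by (rule weak_time_derivative_comb[OF C1 C2 w1 w2])
    fix \<phi> \<Phi> h
    assume "weak_gradient \<Omega> \<phi> \<Phi> \<and> has_trace \<Omega> \<phi> h \<and> (AE x in ?B1. h x = 0)"
    then have A: "weak_gradient \<Omega> \<phi> \<Phi>" "has_trace \<Omega> \<phi> h" "AE x in ?B1. h x = 0" by auto
    have L: "\<phi> \<in> L2 ?L" "\<Phi> \<in> L2 ?L" using A(1) by (auto simp: weak_gradient_def)
    show "AE t in ?I. a * w1 t \<phi> + b * w2 t \<phi> + (LINT x|?L. (a *\<^sub>R G1 t x + b *\<^sub>R G2 t x) \<bullet> \<Phi> x)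
        = (LINT x|?L. (a * F1 (x, t) + b * F2 (x, t)) * \<phi> x)
          + (LINT x|?B2. c * g2 (x, t) * h x)"
      using eq1[OF A] eq2[OF A] G1(2) G2(2) sec
    proof eventually_elim
      case (elim t)
      have eqG: "(LINT x|?L. (a *\<^sub>R G1 t x + b *\<^sub>R G2 t x) \<bullet> \<Phi> x)
          = a * (LINT x|?L. G1 t x \<bullet> \<Phi> x) + b * (LINT x|?L. G2 t x \<bullet> \<Phi> x)"
        using elim(3,4) L by (simp add: inner_add_left L2_inner_integrable weak_gradient_def)
      have eqF: "(LINT x|?L. (a * F1 (x, t) + b * F2 (x, t)) * \<phi> x)
          = a * (LINT x|?L. F1 (x, t) * \<phi> x) + b * (LINT x|?L. F2 (x, t) * \<phi> x)"
        using L2_mult_integrable[OF elim(5) L(1)] L2_mult_integrable[OF elim(6) L(1)]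
        by (simp add: distrib_right mult.assoc)
      have N: "(LINT x|?B2. k * g2 (x, t) * h x) = k * (LINT x|?B2. g2 (x, t) * h x)" for k
        by (simp add: mult.assoc)
      show ?case
        using arg_cong[OF elim(1)[unfolded N], of "\<lambda>z. a * z"] arg_cong[OF elim(2)[unfolded N], of "\<lambda>z. b * z"]
        unfolding eqG eqF N c unfolding ring_distribs mult.assoc by linarith
    qed
  qed
qed

section \<open>The energy estimate\<close>

text \<open>If \<open>q t > q 0\<close>, let \<open>a\<close> be the last point before \<open>t\<close> with \<open>q a \<le> q 0\<close>.  After \<open>a\<close> the function exceeds
  \<open>q a\<close>, and so does its mean over \<open>[a, t]\<close>.\<close>
lemma le_initial_if_mean_le:
  fixes q :: "real \<Rightarrow> real"
  assumes q: "continuous_on {0..T} q" and t: "t \<in> {0..T}"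
    and mean: "\<And>a b. 0 \<le> a \<Longrightarrow> a < b \<Longrightarrow> b \<le> T \<Longrightarrow> integral {a..b} q \<le> (b - a) * q a"
  shows "q t \<le> q 0"
proof (rule ccontr)
  assume neg: "\<not> q t \<le> q 0"
  have qt: "continuous_on {0..t} q" using q by (rule continuous_on_subset) (use t in auto)
  define S where "S = {0..t} \<inter> q -` {..q 0}"
  have "closed S"
    unfolding S_def by (rule continuous_closed_preimage[OF qt]) auto
  moreover have "bounded S" by (rule bounded_subset[of "{0..t}"]) (auto simp: S_def)
  ultimately have compact: "compact S" by (simp add: compact_eq_bounded_closed)
  have "S \<noteq> {}" using t by (auto simp: S_def)
  from compact_attains_sup[OF compact this]
  obtain a where a: "a \<in> S" "\<And>s. s \<in> S \<Longrightarrow> s \<le> a" by blast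
  have a': "0 \<le> a" "a \<le> t" "q a \<le> q 0" using a(1) by (auto simp: S_def)
  have at: "a < t" using a' neg by (cases "a = t") auto
  have ge: "q a \<le> q s" if "s \<in> {a..t}" for s
  proof (cases "s = a")
    case False
    then have "s \<notin> S" using a(2)[of s] that by auto
    then show ?thesis using that a' by (auto simp: S_def)
  qed simp
  have cont: "continuous_on {a..t} (\<lambda>s. q s - q a)"
    by (intro continuous_intros continuous_on_subset[OF qt]) (use a' in auto)
  have "integral {a..t} (\<lambda>s. q s - q a) = integral {a..t} q - (t - a) * q a"
    using at continuous_on_subset[OF qt, of "{a..t}"] a'
    by (subst Henstock_Kurzweil_Integration.integral_diff) (auto intro: integrable_continuous_real)
  also have "\<dots> \<le> 0" using mean[of a t] a' at t by auto
  finally have le0: "integral {a..t} (\<lambda>s. q s - q a) \<le> 0" .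
  have "0 \<le> integral {a..t} (\<lambda>s. q s - q a)"
    by (rule integral_nonneg[OF integrable_continuous_real[OF cont]]) (use ge in simp)
  then have zero: "integral {a..t} (\<lambda>s. q s - q a) = 0" using le0 by (rule order_antisym[rotated])
  have iff: "integral {a..t} (\<lambda>s. q s - q a) = 0 \<longleftrightarrow> (\<forall>s\<in>{a..t}. q s - q a = 0)"
    by (rule integral_eq_0_iff[OF cont at]) (use ge in simp)
  have "\<forall>s\<in>{a..t}. q s - q a = 0" by (rule iffD1[OF iff zero])
  then have "q t - q a = 0" by (rule bspec) (use at in simp)
  then show False using a' neg by simp
qed

lemma integrable_lebesgue_on_subset:
  fixes f :: "'a::euclidean_space \<Rightarrow> 'b::euclidean_space"
  assumes f: "integrable (lebesgue_on S) f" and S: "S \<in> sets lebesgue" and R: "R \<in> sets lebesgue" "R \<subseteq> S"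
  shows "integrable (lebesgue_on R) f"
proof -
  have "integrable lebesgue (\<lambda>x. indicator S x *\<^sub>R f x)"
    using f S by (subst (asm) integrable_restrict_space) auto
  then have "integrable lebesgue (\<lambda>x. indicator R x *\<^sub>R (indicator S x *\<^sub>R f x))"
    using R(1) by (rule integrable_mult_indicator[rotated])
  moreover have "(\<lambda>x. indicator R x *\<^sub>R (indicator S x *\<^sub>R f x)) = (\<lambda>x. indicator R x *\<^sub>R f x)"
    using R by (auto simp: indicator_def fun_eq_iff)
  ultimately have "integrable lebesgue (\<lambda>x. indicator R x *\<^sub>R f x)" by metis
  then show ?thesis using R by (subst integrable_restrict_space) auto
qed

lemma integrable_lborel_imp_lebesgue_on:
  fixes f :: "'a::euclidean_space \<Rightarrow> 'b::euclidean_space"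
  assumes f: "integrable lborel f" and S: "S \<in> sets borel"
  shows "integrable (lebesgue_on S) f"
proof -
  have "integrable lebesgue f"
    using f borel_measurable_integrable[OF f] by (simp add: integrable_completion)
  then have "integrable lebesgue (\<lambda>x. indicator S x *\<^sub>R f x)"
    using S by (intro integrable_mult_indicator) auto
  then show ?thesis using S by (subst integrable_restrict_space) auto
qed

lemma lebesgue_on_integral_indicator:
  fixes f :: "'a::euclidean_space \<Rightarrow> real"
  assumes S: "S \<in> sets borel" and f: "f \<in> borel_measurable borel"
  shows "(LINT x|lebesgue_on S. f x) = (LINT x|lborel. indicator S x * f x)"
proof -
  have "(LINT x|lebesgue_on S. f x) = (LINT x|lebesgue_on S. indicator S x * f x)"
    by (rule Bochner_Integration.integral_cong) auto
  also have "\<dots> = (LINT x|lborel. indicator S x * f x)"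
    using S f by (intro lebesgue_on_integral_lborel) auto
  finally show ?thesis .
qed

lemma AE_lebesgue_on_subset:
  fixes S :: "'a::euclidean_space set"
  assumes "AE x in lebesgue_on S. P x" "S \<in> sets borel" "R \<in> sets borel" "R \<subseteq> S"
  shows "AE x in lebesgue_on R. P x"
  using assms by (auto simp: AE_lebesgue_on_iff elim!: eventually_mono)

text \<open>With \<open>n t = |y(t)|\<^sup>2\<close>, \<open>M = max n\<close>, and \<open>D r t\<close> the inner product of the gradients at times \<open>r\<close> and \<open>t\<close>,
  Young's inequality \<open>(F(r), y(t)) \<le> T |F(r)|\<^sup>2 + M / (4 T)\<close> is scaled so that the contribution of \<open>M\<close> over
  the whole time interval is \<open>M / 2\<close> and can be absorbed in the end.\<close>
theorem heat_energy_estimate: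
  assumes T: "T > 0" and \<Omega>: "bounded \<Omega>" "\<Omega> \<in> sets borel"
    and F: "F \<in> L2 (lebesgue_on (\<Omega> \<times> {0<..<T}))"
    and sol: "heat_weak_solution \<Omega> \<Gamma>1 \<Gamma>2 T F (\<lambda>_. 0) (\<lambda>_. 0) (\<lambda>_. 0) y"
    and tT: "t' \<in> {0..T}"
  shows "(LINT x|lebesgue_on \<Omega>. (y t' x)\<^sup>2) \<le> 4 * T * (LINT p|lebesgue_on (\<Omega> \<times> {0<..<T}). (F p)\<^sup>2)"
proof -
  let ?L = "lebesgue_on \<Omega>" and ?I = "lebesgue_on {0<..<T}" and ?Q = "lebesgue_on (\<Omega> \<times> {0<..<T})"
  have Ib: "{0<..<T} \<in> sets borel" by simp
  obtain G w where y: "y \<in> C_L2 \<Omega> T" and init: "AE x in ?L. y 0 x = 0"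
    and tr: "AE t in ?I. \<exists>h. has_trace \<Omega> (y t) h \<and> (AE x in restrict_space (boundary_measure \<Omega>) \<Gamma>1. h x = 0)"
    and G: "(\<lambda>(x, t). G t x) \<in> L2 ?Q" and wg: "AE t in ?I. weak_gradient \<Omega> (y t) (G t)"
    and w: "weak_time_derivative \<Omega> \<Gamma>1 T y w"
    and eq: "\<And>\<phi> \<Phi> h. weak_gradient \<Omega> \<phi> \<Phi> \<Longrightarrow> has_trace \<Omega> \<phi> h \<Longrightarrow> AE x in restrict_space (boundary_measure \<Omega>) \<Gamma>1. h x = 0 \<Longrightarrow>
      AE t in ?I. w t \<phi> + (LINT x|?L. G t x \<bullet> \<Phi> x) = (LINT x|?L. F (x, t) * \<phi> x)
        + (LINT x|restrict_space (boundary_measure \<Omega>) \<Gamma>2. 0 * h x)"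
    using sol unfolding heat_weak_solution_def by blast
  obtain Gb where Gb[measurable]: "Gb \<in> borel_measurable borel" and Gb0: "\<And>p. p \<notin> \<Omega> \<times> {0<..<T} \<Longrightarrow> Gb p = 0"
    and GGb: "AE t in ?I. AE x in ?L. (case (x, t) of (x, t) \<Rightarrow> G t x) = Gb (x, t)"
    and Gbint: "integrable lborel (\<lambda>p. (norm (Gb p))\<^sup>2)"
    using L2_borel_representative[OF \<Omega>(2) Ib G] by blast
  obtain Fb where Fb[measurable]: "Fb \<in> borel_measurable borel" and Fb0: "\<And>p. p \<notin> \<Omega> \<times> {0<..<T} \<Longrightarrow> Fb p = 0"
    and FFb: "AE t in ?I. AE x in ?L. F (x, t) = Fb (x, t)"
    and Fbint: "integrable lborel (\<lambda>p. (norm (Fb p))\<^sup>2)"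
    and Fbnorm: "(LINT p|lborel. (norm (Fb p))\<^sup>2) = (LINT p|?Q. (norm (F p))\<^sup>2)"
    using L2_borel_representative[OF \<Omega>(2) Ib F] by blast
  define n where "n t = (LINT x|?L. (y t x)\<^sup>2)" for t
  define D where "D r t = (LINT x|lborel. Gb (x, r) \<bullet> Gb (x, t))" for r t
  define e where "e r = (LINT x|lborel. (norm (Fb (x, r)))\<^sup>2)" for r
  define \<gamma> where "\<gamma> r = (LINT x|lborel. (norm (Gb (x, r)))\<^sup>2)" for r
  note yL = C_L2_L2[OF y]
  have n_cont: "continuous_on {0..T} n" unfolding n_def by (rule C_L2_continuous_norm[OF y])
  have n_nonneg: "0 \<le> n t" for t by (simp add: n_def)
  have n0: "n 0 = 0" unfolding n_def using init by (intro integral_eq_zero_AE) auto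
  obtain tm where tm: "tm \<in> {0..T}" "\<And>t. t \<in> {0..T} \<Longrightarrow> n t \<le> n tm"
    using continuous_attains_sup[OF compact_Icc _ n_cont] T by auto
  define M where "M = n tm"
  have M: "0 \<le> M" "\<And>t. t \<in> {0..T} \<Longrightarrow> n t \<le> M" using tm n_nonneg by (auto simp: M_def)
  have e_int: "integrable lborel e" unfolding e_def by (rule L2_lborel_sections(2)[OF Fb Fbint])
  have e_eq: "(LINT r|lborel. e r) = (LINT p|?Q. (F p)\<^sup>2)"
    unfolding e_def L2_lborel_sections(3)[OF Fb Fbint] Fbnorm by simp
  have e_nonneg: "0 \<le> e r" for r by (simp add: e_def)
  have \<gamma>_int: "integrable lborel \<gamma>" unfolding \<gamma>_def by (rule L2_lborel_sections(2)[OF Gb Gbint])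
  have Gsec: "AE t in lborel. (\<lambda>x. Gb (x, t)) \<in> L2 lborel" by (rule L2_lborel_sections(1)[OF Gb Gbint])
  have Fsec: "AE t in lborel. (\<lambda>x. Fb (x, t)) \<in> L2 lborel" by (rule L2_lborel_sections(1)[OF Fb Fbint])
  have [measurable]: "e \<in> borel_measurable borel" "\<gamma> \<in> borel_measurable borel"
    using borel_measurable_integrable[OF e_int] borel_measurable_integrable[OF \<gamma>_int] by simp_all
  have D_meas[measurable]: "(\<lambda>r. D r t) \<in> borel_measurable borel" for t
  proof -
    have [measurable]: "Gb \<in> borel_measurable (borel \<Otimes>\<^sub>M borel)" using Gb by (simp add: borel_prod)
    have "(\<lambda>r. LINT x|lborel. Gb (x, r) \<bullet> Gb (x, t)) \<in> borel_measurable borel" by measurable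
    then show ?thesis by (simp add: D_def)
  qed
  have D_int: "integrable lborel (\<lambda>r. indicator {s<..<t} r * D r t)" if "(\<lambda>x. Gb (x, t)) \<in> L2 lborel" for s t
  proof (rule Bochner_Integration.integrable_bound)
    have "integrable lborel (indicator {s<..<t} :: real \<Rightarrow> real)"
      by (rule integrable_real_indicator) (cases "s \<le> t"; simp)+
    then show "integrable lborel (\<lambda>r. \<gamma> r + indicator {s<..<t} r * \<gamma> t)"
      using \<gamma>_int by simp
    show "AE r in lborel. norm (indicator {s<..<t} r * D r t) \<le> norm (\<gamma> r + indicator {s<..<t} r * \<gamma> t)"
      using Gsec
    proof eventually_elim
      case (elim r)
      have "\<bar>D r t\<bar> \<le> sqrt (\<gamma> r) * sqrt (\<gamma> t)"
        unfolding D_def \<gamma>_def by (rule L2_Cauchy_Schwarz[OF elim that])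
      also have "\<dots> \<le> \<gamma> r + \<gamma> t"
      proof -
        have nn: "0 \<le> \<gamma> r" "0 \<le> \<gamma> t" by (simp_all add: \<gamma>_def)
        then have "sqrt (\<gamma> r) * sqrt (\<gamma> t) \<le> (\<gamma> r + \<gamma> t) / 2"
          using arith_geo_mean_sqrt[of "\<gamma> r" "\<gamma> t"] by (simp add: real_sqrt_mult)
        also have "\<dots> \<le> \<gamma> r + \<gamma> t" using nn by simp
        finally show ?thesis .
      qed
      finally show ?case by (auto simp: indicator_def \<gamma>_def)
    qed
  qed simp
  define p where "p r = 2 * T * e r + M / (2 * T)" for r
  have p_nonneg: "0 \<le> p r" for r using T M e_nonneg by (simp add: p_def)
  have [measurable]: "p \<in> borel_measurable borel" unfolding p_def by measurable
  have p_int: "integrable (lebesgue_on {0..T}) p"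
    unfolding p_def using integrable_lborel_imp_lebesgue_on[OF e_int, of "{0..T}"]
    by (intro Bochner_Integration.integrable_add integrable_mult_right) (auto simp: integrable_restrict_space)
  \<comment> \<open>the weak formulation tested with the solution at a fixed time\<close>
  have key: "AE t in ?I. (\<lambda>x. Gb (x, t)) \<in> L2 lborel \<and> (\<forall>s. 0 \<le> s \<and> s < t \<longrightarrow>
      n t - n s \<le> (LINT r|lebesgue_on {s<..<t}. p r - 2 * D r t))"
  proof -
    have "AE t in ?I. (\<lambda>x. Gb (x, t)) \<in> L2 lborel" using Gsec by (auto simp: AE_lebesgue_on_iff)
    then show ?thesis using wg tr GGb AE_space
    proof eventually_elim
      case (elim t)
      then obtain h where h: "has_trace \<Omega> (y t) h" "AE x in restrict_space (boundary_measure \<Omega>) \<Gamma>1. h x = 0"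
        by blast
      have t: "t \<in> {0..T}" "t \<le> T" using elim by auto
      have V: "y t \<in> V_space \<Omega> \<Gamma>1" using h by (auto simp: V_space_def)
      have dual: "L2_dual \<Omega> \<Gamma>1 T w" using w by (simp add: weak_time_derivative_def)
      have "integrable ?I (\<lambda>r. 1 * w r (y t))"
        by (intro L2_mult_integrable L2_dual_L2[OF dual V] continuous_L2_lebesgue_on) auto
      then have k: "integrable ?I (\<lambda>r. w r (y t))" by simp
      have "AE r in ?I. (\<lambda>x. Fb (x, r)) \<in> L2 lborel" using Fsec by (auto simp: AE_lebesgue_on_iff)
      then have bound: "AE r in ?I. w r (y t) \<le> T * e r + M / (4 * T) - D r t"
        using eq[OF elim(2) h] wg GGb FFb L2_sections[OF \<Omega>(2) Ib F]
      proof eventually_elim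
        case (elim r)
        note r = elim
        have Gt: "G t \<in> L2 ?L" "G r \<in> L2 ?L" using \<open>weak_gradient \<Omega> (y t) (G t)\<close> r(3) by (auto simp: weak_gradient_def)
        have "(LINT x|?L. G r x \<bullet> G t x) = (LINT x|?L. Gb (x, r) \<bullet> Gb (x, t))"
        proof (rule integral_cong_AE)
          show "(\<lambda>x. G r x \<bullet> G t x) \<in> borel_measurable ?L"
            using Gt[THEN L2_measurable] by measurable
          show "(\<lambda>x. Gb (x, r) \<bullet> Gb (x, t)) \<in> borel_measurable ?L"
            by (rule lebesgue_on_borel_measurable) measurable
          show "AE x in ?L. G r x \<bullet> G t x = Gb (x, r) \<bullet> Gb (x, t)"
            using r(4) \<open>AE x in ?L. (case (x, t) of (x, t) \<Rightarrow> G t x) = Gb (x, t)\<close> by eventually_elim simp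
        qed
        also have "\<dots> = D r t"
          unfolding D_def using Gb0 by (intro lebesgue_on_integral_lborel \<Omega>) auto
        finally have D: "(LINT x|?L. G r x \<bullet> G t x) = D r t" .
        have "(LINT x|?L. F (x, r) * y t x) \<le> (LINT x|?L. T * (F (x, r))\<^sup>2 + 1 / (4 * T) * (y t x)\<^sup>2)"
        proof (rule integral_mono)
          show "integrable ?L (\<lambda>x. F (x, r) * y t x)" by (rule L2_mult_integrable[OF r(6) yL[OF t(1)]])
          show "integrable ?L (\<lambda>x. T * (F (x, r))\<^sup>2 + 1 / (4 * T) * (y t x)\<^sup>2)"
            using L2_integrable_real[OF r(6)] L2_integrable_real[OF yL[OF t(1)]] by simp
          fix x
          have "0 \<le> T * (F (x, r) - y t x / (2 * T))\<^sup>2" using T by simp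
          also have "\<dots> = T * (F (x, r))\<^sup>2 + 1 / (4 * T) * (y t x)\<^sup>2 - F (x, r) * y t x"
            using T by (simp add: field_simps power2_eq_square)
          finally show "F (x, r) * y t x \<le> T * (F (x, r))\<^sup>2 + 1 / (4 * T) * (y t x)\<^sup>2" by simp
        qed
        also have "\<dots> = T * (LINT x|?L. (F (x, r))\<^sup>2) + 1 / (4 * T) * n t"
          using L2_integrable_real[OF r(6)] L2_integrable_real[OF yL[OF t(1)]] by (simp add: n_def)
        also have "(LINT x|?L. (F (x, r))\<^sup>2) = (LINT x|?L. (norm (Fb (x, r)))\<^sup>2)"
        proof (rule integral_cong_AE)
          show "(\<lambda>x. (F (x, r))\<^sup>2) \<in> borel_measurable ?L" using L2_measurable[OF r(6)] by measurable
          show "(\<lambda>x. (norm (Fb (x, r)))\<^sup>2) \<in> borel_measurable ?L"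
            by (rule lebesgue_on_borel_measurable) measurable
          show "AE x in ?L. (F (x, r))\<^sup>2 = (norm (Fb (x, r)))\<^sup>2" using r(5) by eventually_elim simp
        qed
        also have "\<dots> = e r"
          unfolding e_def using Fb0 by (intro lebesgue_on_integral_lborel \<Omega>) auto
        finally have "(LINT x|?L. F (x, r) * y t x) \<le> T * e r + 1 / (4 * T) * n t" .
        moreover have "1 / (4 * T) * n t \<le> M / (4 * T)"
          using M(2)[OF t(1)] T by (simp add: divide_right_mono)
        ultimately show ?case using r(2) D by simp
      qed
      have main: "n t - n s \<le> (LINT r|lebesgue_on {s<..<t}. p r - 2 * D r t)" if s: "0 \<le> s" "s < t" for s
      proof -
        have sT: "s \<in> {0..T}" and sub: "{s<..<t} \<subseteq> {0<..<T}" "{s<..<t} \<subseteq> {0..T}" using s t by auto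
        let ?m = "\<lambda>r. LINT x|?L. y r x * y t x"
        have "?m t - ?m s = (LINT r|lebesgue_on {s<..<t}. w r (y t))"
        proof (rule weak_derivative_imp_difference[OF C_L2_continuous_inner[OF y yL[OF t(1)]] k _ s t(2)])
          fix \<theta> assume "test_function {0<..<T} \<theta>"
          then show "(LINT r|?I. deriv \<theta> r * ?m r) = - (LINT r|?I. \<theta> r * w r (y t))"
            using w V by (simp add: weak_time_derivative_def)
        qed
        also have "\<dots> \<le> (LINT r|lebesgue_on {s<..<t}. (1/2) * (p r - 2 * D r t))"
        proof (rule integral_mono_AE)
          show "integrable (lebesgue_on {s<..<t}) (\<lambda>r. w r (y t))"
            by (rule integrable_lebesgue_on_subset[OF k]) (use sub in auto)
          have "integrable (lebesgue_on {s<..<t}) (\<lambda>r. indicator {s<..<t} r * D r t)"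
            by (rule integrable_lborel_imp_lebesgue_on[OF D_int]) (use elim in auto)
          then have "integrable (lebesgue_on {s<..<t}) (\<lambda>r. D r t)"
            by (subst (asm) Bochner_Integration.integrable_cong[OF refl]) auto
          moreover have "integrable (lebesgue_on {s<..<t}) p"
            by (rule integrable_lebesgue_on_subset[OF p_int]) (use sub in auto)
          ultimately show "integrable (lebesgue_on {s<..<t}) (\<lambda>r. (1/2) * (p r - 2 * D r t))" by simp
          have "AE r in lebesgue_on {s<..<t}. w r (y t) \<le> T * e r + M / (4 * T) - D r t"
            by (rule AE_lebesgue_on_subset[OF bound]) (use sub in auto)
          then show "AE r in lebesgue_on {s<..<t}. w r (y t) \<le> (1/2) * (p r - 2 * D r t)"
            by eventually_elim (simp add: p_def field_simps)
        qed
        also have "\<dots> = (1/2) * (LINT r|lebesgue_on {s<..<t}. p r - 2 * D r t)" by simp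
        finally have le: "2 * (?m t - ?m s) \<le> (LINT r|lebesgue_on {s<..<t}. p r - 2 * D r t)" by simp
        have "?m s \<le> (LINT x|?L. (1/2) * (y s x)\<^sup>2 + (1/2) * (y t x)\<^sup>2)"
        proof (rule integral_mono)
          show "integrable ?L (\<lambda>x. y s x * y t x)" by (rule L2_mult_integrable[OF yL[OF sT] yL[OF t(1)]])
          show "integrable ?L (\<lambda>x. (1/2) * (y s x)\<^sup>2 + (1/2) * (y t x)\<^sup>2)"
            using L2_integrable_real[OF yL[OF sT]] L2_integrable_real[OF yL[OF t(1)]] by simp
          show "y s x * y t x \<le> (1/2) * (y s x)\<^sup>2 + (1/2) * (y t x)\<^sup>2" for x
            using sum_squares_bound[of "y s x" "y t x"] by simp
        qed
        also have "\<dots> = (1/2) * n s + (1/2) * n t"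
          using L2_integrable_real[OF yL[OF sT]] L2_integrable_real[OF yL[OF t(1)]] by (simp add: n_def)
        finally have "2 * ?m s \<le> n s + n t" by simp
        moreover have "?m t = n t" by (simp add: n_def power2_eq_square)
        ultimately show ?thesis using le by simp
      qed
      then show ?case using elim by blast
    qed
  qed
  define P where "P t = integral {0..t} p" for t
  have p_on: "p integrable_on {0..T}" using p_int by (intro integrable_on_lebesgue_on) auto
  have P_cont: "continuous_on {0..T} P" unfolding P_def by (rule indefinite_integral_continuous_1[OF p_on])
  have P_diff: "(LINT r|lebesgue_on {s<..<t}. p r) = P t - P s" if "0 \<le> s" "s < t" "t \<le> T" for s t
  proof -
    have "integrable (lebesgue_on {s<..<t}) p" by (rule integrable_lebesgue_on_subset[OF p_int]) (use that in auto)
    then have "(LINT r|lebesgue_on {s<..<t}. p r) = integral {s..t} p"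
      by (subst lebesgue_integral_eq_integral) (auto simp: integral_open_interval_real)
    moreover have "integral {0..s} p + integral {s..t} p = integral {0..t} p"
      using that integrable_on_subinterval[OF p_on, of 0 t]
      by (intro Henstock_Kurzweil_Integration.integral_combine) auto
    ultimately show ?thesis by (simp add: P_def)
  qed
  have P_le: "P t \<le> 2 * T * (LINT p|?Q. (F p)\<^sup>2) + M / 2" if t: "t \<in> {0..T}" for t
  proof -
    have "P t \<le> integral {0..T} p"
      unfolding P_def using t p_on p_nonneg integrable_on_subinterval[OF p_on, of 0 t]
      by (intro integral_subset_le) auto
    also have "\<dots> = (LINT r|lebesgue_on {0..T}. p r)"
      using p_int by (intro lebesgue_integral_eq_integral[symmetric]) auto
    also have "\<dots> = 2 * T * (LINT r|lebesgue_on {0..T}. e r) + M / 2"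
    proof -
      have m: "measure (lebesgue_on {0..T}) {0..T} = T" using T by (simp add: measure_restrict_space)
      have "integrable (lebesgue_on {0..T}) (\<lambda>_. M / (2 * T))" by (simp add: integrable_restrict_space)
      moreover have "integrable (lebesgue_on {0..T}) e" by (rule integrable_lborel_imp_lebesgue_on[OF e_int]) simp
      ultimately show ?thesis using T m by (simp add: p_def)
    qed
    also have "(LINT r|lebesgue_on {0..T}. e r) \<le> (LINT r|lborel. e r)"
    proof -
      have "(LINT r|lebesgue_on {0..T}. e r) = (LINT r|lborel. indicator {0..T} r * e r)"
        by (rule lebesgue_on_integral_indicator) auto
      also have "\<dots> \<le> (LINT r|lborel. e r)"
        using e_int e_nonneg integrable_mult_indicator[OF _ e_int, of "{0..T}"]
        by (intro integral_mono) (auto simp: indicator_def)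
      finally show ?thesis .
    qed
    finally show ?thesis using T by (simp add: e_eq mult_left_mono)
  qed
  \<comment> \<open>averaging over the final time: the gradient contributes with a favourable sign\<close>
  have mean: "integral {a..b} (\<lambda>t. n t - P t) \<le> (b - a) * (n a - P a)" if ab: "0 \<le> a" "a < b" "b \<le> T" for a b
  proof -
    define K where "K t = indicator {a<..<b} t * (LINT r|lborel. indicator {a<..<t} r * D r t)" for t
    have K: "integrable lborel K" "0 \<le> (LINT t|lborel. K t)"
      using Volterra_form_nonneg[OF Gb Gbint, of a b] by (simp_all add: K_def[abs_def] D_def)
    have [measurable]: "K \<in> borel_measurable borel" using borel_measurable_integrable[OF K(1)] by simp
    have q_cont: "continuous_on {a..b} (\<lambda>t. n t - P t)"
      by (intro continuous_intros continuous_on_subset[OF n_cont] continuous_on_subset[OF P_cont]) (use ab in auto)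
    have q_int: "integrable (lebesgue_on {a<..<b}) (\<lambda>t. n t - P t)"
    proof -
      have "integrable (lebesgue_on {a..b}) (\<lambda>t. n t - P t)"
        using q_cont by (intro continuous_imp_integrable_real)
      then show ?thesis by (rule integrable_lebesgue_on_subset) auto
    qed
    have K_int: "integrable (lebesgue_on {a<..<b}) K" by (rule integrable_lborel_imp_lebesgue_on[OF K(1)]) simp
    have const: "integrable (lebesgue_on {a<..<b}) (\<lambda>_. n a - P a)" using ab by (simp add: integrable_restrict_space)
    have "AE t in lebesgue_on {a<..<b}. (\<lambda>x. Gb (x, t)) \<in> L2 lborel \<and> (\<forall>s. 0 \<le> s \<and> s < t \<longrightarrow>
        n t - n s \<le> (LINT r|lebesgue_on {s<..<t}. p r - 2 * D r t))"
      by (rule AE_lebesgue_on_subset[OF key]) (use ab in auto)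
    then have le: "AE t in lebesgue_on {a<..<b}. n t - P t \<le> (n a - P a) - 2 * K t"
      using AE_space
    proof eventually_elim
      case (elim t)
      then have t: "a < t" "t < b" by auto
      have "integrable (lebesgue_on {a<..<t}) (\<lambda>r. indicator {a<..<t} r * D r t)"
        by (rule integrable_lborel_imp_lebesgue_on[OF D_int]) (use elim in auto)
      then have Di: "integrable (lebesgue_on {a<..<t}) (\<lambda>r. D r t)"
        by (subst (asm) Bochner_Integration.integrable_cong[OF refl]) auto
      have pi: "integrable (lebesgue_on {a<..<t}) p"
        by (rule integrable_lebesgue_on_subset[OF p_int]) (use ab t in auto)
      have "n t - n a \<le> (LINT r|lebesgue_on {a<..<t}. p r - 2 * D r t)" using elim t ab by blast
      also have "\<dots> = (LINT r|lebesgue_on {a<..<t}. p r) - 2 * (LINT r|lebesgue_on {a<..<t}. D r t)"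
        using Di pi by simp
      also have "\<dots> = P t - P a - 2 * K t"
        using P_diff[of a t] ab t by (simp add: K_def lebesgue_on_integral_indicator)
      finally show ?case by simp
    qed
    have "integral {a..b} (\<lambda>t. n t - P t) = (LINT t|lebesgue_on {a<..<b}. n t - P t)"
      using q_int by (subst lebesgue_integral_eq_integral) (auto simp: integral_open_interval_real)
    also have "\<dots> \<le> (LINT t|lebesgue_on {a<..<b}. (n a - P a) - 2 * K t)"
      using le q_int K_int const by (intro integral_mono_AE) auto
    also have "\<dots> = (b - a) * (n a - P a) - 2 * (LINT t|lebesgue_on {a<..<b}. K t)"
    proof -
      have "measure (lebesgue_on {a<..<b}) {a<..<b} = b - a" using ab by (simp add: measure_restrict_space)
      then show ?thesis using K_int const by simp
    qed
    also have "(LINT t|lebesgue_on {a<..<b}. K t) = (LINT t|lborel. K t)"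
    proof (rule lebesgue_on_integral_lborel)
      show "K t = 0" if "t \<notin> {a<..<b}" for t using that by (simp add: K_def)
    qed simp_all
    finally show ?thesis using K(2) by simp
  qed
  have "n t - P t \<le> n 0 - P 0" if "t \<in> {0..T}" for t
    by (rule le_initial_if_mean_le[of T "\<lambda>t. n t - P t", OF _ that mean])
      (intro continuous_intros n_cont P_cont)
  then have "n t \<le> P t" if "t \<in> {0..T}" for t using that n0 by (force simp: P_def)
  then have "n t \<le> 2 * T * (LINT p|?Q. (F p)\<^sup>2) + M / 2" if "t \<in> {0..T}" for t
    using P_le[OF that] that by force
  from this[OF tm(1)] have "M \<le> 4 * T * (LINT p|?Q. (F p)\<^sup>2)" by (simp add: M_def)
  then show ?thesis using M(2)[OF tT] by (simp add: n_def)
qed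

section \<open>Linear-quadratic games with a common observation\<close>

text \<open>The situation of the theorem without the heat equation: the cost of player \<open>i\<close> is the cost of the own
  control plus the squared distance of the observation \<open>S v\<close> from the individual target \<open>d i\<close>, measured in
  a semi-inner product \<open>B\<close> shared by all players.  Linearity of \<open>S\<close> is expressed through \<open>B\<close>, since states
  are determined only up to null sets.\<close>
locale common_observation_game = semi_inner H lc B
  for H :: "'h set" and lc :: "real \<Rightarrow> 'h \<Rightarrow> real \<Rightarrow> 'h \<Rightarrow> 'h" and B :: "'h \<Rightarrow> 'h \<Rightarrow> real" +
  fixes N :: nat and M :: "nat \<Rightarrow> 'p measure" and \<alpha> :: "nat \<Rightarrow> real" and K :: real
    and S :: "(nat \<Rightarrow> 'p \<Rightarrow> real) \<Rightarrow> 'h" and d :: "nat \<Rightarrow> 'h"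
    and J :: "nat \<Rightarrow> (nat \<Rightarrow> 'p \<Rightarrow> real) \<Rightarrow> real" and U :: "(nat \<Rightarrow> 'p \<Rightarrow> real) set"
  assumes U: "U = {v. \<forall>i\<in>{1..N}. v i \<in> L2 (M i)}"
    and \<alpha>_pos: "\<And>i. i \<in> {1..N} \<Longrightarrow> \<alpha> i > 0"
    and S_H: "\<And>v. v \<in> U \<Longrightarrow> S v \<in> H"
    and d_H: "\<And>i. i \<in> {1..N} \<Longrightarrow> d i \<in> H"
    and S_lin: "\<And>v v1 v2 s t h. v \<in> U \<Longrightarrow> v1 \<in> U \<Longrightarrow> v2 \<in> U \<Longrightarrow>
      (\<And>i p. i \<in> {1..N} \<Longrightarrow> v i p = s * v1 i p + t * v2 i p) \<Longrightarrow> h \<in> H \<Longrightarrow>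
      B (S v) h = s * B (S v1) h + t * B (S v2) h"
    and K_nonneg: "K \<ge> 0"
    and S_bound: "\<And>v. v \<in> U \<Longrightarrow> B (S v) (S v) \<le> K * (\<Sum>i=1..N. LINT p|M i. (v i p)\<^sup>2)"
    and J: "\<And>i v. i \<in> {1..N} \<Longrightarrow> v \<in> U \<Longrightarrow>
      J i v = \<alpha> i / 2 * (LINT p|M i. (v i p)\<^sup>2) + 1 / 2 * B (lc 1 (S v) (-1) (d i)) (lc 1 (S v) (-1) (d i))"
begin

definition only :: "nat \<Rightarrow> ('p \<Rightarrow> real) \<Rightarrow> nat \<Rightarrow> 'p \<Rightarrow> real" where
  "only i w = (\<lambda>_ _. 0)(i := w)"

definition comb_profile :: "real \<Rightarrow> (nat \<Rightarrow> 'p \<Rightarrow> real) \<Rightarrow> real \<Rightarrow> (nat \<Rightarrow> 'p \<Rightarrow> real) \<Rightarrow> nat \<Rightarrow> 'p \<Rightarrow> real" where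
  "comb_profile s u t v = (\<lambda>i p. s * u i p + t * v i p)"

definition energy_form :: "(nat \<Rightarrow> 'p \<Rightarrow> real) \<Rightarrow> (nat \<Rightarrow> 'p \<Rightarrow> real) \<Rightarrow> real" where
  "energy_form u w = (\<Sum>i=1..N. \<alpha> i * (LINT p|M i. u i p * w i p)) + B (S u) (S w)"

definition target_form :: "(nat \<Rightarrow> 'p \<Rightarrow> real) \<Rightarrow> real" where
  "target_form w = (\<Sum>i=1..N. B (d i) (S (only i (w i))))"

lemma U_L2: "v \<in> U \<Longrightarrow> i \<in> {1..N} \<Longrightarrow> v i \<in> L2 (M i)"
  by (simp add: U)

lemma only_U: "w \<in> L2 (M i) \<Longrightarrow> only i w \<in> U"
  by (auto simp: U only_def L2_zero)

lemma comb_profile_U: "u \<in> U \<Longrightarrow> v \<in> U \<Longrightarrow> comb_profile s u t v \<in> U"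
  by (auto simp: U comb_profile_def intro: L2_comb_real)

lemma update_U: "u \<in> U \<Longrightarrow> w \<in> L2 (M i) \<Longrightarrow> u(i := w) \<in> U"
  by (auto simp: U)

lemma B_S_zero:
  assumes "v \<in> U" "\<And>i p. i \<in> {1..N} \<Longrightarrow> v i p = 0" "h \<in> H"
  shows "B (S v) h = 0"
  using S_lin[of v v v 0 0 h] assms by simp

lemma B_S_comb_profile:
  "u \<in> U \<Longrightarrow> v \<in> U \<Longrightarrow> h \<in> H \<Longrightarrow> B (S (comb_profile s u t v)) h = s * B (S u) h + t * B (S v) h"
  by (rule S_lin[OF comb_profile_U]) (simp_all add: comb_profile_def)

lemma B_S_only_comb:
  assumes "u \<in> L2 (M i)" "v \<in> L2 (M i)" "h \<in> H"
  shows "B (S (only i (\<lambda>p. s * u p + t * v p))) h = s * B (S (only i u)) h + t * B (S (only i v)) h"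
proof (rule S_lin[OF only_U only_U only_U])
  show "(\<lambda>p. s * u p + t * v p) \<in> L2 (M i)" using assms by (intro L2_comb_real)
qed (use assms in \<open>auto simp: only_def\<close>)

text \<open>Linearity is available for two summands only, so the components are added one at a time.\<close>
lemma B_S_sum_only:
  assumes v: "v \<in> U" and h: "h \<in> H"
  shows "(\<Sum>i=1..N. B (S (only i (v i))) h) = B (S v) h"
proof -
  define tr where "tr k = (\<lambda>i. if i \<le> k then v i else (\<lambda>_. 0))" for k
  have tr: "tr k \<in> U" for k using v by (auto simp: U tr_def L2_zero)
  have "(\<Sum>i=1..k. B (S (only i (v i))) h) = B (S (tr k)) h" if "k \<le> N" for k
    using that
  proof (induction k)
    case 0
    then show ?case using B_S_zero[OF tr _ h, of 0] by (simp add: tr_def)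
  next
    case (Suc k)
    have "B (S (tr (Suc k))) h = 1 * B (S (tr k)) h + 1 * B (S (only (Suc k) (v (Suc k)))) h"
    proof (rule S_lin[OF tr tr _ _ h])
      show "only (Suc k) (v (Suc k)) \<in> U" using v Suc.prems by (intro only_U) (simp add: U)
      show "tr (Suc k) i p = 1 * tr k i p + 1 * only (Suc k) (v (Suc k)) i p" for i p
        by (auto simp: tr_def only_def le_Suc_eq)
    qed
    then show ?case using Suc by simp
  qed
  then have "(\<Sum>i=1..N. B (S (only i (v i))) h) = B (S (tr N)) h" by simp
  also have "\<dots> = 1 * B (S v) h + 0 * B (S v) h"
    by (rule S_lin[OF tr v v _ h]) (auto simp: tr_def)
  finally show ?thesis by simp
qed

lemma semi_inner_energy_form: "semi_inner U comb_profile energy_form"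
proof
  fix u v w s t assume uv: "u \<in> U" "v \<in> U"
  show "comb_profile s u t v \<in> U" using uv by (rule comb_profile_U)
  show "energy_form u v = energy_form v u" using uv by (simp add: energy_form_def sym S_H mult.commute)
  show "0 \<le> energy_form u u" unfolding energy_form_def
    using uv \<alpha>_pos by (intro add_nonneg_nonneg sum_nonneg mult_nonneg_nonneg nonneg S_H) (auto simp: less_imp_le)
  assume w: "w \<in> U"
  have "(LINT p|M i. comb_profile s u t v i p * w i p) = s * (LINT p|M i. u i p * w i p) + t * (LINT p|M i. v i p * w i p)"
    if i: "i \<in> {1..N}" for i
    using L2_mult_integrable[OF U_L2[OF uv(1) i] U_L2[OF w i]] L2_mult_integrable[OF U_L2[OF uv(2) i] U_L2[OF w i]]
    by (simp add: comb_profile_def distrib_right mult.assoc)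
  then have "(\<Sum>i=1..N. \<alpha> i * (LINT p|M i. comb_profile s u t v i p * w i p))
      = (\<Sum>i=1..N. s * (\<alpha> i * (LINT p|M i. u i p * w i p)) + t * (\<alpha> i * (LINT p|M i. v i p * w i p)))"
    by (intro sum.cong) (auto simp: algebra_simps)
  then show "energy_form (comb_profile s u t v) w = s * energy_form u w + t * energy_form v w"
    unfolding energy_form_def using B_S_comb_profile[OF uv S_H[OF w], of s t]
    by (simp add: sum.distrib sum_distrib_left algebra_simps)
qed

lemma control_norm_le_energy_form:
  assumes "u \<in> U" "i \<in> {1..N}"
  shows "\<alpha> i * (LINT p|M i. (u i p)\<^sup>2) \<le> energy_form u u"
proof -
  have "\<alpha> i * (LINT p|M i. u i p * u i p) \<le> (\<Sum>i=1..N. \<alpha> i * (LINT p|M i. u i p * u i p))"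
    using assms \<alpha>_pos by (intro member_le_sum mult_nonneg_nonneg) (auto simp: less_imp_le)
  also have "\<dots> \<le> energy_form u u" unfolding energy_form_def using nonneg[OF S_H[OF assms(1)]] by simp
  finally show ?thesis by (simp add: power2_eq_square)
qed

lemma B_S_only_le:
  assumes i: "i \<in> {1..N}" and w: "w \<in> L2 (M i)"
  shows "B (S (only i w)) (S (only i w)) \<le> K * (LINT p|M i. (w p)\<^sup>2)"
proof -
  have "(\<Sum>j=1..N. LINT p|M j. (only i w j p)\<^sup>2) = (\<Sum>j=1..N. if j = i then LINT p|M i. (w p)\<^sup>2 else 0)"
    by (intro sum.cong) (auto simp: only_def)
  also have "\<dots> = (LINT p|M i. (w p)\<^sup>2)" using i by simp
  finally show ?thesis using S_bound[OF only_U[OF w]] by simp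
qed

lemma target_form_bounded:
  "\<exists>C. \<forall>w\<in>U. \<bar>target_form w\<bar> \<le> C * sqrt (energy_form w w)"
proof -
  define C where "C = (\<Sum>i=1..N. sqrt (B (d i) (d i)) * sqrt (K / \<alpha> i))"
  have "\<bar>target_form w\<bar> \<le> C * sqrt (energy_form w w)" if w: "w \<in> U" for w
  proof -
    have "\<bar>B (d i) (S (only i (w i)))\<bar> \<le> sqrt (B (d i) (d i)) * sqrt (K / \<alpha> i) * sqrt (energy_form w w)"
      if i: "i \<in> {1..N}" for i
    proof -
      have wi: "w i \<in> L2 (M i)" using w i by (rule U_L2)
      have "\<bar>B (d i) (S (only i (w i)))\<bar> \<le> sqrt (B (d i) (d i)) * sqrt (B (S (only i (w i))) (S (only i (w i))))"
        by (rule Cauchy_Schwarz_sqrt[OF d_H[OF i] S_H[OF only_U[OF wi]]])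
      also have "\<dots> \<le> sqrt (B (d i) (d i)) * sqrt (K / \<alpha> i * energy_form w w)"
      proof (intro mult_left_mono real_sqrt_le_mono)
        have "(LINT p|M i. (w i p)\<^sup>2) \<le> energy_form w w / \<alpha> i"
          using control_norm_le_energy_form[OF w i] \<alpha>_pos[OF i] by (simp add: field_simps)
        then have "K * (LINT p|M i. (w i p)\<^sup>2) \<le> K * (energy_form w w / \<alpha> i)" using K_nonneg by (rule mult_left_mono)
        then show "B (S (only i (w i))) (S (only i (w i))) \<le> K / \<alpha> i * energy_form w w"
          using B_S_only_le[OF i wi] by simp
      qed (use nonneg[OF d_H[OF i]] in simp)
      also have "\<dots> = sqrt (B (d i) (d i)) * sqrt (K / \<alpha> i) * sqrt (energy_form w w)"
        by (simp only: real_sqrt_mult mult.assoc)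
      finally show ?thesis .
    qed
    then have "\<bar>target_form w\<bar> \<le> (\<Sum>i=1..N. sqrt (B (d i) (d i)) * sqrt (K / \<alpha> i) * sqrt (energy_form w w))"
      unfolding target_form_def by (intro order_trans[OF sum_abs] sum_mono) auto
    then show ?thesis by (simp add: C_def sum_distrib_right)
  qed
  then show ?thesis by blast
qed

text \<open>The form dominates the norm of each component, and is dominated by the sum of these norms because \<open>S\<close>
  is bounded.\<close>
lemma energy_form_complete:
  fixes x :: "nat \<Rightarrow> nat \<Rightarrow> 'p \<Rightarrow> real"
  assumes x: "\<And>n. x n \<in> U"
    and Cauchy: "\<And>e. e > 0 \<Longrightarrow> \<exists>k. \<forall>m\<ge>k. \<forall>n\<ge>k. energy_form (comb_profile 1 (x m) (-1) (x n)) (comb_profile 1 (x m) (-1) (x n)) < e"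
  shows "\<exists>u\<in>U. (\<lambda>n. energy_form (comb_profile 1 (x n) (-1) u) (comb_profile 1 (x n) (-1) u)) \<longlonglongrightarrow> 0"
proof -
  have "\<exists>g\<in>L2 (M i). (\<lambda>n. LINT p|M i. (x n i p - g p)\<^sup>2) \<longlonglongrightarrow> 0" if i: "i \<in> {1..N}" for i
  proof (rule L2_complete)
    show "x n i \<in> L2 (M i)" for n using x i by (rule U_L2)
    fix e :: real assume "e > 0"
    then have "\<alpha> i * e > 0" using \<alpha>_pos[OF i] by simp
    from Cauchy[OF this] obtain k
      where k: "\<And>m n. m \<ge> k \<Longrightarrow> n \<ge> k \<Longrightarrow> energy_form (comb_profile 1 (x m) (-1) (x n)) (comb_profile 1 (x m) (-1) (x n)) < \<alpha> i * e" by blast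
    have "(LINT p|M i. (x m i p - x n i p)\<^sup>2) < e" if "m \<ge> k" "n \<ge> k" for m n
    proof -
      have "\<alpha> i * (LINT p|M i. (x m i p - x n i p)\<^sup>2) < \<alpha> i * e"
        using control_norm_le_energy_form[OF comb_profile_U[OF x x] i, of 1 m "-1" n] k[OF that] by (simp add: comb_profile_def)
      then show ?thesis using \<alpha>_pos[OF i] by simp
    qed
    then show "\<exists>k. \<forall>m\<ge>k. \<forall>n\<ge>k. (LINT p|M i. (x m i p - x n i p)\<^sup>2) < e" by blast
  qed
  then have "\<forall>i\<in>{1..N}. \<exists>g. g \<in> L2 (M i) \<and> (\<lambda>n. LINT p|M i. (x n i p - g p)\<^sup>2) \<longlonglongrightarrow> 0" by blast
  from bchoice[OF this] obtain u where u: "\<And>i. i \<in> {1..N} \<Longrightarrow> u i \<in> L2 (M i)"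
      "\<And>i. i \<in> {1..N} \<Longrightarrow> (\<lambda>n. LINT p|M i. (x n i p - u i p)\<^sup>2) \<longlonglongrightarrow> 0" by blast
  have uU: "u \<in> U" using u(1) by (simp add: U)
  have "(\<lambda>n. energy_form (comb_profile 1 (x n) (-1) u) (comb_profile 1 (x n) (-1) u)) \<longlonglongrightarrow> 0"
  proof (rule Lim_null_comparison)
    show "(\<lambda>n. (\<Sum>i=1..N. \<alpha> i * (LINT p|M i. (x n i p - u i p)\<^sup>2)) + K * (\<Sum>i=1..N. LINT p|M i. (x n i p - u i p)\<^sup>2)) \<longlonglongrightarrow> 0"
    proof -
      have "(\<lambda>n. (\<Sum>i=1..N. \<alpha> i * (LINT p|M i. (x n i p - u i p)\<^sup>2)) + K * (\<Sum>i=1..N. LINT p|M i. (x n i p - u i p)\<^sup>2))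
          \<longlonglongrightarrow> (\<Sum>i=1..N. \<alpha> i * 0) + K * (\<Sum>i=1..N. 0)"
        using u(2) by (intro tendsto_add tendsto_sum tendsto_mult tendsto_const) auto
      then show ?thesis by simp
    qed
    have "norm (energy_form (comb_profile 1 (x n) (-1) u) (comb_profile 1 (x n) (-1) u))
        \<le> (\<Sum>i=1..N. \<alpha> i * (LINT p|M i. (x n i p - u i p)\<^sup>2)) + K * (\<Sum>i=1..N. LINT p|M i. (x n i p - u i p)\<^sup>2)" for n
    proof -
      have "comb_profile 1 (x n) (-1) u \<in> U" by (rule comb_profile_U[OF x uU])
      from S_bound[OF this] semi_inner.nonneg[OF semi_inner_energy_form this] show ?thesis
        by (simp add: energy_form_def comb_profile_def power2_eq_square)
    qed
    then show "\<forall>\<^sub>F n in sequentially. norm (energy_form (comb_profile 1 (x n) (-1) u) (comb_profile 1 (x n) (-1) u))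
        \<le> (\<Sum>i=1..N. \<alpha> i * (LINT p|M i. (x n i p - u i p)\<^sup>2)) + K * (\<Sum>i=1..N. LINT p|M i. (x n i p - u i p)\<^sup>2)"
      by (intro always_eventually allI)
  qed
  then show ?thesis using uU by blast
qed

text \<open>The Euler equations: for each player the derivative of the own cost in the own control vanishes.\<close>
definition stationary :: "(nat \<Rightarrow> 'p \<Rightarrow> real) \<Rightarrow> bool" where
  "stationary u \<longleftrightarrow> (\<forall>i\<in>{1..N}. \<forall>w\<in>L2 (M i).
     \<alpha> i * (LINT p|M i. u i p * w p) + B (S u) (S (only i w)) = B (d i) (S (only i w)))"

lemma J_along_line:
  assumes u: "u \<in> U" and i: "i \<in> {1..N}" and w: "w \<in> L2 (M i)"
  shows "J i (u(i := (\<lambda>p. u i p + s * w p))) = J i u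
    + s * (\<alpha> i * (LINT p|M i. u i p * w p) + B (S u) (S (only i w)) - B (d i) (S (only i w)))
    + s\<^sup>2 * ((\<alpha> i * (LINT p|M i. (w p)\<^sup>2) + B (S (only i w)) (S (only i w))) / 2)"
proof -
  define u' where "u' = u(i := (\<lambda>p. u i p + s * w p))"
  have ui: "u i \<in> L2 (M i)" using u i by (rule U_L2)
  have u': "u' \<in> U" unfolding u'_def using L2_comb_real[OF ui w, of 1 s] by (intro update_U u) simp
  have sw: "only i w \<in> U" by (rule only_U[OF w])
  have lin1: "B (S u') h = B (S u) h + s * B (S (only i w)) h" if "h \<in> H" for h
    using S_lin[OF u' u sw _ that, of 1 s] by (auto simp: u'_def only_def)
  have HH: "S u \<in> H" "S u' \<in> H" "S (only i w) \<in> H" "d i \<in> H" by (intro S_H d_H u u' sw i)+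
  have BB: "B (S u') (S u') = B (S u) (S u) + 2 * s * B (S u) (S (only i w)) + s\<^sup>2 * B (S (only i w)) (S (only i w))"
    using lin1[OF HH(2)] lin1[OF HH(1)] lin1[OF HH(3)] sym[OF HH(1) HH(2)] sym[OF HH(3) HH(2)] sym[OF HH(3) HH(1)]
    by (simp add: algebra_simps power2_eq_square)
  have sq: "B (lc 1 (S v) (-1) (d i)) (lc 1 (S v) (-1) (d i)) = B (S v) (S v) - 2 * B (S v) (d i) + B (d i) (d i)"
    if "v \<in> U" for v
    using square_lc[OF S_H[OF that] HH(4), of 1 "-1"] by simp
  have "(LINT p|M i. (u' i p)\<^sup>2) = (LINT p|M i. (u i p)\<^sup>2 + 2 * s * (u i p * w p) + s\<^sup>2 * (w p)\<^sup>2)"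
    by (rule Bochner_Integration.integral_cong) (auto simp: u'_def power2_eq_square algebra_simps)
  also have "\<dots> = (LINT p|M i. (u i p)\<^sup>2) + 2 * s * (LINT p|M i. u i p * w p) + s\<^sup>2 * (LINT p|M i. (w p)\<^sup>2)"
    using L2_integrable_real[OF ui] L2_integrable_real[OF w] L2_mult_integrable[OF ui w] by simp
  finally have norm: "(LINT p|M i. (u' i p)\<^sup>2) = (LINT p|M i. (u i p)\<^sup>2) + 2 * s * (LINT p|M i. u i p * w p) + s\<^sup>2 * (LINT p|M i. (w p)\<^sup>2)" .
  show ?thesis
    unfolding u'_def[symmetric] J[OF i u] J[OF i u'] sq[OF u] sq[OF u'] norm BB lin1[OF HH(4)] sym[OF HH(4) HH(3)]
    by (simp add: field_simps)
qed

text \<open>Along a line in the variable of one player the cost is a polynomial of degree two with nonnegative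
  leading coefficient.\<close>
lemma nash_iff_stationary:
  assumes u: "u \<in> U"
  shows "nash_equilibrium N (\<lambda>i. L2 (M i)) J u \<longleftrightarrow> stationary u"
proof
  assume nash: "nash_equilibrium N (\<lambda>i. L2 (M i)) J u"
  show "stationary u"
    unfolding stationary_def
  proof (intro ballI)
    fix i and w :: "'p \<Rightarrow> real" assume i: "i \<in> {1..N}" and w: "w \<in> L2 (M i)"
    have "0 \<le> s * (\<alpha> i * (LINT p|M i. u i p * w p) + B (S u) (S (only i w)) - B (d i) (S (only i w)))
      + s\<^sup>2 * ((\<alpha> i * (LINT p|M i. (w p)\<^sup>2) + B (S (only i w)) (S (only i w))) / 2)" for s
    proof -
      have "(\<lambda>p. u i p + s * w p) \<in> L2 (M i)" using L2_comb_real[OF U_L2[OF u i] w, of 1 s] by simp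
      then have "J i u \<le> J i (u(i := (\<lambda>p. u i p + s * w p)))" using nash i by (simp add: nash_equilibrium_def)
      then show ?thesis unfolding J_along_line[OF u i w] by linarith
    qed
    from quadratic_nonneg_imp_linear_zero[OF this]
    show "\<alpha> i * (LINT p|M i. u i p * w p) + B (S u) (S (only i w)) = B (d i) (S (only i w))" by simp
  qed
next
  assume st: "stationary u"
  show "nash_equilibrium N (\<lambda>i. L2 (M i)) J u"
    unfolding nash_equilibrium_def
  proof (intro ballI)
    fix i and v :: "'p \<Rightarrow> real" assume i: "i \<in> {1..N}" and v: "v \<in> L2 (M i)"
    define w where "w = (\<lambda>p. v p - u i p)"
    have w: "w \<in> L2 (M i)" unfolding w_def by (rule L2_diff[OF v U_L2[OF u i]])
    have "0 \<le> \<alpha> i * (LINT p|M i. (w p)\<^sup>2) + B (S (only i w)) (S (only i w))"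
      using \<alpha>_pos[OF i] by (intro add_nonneg_nonneg mult_nonneg_nonneg nonneg S_H only_U w) auto
    moreover have "\<alpha> i * (LINT p|M i. u i p * w p) + B (S u) (S (only i w)) = B (d i) (S (only i w))"
      using st i w by (simp add: stationary_def)
    moreover have "u(i := (\<lambda>p. u i p + 1 * w p)) = u(i := v)" by (simp add: w_def)
    ultimately show "J i u \<le> J i (u(i := v))" using J_along_line[OF u i w, of 1] by simp
  qed
qed

text \<open>The Riesz representer of the right-hand side, tested with controls of a single player.\<close>
theorem exists_stationary: "\<exists>u\<in>U. stationary u"
proof -
  obtain C where C: "\<And>w. w \<in> U \<Longrightarrow> \<bar>target_form w\<bar> \<le> C * sqrt (energy_form w w)" using target_form_bounded by blast
  have ne: "U \<noteq> {}" using comb_profile_U by (auto simp: U intro!: exI[of _ "\<lambda>_ _. 0"] L2_zero)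
  have lin: "target_form (comb_profile s u t v) = s * target_form u + t * target_form v" if uv: "u \<in> U" "v \<in> U" for s t u v
  proof -
    have "B (d i) (S (only i (comb_profile s u t v i))) = s * B (d i) (S (only i (u i))) + t * B (d i) (S (only i (v i)))"
      if i: "i \<in> {1..N}" for i
    proof -
      have L: "u i \<in> L2 (M i)" "v i \<in> L2 (M i)" "comb_profile s u t v i \<in> L2 (M i)"
        using uv i by (auto intro: U_L2 comb_profile_U)
      show ?thesis
        using B_S_only_comb[OF L(1,2) d_H[OF i], of s t] L
          sym[OF d_H[OF i] S_H[OF only_U[OF L(1)]]] sym[OF d_H[OF i] S_H[OF only_U[OF L(2)]]]
          sym[OF d_H[OF i] S_H[OF only_U[OF L(3)]]]
        by (simp add: comb_profile_def)
    qed
    then show ?thesis by (simp add: target_form_def sum.distrib sum_distrib_left)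
  qed
  have "\<exists>u\<in>U. \<forall>w\<in>U. energy_form u w = target_form w"
  proof (rule semi_inner.Riesz_representation[OF semi_inner_energy_form ne, where C = C])
    fix x :: "nat \<Rightarrow> nat \<Rightarrow> 'p \<Rightarrow> real"
    assume "\<And>n. x n \<in> U"
      "\<And>e. e > 0 \<Longrightarrow> \<exists>k. \<forall>m\<ge>k. \<forall>n\<ge>k. energy_form (comb_profile 1 (x m) (-1) (x n)) (comb_profile 1 (x m) (-1) (x n)) < e"
    then show "\<exists>u\<in>U. (\<lambda>n. energy_form (comb_profile 1 (x n) (-1) u) (comb_profile 1 (x n) (-1) u)) \<longlonglongrightarrow> 0"
      by (rule energy_form_complete)
  qed (rule lin, assumption, assumption, rule C)
  then obtain u where u: "u \<in> U" and eq: "\<And>w. w \<in> U \<Longrightarrow> energy_form u w = target_form w" by blast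
  have "stationary u"
    unfolding stationary_def
  proof (intro ballI)
    fix i and w :: "'p \<Rightarrow> real" assume i: "i \<in> {1..N}" and w: "w \<in> L2 (M i)"
    have sw: "only i w \<in> U" by (rule only_U[OF w])
    have "(\<Sum>j=1..N. \<alpha> j * (LINT p|M j. u j p * only i w j p)) = (\<Sum>j=1..N. if j = i then \<alpha> i * (LINT p|M i. u i p * w p) else 0)"
      by (intro sum.cong) (auto simp: only_def)
    then have "energy_form u (only i w) = \<alpha> i * (LINT p|M i. u i p * w p) + B (S u) (S (only i w))"
      using i by (simp add: energy_form_def)
    moreover have "target_form (only i w) = B (d i) (S (only i w))"
    proof -
      have "B (d j) (S (only j (only i w j))) = (if j = i then B (d i) (S (only i w)) else 0)"
        if j: "j \<in> {1..N}" for j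
      proof (cases "j = i")
        case False
        then have z: "only j (only i w j) = (\<lambda>_ _. 0)" by (auto simp: only_def fun_eq_iff)
        have zU: "(\<lambda>_ _. 0) \<in> U" by (simp add: U L2_zero)
        have "B (S (\<lambda>_ _. 0)) (d j) = 0" by (rule B_S_zero[OF zU _ d_H[OF j]]) simp
        then show ?thesis using False z sym[OF d_H[OF j] S_H[OF zU]] by simp
      qed (simp add: only_def)
      then have "target_form (only i w) = (\<Sum>j=1..N. if j = i then B (d i) (S (only i w)) else 0)"
        unfolding target_form_def by (intro sum.cong) auto
      then show ?thesis using i by simp
    qed
    ultimately show "\<alpha> i * (LINT p|M i. u i p * w p) + B (S u) (S (only i w)) = B (d i) (S (only i w))"
      using eq[OF sw] by simp
  qed
  then show ?thesis using u by blast
qed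

text \<open>The Euler equations for the difference \<open>e\<close> of two stationary points, tested with the components of \<open>e\<close>
  and added over the players, give \<open>energy_form e e = 0\<close>.\<close>
theorem stationary_unique:
  assumes u: "u \<in> U" "stationary u" and v: "v \<in> U" "stationary v" and i: "i \<in> {1..N}"
  shows "AE p in M i. u i p = v i p"
proof -
  define e where "e = comb_profile 1 u (-1) v"
  have e: "e \<in> U" unfolding e_def using u v by (intro comb_profile_U)
  have "\<alpha> j * (LINT p|M j. (e j p)\<^sup>2) + B (S e) (S (only j (e j))) = 0" if j: "j \<in> {1..N}" for j
  proof -
    have ej: "e j \<in> L2 (M j)" using e j by (rule U_L2)
    have "\<alpha> j * (LINT p|M j. u j p * e j p) + B (S u) (S (only j (e j)))
        = \<alpha> j * (LINT p|M j. v j p * e j p) + B (S v) (S (only j (e j)))"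
      using u(2) v(2) j ej by (simp add: stationary_def)
    moreover have "(LINT p|M j. (e j p)\<^sup>2) = (LINT p|M j. u j p * e j p - v j p * e j p)"
      by (rule Bochner_Integration.integral_cong) (auto simp: e_def comb_profile_def power2_eq_square algebra_simps)
    moreover have "\<dots> = (LINT p|M j. u j p * e j p) - (LINT p|M j. v j p * e j p)"
      by (intro Bochner_Integration.integral_diff L2_mult_integrable U_L2[OF u(1) j] U_L2[OF v(1) j] ej)
    moreover have "B (S e) (S (only j (e j))) = B (S u) (S (only j (e j))) - B (S v) (S (only j (e j)))"
      unfolding e_def[symmetric] using B_S_comb_profile[OF u(1) v(1) S_H[OF only_U[OF ej]], of 1 "-1"] by (simp add: e_def)
    ultimately show ?thesis by (simp add: right_diff_distrib)
  qed
  then have "(\<Sum>j=1..N. \<alpha> j * (LINT p|M j. (e j p)\<^sup>2) + B (S e) (S (only j (e j)))) = 0" by simp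
  moreover have "(\<Sum>j=1..N. B (S e) (S (only j (e j)))) = B (S e) (S e)"
  proof -
    have "(\<Sum>j=1..N. B (S e) (S (only j (e j)))) = (\<Sum>j=1..N. B (S (only j (e j))) (S e))"
      using e by (intro sum.cong refl sym S_H only_U U_L2) auto
    then show ?thesis using B_S_sum_only[OF e S_H[OF e]] by simp
  qed
  ultimately have "energy_form e e = 0" by (simp add: energy_form_def sum.distrib power2_eq_square)
  then have "(LINT p|M i. (e i p)\<^sup>2) \<le> 0"
    using control_norm_le_energy_form[OF e i] \<alpha>_pos[OF i] by (simp add: mult_le_0_iff)
  then have "(LINT p|M i. (e i p)\<^sup>2) = 0" by (intro antisym) auto
  then have "AE p in M i. (e i p)\<^sup>2 = 0"
    using L2_integrable_real[OF U_L2[OF e i]] by (subst (asm) integral_nonneg_eq_0_iff_AE) auto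
  then show ?thesis by eventually_elim (simp add: e_def comb_profile_def)
qed

theorem exists_unique_nash:
  "\<exists>u\<in>U. nash_equilibrium N (\<lambda>i. L2 (M i)) J u \<and>
     (\<forall>u'\<in>U. nash_equilibrium N (\<lambda>i. L2 (M i)) J u' \<longrightarrow> (\<forall>i\<in>{1..N}. AE p in M i. u' i p = u i p))"
proof -
  obtain u where "u \<in> U" "stationary u" using exists_stationary by blast
  then show ?thesis using nash_iff_stationary stationary_unique by blast
qed

end

section \<open>Observations of the state\<close>

lemma AE_lborel_fst:
  fixes P :: "'a::euclidean_space \<Rightarrow> bool"
  assumes "AE x in lborel. P x"
  shows "AE p in (lborel :: ('a \<times> 'b::euclidean_space) measure). P (fst p)"
proof -
  obtain A where A: "A \<in> null_sets (lborel :: 'a measure)" "\<And>x. x \<notin> A \<Longrightarrow> P x"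
    using assms unfolding eventually_ae_filter by auto
  have "A \<in> sets borel" using null_setsD2[OF A(1)] by simp
  then have "A \<times> (UNIV :: 'b set) \<in> sets borel" by (rule borel_Times) simp
  then have S: "{p :: 'a \<times> 'b. fst p \<notin> A} \<in> sets borel"
    using sets.compl_sets[of "A \<times> (UNIV :: 'b set)" borel]
    by (simp add: Compl_eq_Diff_UNIV[symmetric] Compl_eq mem_Times_iff)
  have "AE p in lborel \<Otimes>\<^sub>M (lborel :: 'b measure). fst p \<notin> A"
  proof (rule lborel_pair.AE_pair_measure)
    show "{p \<in> space (lborel \<Otimes>\<^sub>M (lborel :: 'b measure)). fst p \<notin> A} \<in> sets (lborel \<Otimes>\<^sub>M lborel)"
      using S unfolding lborel_prod by simp
    show "AE x in lborel. AE y in (lborel :: 'b measure). fst (x, y) \<notin> A"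
      using AE_not_in[OF A(1)] by eventually_elim simp
  qed
  then have "AE p in (lborel :: ('a \<times> 'b) measure). fst p \<notin> A" unfolding lborel_prod .
  then show ?thesis by eventually_elim (rule A(2))
qed

lemma AE_lebesgue_on_fst:
  fixes A :: "'a::euclidean_space set" and I :: "'b::euclidean_space set"
  assumes A: "A \<in> sets borel" and I: "I \<in> sets borel" and P: "AE x in lebesgue_on A. P x"
  shows "AE p in lebesgue_on (A \<times> I). P (fst p)"
proof -
  have "AE x in lborel. x \<in> A \<longrightarrow> P x" using P A by (simp add: AE_lebesgue_on_iff)
  then have "AE p in (lborel :: ('a \<times> 'b) measure). fst p \<in> A \<longrightarrow> P (fst p)" by (rule AE_lborel_fst)
  then show ?thesis unfolding AE_lebesgue_on_iff[OF borel_Times[OF A I]] by eventually_elim auto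
qed

lemma lebesgue_on_measurable_fst:
  fixes A :: "'a::euclidean_space set" and I :: "'b::euclidean_space set" and r :: "'a \<Rightarrow> real"
  assumes A: "A \<in> sets borel" and I: "I \<in> sets borel" and r: "r \<in> borel_measurable (lebesgue_on A)"
  shows "(\<lambda>p. r (fst p)) \<in> borel_measurable (lebesgue_on (A \<times> I))"
proof -
  obtain g where g: "g \<in> borel_measurable borel" and rg: "AE x in lebesgue_on A. r x = g x"
    using lebesgue_on_borel_representative[OF A r] by blast
  have "AE x in lebesgue_on A. g x = r x" using rg by eventually_elim simp
  from AE_lebesgue_on_fst[OF A I this]
  have ae: "AE p in lebesgue_on (A \<times> I). g (fst p) = r (fst p)" .
  have "(\<lambda>p :: 'a \<times> 'b. g (fst p)) \<in> borel_measurable borel"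
    using measurable_compose[OF borel_measurable_continuous_onI[OF continuous_on_fst[OF continuous_on_id]] g] by simp
  then have "(\<lambda>p :: 'a \<times> 'b. g (fst p)) \<in> borel_measurable (lebesgue_on (A \<times> I))" by (rule lebesgue_on_borel_measurable)
  then show ?thesis by (rule lebesgue_on_measurable_AE[OF _ _ ae, rotated]) (use borel_Times[OF A I] in simp)
qed

lemma Linf_fst:
  fixes A :: "'a::euclidean_space set" and I :: "'b::euclidean_space set"
  assumes A: "A \<in> sets borel" and I: "I \<in> sets borel" and r: "r \<in> Linf (lebesgue_on A)"
  shows "(\<lambda>p. r (fst p)) \<in> Linf (lebesgue_on (A \<times> I))"
proof -
  obtain C where "AE x in lebesgue_on A. \<bar>r x\<bar> \<le> C" and m: "r \<in> borel_measurable (lebesgue_on A)"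
    using r by (auto simp: Linf_def)
  from AE_lebesgue_on_fst[OF A I this(1)] lebesgue_on_measurable_fst[OF A I m]
  show ?thesis by (auto simp: Linf_def)
qed

lemma Linf_mult_L2:
  fixes f :: "'a \<Rightarrow> real"
  assumes r: "r \<in> Linf M" and f: "f \<in> L2 M"
  shows "(\<lambda>x. r x * f x) \<in> L2 M"
proof -
  obtain C where C: "AE x in M. \<bar>r x\<bar> \<le> C" and m: "r \<in> borel_measurable M" using r by (auto simp: Linf_def)
  have "integrable M (\<lambda>x. (r x * f x)\<^sup>2)"
  proof (rule Bochner_Integration.integrable_bound)
    show "integrable M (\<lambda>x. C\<^sup>2 * (f x)\<^sup>2)" using L2_integrable_real[OF f] by simp
    show "AE x in M. norm ((r x * f x)\<^sup>2) \<le> norm (C\<^sup>2 * (f x)\<^sup>2)"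
      using C
    proof eventually_elim
      case (elim x)
      then have "(\<bar>r x\<bar>)\<^sup>2 \<le> C\<^sup>2" by (intro power_mono) auto
      then show ?case by (simp add: power_mult_distrib mult_right_mono)
    qed
  qed (use m L2_measurable[OF f] in measurable)
  then show ?thesis using m L2_measurable[OF f] by (simp add: L2_def)
qed

lemma weighted_integrable:
  "r \<in> Linf M \<Longrightarrow> f \<in> L2 M \<Longrightarrow> g \<in> L2 M \<Longrightarrow> integrable M (\<lambda>x. r x * f x * g x :: real)"
  by (rule L2_mult_integrable[OF Linf_mult_L2])

lemma weighted_semi_inner:
  assumes r: "r \<in> Linf M" "AE x in M. r x \<ge> 0"
  shows "semi_inner (L2 M) (\<lambda>s u t v x. s * u x + t * v x) (\<lambda>f g. LINT x|M. r x * f x * g x :: real)"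
proof
  fix s t :: real and u v w :: "'a \<Rightarrow> real"
  assume uv: "u \<in> L2 M" "v \<in> L2 M"
  show "(\<lambda>x. s * u x + t * v x) \<in> L2 M" using uv by (rule L2_comb_real)
  assume w: "w \<in> L2 M"
  have "(LINT x|M. r x * (s * u x + t * v x) * w x) = (LINT x|M. s * (r x * u x * w x) + t * (r x * v x * w x))"
    by (simp add: algebra_simps)
  then show "(LINT x|M. r x * (s * u x + t * v x) * w x) = s * (LINT x|M. r x * u x * w x) + t * (LINT x|M. r x * v x * w x)"
    using weighted_integrable[OF r(1) uv(1) w] weighted_integrable[OF r(1) uv(2) w] by simp
next
  fix u v :: "'a \<Rightarrow> real"
  show "(LINT x|M. r x * u x * v x) = (LINT x|M. r x * v x * u x)" by (simp add: mult.assoc mult.commute[of "u _"])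
  show "0 \<le> (LINT x|M. r x * u x * u x)"
    using r(2) by (intro integral_nonneg_AE) (auto simp: mult.assoc elim!: eventually_mono)
qed

lemma weighted_bound:
  assumes r: "r \<in> Linf M"
  obtains C where "C \<ge> 0" "\<And>f. f \<in> L2 M \<Longrightarrow> (LINT x|M. r x * f x * f x :: real) \<le> C * (LINT x|M. (f x)\<^sup>2)"
proof -
  obtain C where C: "AE x in M. \<bar>r x\<bar> \<le> C" using r by (auto simp: Linf_def)
  have "(LINT x|M. r x * f x * f x) \<le> max 0 C * (LINT x|M. (f x)\<^sup>2)" if f: "f \<in> L2 M" for f
  proof -
    have "(LINT x|M. r x * f x * f x) \<le> (LINT x|M. max 0 C * (f x)\<^sup>2)"
    proof (rule integral_mono_AE)
      show "integrable M (\<lambda>x. max 0 C * (f x)\<^sup>2)" using L2_integrable_real[OF f] by simp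
      show "AE x in M. r x * f x * f x \<le> max 0 C * (f x)\<^sup>2"
        using C
      proof eventually_elim
        case (elim x)
        then have "r x \<le> max 0 C" by simp
        then have "r x * (f x)\<^sup>2 \<le> max 0 C * (f x)\<^sup>2" by (rule mult_right_mono) simp
        then show ?case by (simp add: power2_eq_square mult.assoc)
      qed
    qed (rule weighted_integrable[OF r f f])
    then show ?thesis by simp
  qed
  then show ?thesis using that[of "max 0 C"] by simp
qed

lemma semi_inner_prod:
  assumes "semi_inner X1 lc1 a1" "semi_inner X2 lc2 a2"
  shows "semi_inner (X1 \<times> X2) (\<lambda>s u t v. (lc1 s (fst u) t (fst v), lc2 s (snd u) t (snd v)))
    (\<lambda>u v. a1 (fst u) (fst v) + a2 (snd u) (snd v))"
proof -
  interpret s1: semi_inner X1 lc1 a1 by fact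
  interpret s2: semi_inner X2 lc2 a2 by fact
  show ?thesis
  proof
    fix u v :: "'a \<times> 'b" assume uv: "u \<in> X1 \<times> X2" "v \<in> X1 \<times> X2"
    then have m: "fst u \<in> X1" "snd u \<in> X2" "fst v \<in> X1" "snd v \<in> X2" by auto
    show "a1 (fst u) (fst v) + a2 (snd u) (snd v) = a1 (fst v) (fst u) + a2 (snd v) (snd u)"
      using s1.sym[OF m(1,3)] s2.sym[OF m(2,4)] by simp
  qed (auto simp: s1.lc s2.lc s1.lin s2.lin s1.nonneg s2.nonneg algebra_simps)
qed

lemma C_L2_space_time_bound:
  assumes T: "T > 0" and \<Omega>: "\<Omega> \<in> sets borel" and y: "y \<in> C_L2 \<Omega> T"
    and E: "\<And>t. t \<in> {0<..<T} \<Longrightarrow> (LINT x|lebesgue_on \<Omega>. (y t x)\<^sup>2) \<le> E" and E0: "0 \<le> E"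
  shows "(\<lambda>(x, t). y t x) \<in> L2 (lebesgue_on (\<Omega> \<times> {0<..<T}))"
    and "(LINT p|lebesgue_on (\<Omega> \<times> {0<..<T}). (case p of (x, t) \<Rightarrow> y t x)\<^sup>2) \<le> T * E"
proof -
  let ?L = "lebesgue_on \<Omega>"
  let ?Q = "lebesgue_on (\<Omega> \<times> {0<..<T})" and ?I = "lebesgue_on {0<..<T}"
  let ?y = "\<lambda>p. case p of (x, t) \<Rightarrow> y t x"
  have m: "(\<lambda>(x, t). y t x) \<in> borel_measurable ?Q" using y by (simp add: C_L2_def)
  have "(\<integral>\<^sup>+p. ennreal ((norm (?y p))\<^sup>2) \<partial>?Q)
      = (\<integral>\<^sup>+t. (\<integral>\<^sup>+x. ennreal ((norm (?y (x, t)))\<^sup>2) \<partial>?L) \<partial>?I)"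
    by (rule nn_integral_lebesgue_on_iterated[OF \<Omega> _ m]) simp
  also have "\<dots> \<le> (\<integral>\<^sup>+t. ennreal E \<partial>?I)"
  proof (rule nn_integral_mono)
    fix t assume "t \<in> space ?I"
    then have t: "t \<in> {0<..<T}" by simp
    then have "y t \<in> L2 ?L" using C_L2_L2[OF y] by simp
    then have "(\<integral>\<^sup>+x. ennreal ((y t x)\<^sup>2) \<partial>?L) = ennreal (LINT x|?L. (y t x)\<^sup>2)"
      by (intro nn_integral_eq_integral L2_integrable_real) auto
    also have "\<dots> \<le> ennreal E" using E[OF t] by (rule ennreal_leI)
    finally show "(\<integral>\<^sup>+x. ennreal ((norm (?y (x, t)))\<^sup>2) \<partial>?L) \<le> ennreal E" by simp
  qed
  also have "\<dots> = ennreal (T * E)"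
    using T E0 by (simp add: emeasure_restrict_space ennreal_mult[symmetric] mult.commute)
  finally have le: "(\<integral>\<^sup>+p. ennreal ((?y p)\<^sup>2) \<partial>?Q) \<le> ennreal (T * E)" by simp
  have int: "integrable ?Q (\<lambda>p. (?y p)\<^sup>2)"
  proof (rule integrableI_nonneg)
    show "(\<lambda>p. (?y p)\<^sup>2) \<in> borel_measurable ?Q" using m by (rule borel_measurable_power)
    show "(\<integral>\<^sup>+p. ennreal ((?y p)\<^sup>2) \<partial>?Q) < \<infinity>"
      using le by (simp add: order_le_less_trans)
  qed simp
  then show "(\<lambda>(x, t). y t x) \<in> L2 ?Q" using m by (simp add: L2_def)
  have "ennreal (LINT p|?Q. (?y p)\<^sup>2) \<le> ennreal (T * E)"
    using le nn_integral_eq_integral[OF int] by simp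
  then show "(LINT p|?Q. (?y p)\<^sup>2) \<le> T * E"
    using T E0 by (subst (asm) ennreal_le_iff) auto
qed

lemma C_L2_space_time_L2:
  assumes T: "T > 0" and \<Omega>: "\<Omega> \<in> sets borel" and y: "y \<in> C_L2 \<Omega> T"
  shows "(\<lambda>(x, t). y t x) \<in> L2 (lebesgue_on (\<Omega> \<times> {0<..<T}))"
proof -
  obtain tm where tm: "tm \<in> {0..T}"
      "\<And>t. t \<in> {0..T} \<Longrightarrow> (LINT x|lebesgue_on \<Omega>. (y t x)\<^sup>2) \<le> (LINT x|lebesgue_on \<Omega>. (y tm x)\<^sup>2)"
    using continuous_attains_sup[OF compact_Icc _ C_L2_continuous_norm[OF y]] T by auto
  show ?thesis
    by (rule C_L2_space_time_bound(1)[OF T \<Omega> y, where E = "LINT x|lebesgue_on \<Omega>. (y tm x)\<^sup>2"]) (use tm in auto)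
qed

text \<open>Equality almost everywhere at each time is passed to the cylinder by integrating the squared
  difference, which avoids the question whether the exceptional set is measurable.\<close>
lemma C_L2_AE_eq:
  assumes T: "T > 0" and \<Omega>: "\<Omega> \<in> sets borel" and y: "y1 \<in> C_L2 \<Omega> T" "y2 \<in> C_L2 \<Omega> T"
    and eq: "\<And>t. t \<in> {0..T} \<Longrightarrow> AE x in lebesgue_on \<Omega>. y1 t x = y2 t x"
  shows "AE p in lebesgue_on (\<Omega> \<times> {0<..<T}). (case p of (x, t) \<Rightarrow> y1 t x) = (case p of (x, t) \<Rightarrow> y2 t x)"
proof -
  let ?z = "\<lambda>t x. 1 * y1 t x + (-1) * y2 t x"
  have z: "?z \<in> C_L2 \<Omega> T" using y by (rule C_L2_comb)
  have "(LINT x|lebesgue_on \<Omega>. (?z t x)\<^sup>2) \<le> 0" if "t \<in> {0<..<T}" for t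
  proof -
    have "AE x in lebesgue_on \<Omega>. y1 t x = y2 t x" using that by (intro eq) auto
    then have "AE x in lebesgue_on \<Omega>. (?z t x)\<^sup>2 = 0" by eventually_elim simp
    then show ?thesis by (simp add: integral_eq_zero_AE)
  qed
  note b = C_L2_space_time_bound[OF T \<Omega> z this order_refl]
  have "(LINT p|lebesgue_on (\<Omega> \<times> {0<..<T}). (case p of (x, t) \<Rightarrow> ?z t x)\<^sup>2) = 0"
    using b(2) by (intro antisym) auto
  then have "AE p in lebesgue_on (\<Omega> \<times> {0<..<T}). (case p of (x, t) \<Rightarrow> ?z t x)\<^sup>2 = 0"
    using L2_integrable_real[OF b(1)] by (subst (asm) integral_nonneg_eq_0_iff_AE) auto
  then show ?thesis by eventually_elim (auto split: prod.splits)
qed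

lemma sets_lebesgue_Times:
  fixes W :: "'a::euclidean_space set" and I :: "'b::euclidean_space set"
  assumes W: "W \<in> sets lebesgue" and I: "I \<in> sets borel"
  shows "W \<times> I \<in> sets lebesgue"
proof -
  have "(indicator W :: 'a \<Rightarrow> real) \<in> borel_measurable (lebesgue_on UNIV)" using W by (simp add: lebesgue_on_UNIV_eq)
  from lebesgue_on_measurable_fst[OF _ I this, of]
  have m: "(\<lambda>p. indicator W (fst p) :: real) \<in> borel_measurable (lebesgue_on (UNIV \<times> I :: ('a \<times> 'b) set))" by simp
  have UI: "(UNIV \<times> I :: ('a \<times> 'b) set) \<in> sets lebesgue" using borel_Times[OF _ I, of UNIV] by (intro sets_completionI_sets) simp
  have "(\<lambda>p. indicator W (fst p) :: real) -` {1} \<inter> space (lebesgue_on (UNIV \<times> I)) \<in> sets (lebesgue_on (UNIV \<times> I :: ('a \<times> 'b) set))"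
    by (rule measurable_sets[OF m]) simp
  moreover have "(\<lambda>p. indicator W (fst p) :: real) -` {1} \<inter> space (lebesgue_on (UNIV \<times> I :: ('a \<times> 'b) set)) = W \<times> I"
    by (auto simp: indicator_def split: if_splits)
  ultimately have "W \<times> I \<in> sets (lebesgue_on (UNIV \<times> I :: ('a \<times> 'b) set))" by metis
  then show ?thesis using UI by (subst (asm) sets_restrict_space_iff) auto
qed

lemma extend_by_zero:
  fixes f :: "'a::euclidean_space \<Rightarrow> real"
  assumes W: "W \<in> sets lebesgue" and Q: "Q \<in> sets lebesgue" "W \<subseteq> Q" and f: "f \<in> L2 (lebesgue_on W)"
    and g: "\<And>p. p \<in> Q \<Longrightarrow> g p = f p * indicator W p"
  shows "g \<in> L2 (lebesgue_on Q)" and "(LINT p|lebesgue_on Q. (g p)\<^sup>2) = (LINT p|lebesgue_on W. (f p)\<^sup>2)"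
proof -
  have "(\<lambda>p. if p \<in> W then f p else 0) \<in> borel_measurable (lebesgue_on Q)"
    using L2_measurable[OF f] W Q by (subst borel_measurable_if_lebesgue_on) auto
  then have m: "g \<in> borel_measurable (lebesgue_on Q)"
    by (subst measurable_lebesgue_cong[where g = "\<lambda>p. if p \<in> W then f p else 0"]) (auto simp: g)
  have sq: "(\<lambda>p. indicator Q p *\<^sub>R (g p)\<^sup>2) = (\<lambda>p. indicator W p *\<^sub>R (f p)\<^sup>2)"
    using Q(2) g by (auto simp: fun_eq_iff indicator_def)
  have "integrable lebesgue (\<lambda>p. indicator W p *\<^sub>R (f p)\<^sup>2)"
    using L2_integrable_real[OF f] W by (subst (asm) integrable_restrict_space) auto
  then have "integrable (lebesgue_on Q) (\<lambda>p. (g p)\<^sup>2)"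
    using Q(1) unfolding sq[symmetric] by (subst integrable_restrict_space) auto
  then show "g \<in> L2 (lebesgue_on Q)" using m by (simp add: L2_def)
  have "(LINT p|lebesgue_on Q. (g p)\<^sup>2) = (LINT p|lebesgue. indicator Q p *\<^sub>R (g p)\<^sup>2)"
    using Q(1) by (intro integral_restrict_space) simp
  also have "\<dots> = (LINT p|lebesgue_on W. (f p)\<^sup>2)"
    unfolding sq using W by (intro integral_restrict_space[symmetric]) simp
  finally show "(LINT p|lebesgue_on Q. (g p)\<^sup>2) = (LINT p|lebesgue_on W. (f p)\<^sup>2)" .
qed

section \<open>Nash equilibria for the heat equation\<close>

theorem theorem2:
  fixes T :: real and N :: nat
    and \<Omega> \<Gamma>1 \<Gamma>2 :: "(real ^ 'd) set"
    and \<omega> :: "nat \<Rightarrow> (real ^ 'd) set"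
    and \<alpha> :: "nat \<Rightarrow> real"
    and \<rho> \<eta> y0 :: "real ^ 'd \<Rightarrow> real"
    and f g1 g2 :: "(real ^ 'd) \<times> real \<Rightarrow> real"
    and yd :: "nat \<Rightarrow> (real ^ 'd) \<times> real \<Rightarrow> real"
    and yT :: "nat \<Rightarrow> real ^ 'd \<Rightarrow> real"
    and y :: "(nat \<Rightarrow> (real ^ 'd) \<times> real \<Rightarrow> real) \<Rightarrow> real \<Rightarrow> real ^ 'd \<Rightarrow> real"
    and J :: "nat \<Rightarrow> (nat \<Rightarrow> (real ^ 'd) \<times> real \<Rightarrow> real) \<Rightarrow> real"
  assumes T: "T > 0"
    and dim: "CARD('d) \<in> {1, 2, 3}"
    and domain: "bounded \<Omega>" "smooth_domain \<Omega>"
    and boundary: "\<Gamma>1 \<in> sets (boundary_measure \<Omega>)" "\<Gamma>2 \<in> sets (boundary_measure \<Omega>)"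
      "frontier \<Omega> = \<Gamma>1 \<union> \<Gamma>2"
    and N: "N \<ge> 1"
    and \<omega>: "\<And>i. i \<in> {1..N} \<Longrightarrow> \<omega> i \<in> sets lebesgue" "\<And>i. i \<in> {1..N} \<Longrightarrow> \<omega> i \<subseteq> \<Omega>"
      "disjoint_family_on \<omega> {1..N}"
    and \<alpha>: "\<And>i. i \<in> {1..N} \<Longrightarrow> \<alpha> i > 0"
    and weights: "\<rho> \<in> Linf (lebesgue_on \<Omega>)" "AE x in lebesgue_on \<Omega>. \<rho> x \<ge> 0"
      "\<eta> \<in> Linf (lebesgue_on \<Omega>)" "AE x in lebesgue_on \<Omega>. \<eta> x \<ge> 0"
    and data: "f \<in> L2 (lebesgue_on (\<Omega> \<times> {0<..<T}))" "y0 \<in> L2 (lebesgue_on \<Omega>)"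
      "g1 \<in> L2 (lateral_measure \<Omega> \<Gamma>1 T)" "g2 \<in> L2 (lateral_measure \<Omega> \<Gamma>2 T)"
    and targets: "\<And>i. i \<in> {1..N} \<Longrightarrow> yd i \<in> L2 (lebesgue_on (\<Omega> \<times> {0<..<T}))"
      "\<And>i. i \<in> {1..N} \<Longrightarrow> yT i \<in> L2 (lebesgue_on \<Omega>)"
    and state: "\<And>v. v \<in> controls N \<omega> T \<Longrightarrow>
        heat_weak_solution \<Omega> \<Gamma>1 \<Gamma>2 T (controlled_source N \<omega> f v) g1 g2 y0 (y v)"
    and state_unique: "\<And>v z t. v \<in> controls N \<omega> T \<Longrightarrow>
        heat_weak_solution \<Omega> \<Gamma>1 \<Gamma>2 T (controlled_source N \<omega> f v) g1 g2 y0 z \<Longrightarrow>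
        t \<in> {0..T} \<Longrightarrow> AE x in lebesgue_on \<Omega>. z t x = y v t x"
    and J: "\<And>i v. J i v = cost \<Omega> T \<rho> \<eta> (\<omega> i) (\<alpha> i) (yd i) (yT i) (v i) (y v)"
  shows "\<exists>u \<in> controls N \<omega> T.
      nash_equilibrium N (\<lambda>i. L2 (lebesgue_on (\<omega> i \<times> {0<..<T}))) J u \<and>
      (\<forall>u' \<in> controls N \<omega> T.
         nash_equilibrium N (\<lambda>i. L2 (lebesgue_on (\<omega> i \<times> {0<..<T}))) J u' \<longrightarrow>
         (\<forall>i\<in>{1..N}. AE p in lebesgue_on (\<omega> i \<times> {0<..<T}). u' i p = u i p))"
proof -
  let ?L = "lebesgue_on \<Omega>" and ?Q = "lebesgue_on (\<Omega> \<times> {0<..<T})"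
  let ?M = "\<lambda>i. lebesgue_on (\<omega> i \<times> {0<..<T})" and ?U = "controls N \<omega> T"
  have \<Omega>: "bounded \<Omega>" "\<Omega> \<in> sets borel" using domain by (auto simp: smooth_domain_def)
  have I: "{0<..<T} \<in> sets borel" by simp
  have Q: "\<Omega> \<times> {0<..<T} \<in> sets lebesgue"
    using borel_Times[OF \<Omega>(2) I] by (intro sets_completionI_sets) simp
  define zero :: "nat \<Rightarrow> (real ^ 'd) \<times> real \<Rightarrow> real" where "zero = (\<lambda>_ _. 0)"
  have zero: "zero \<in> ?U" by (simp add: zero_def controls_def L2_zero)
  have ctrl: "(\<lambda>p. v i p * indicator (\<omega> i) (fst p)) \<in> L2 ?Q"
      "(LINT p|?Q. (v i p * indicator (\<omega> i) (fst p))\<^sup>2) = (LINT p|?M i. (v i p)\<^sup>2)"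
    if v: "v \<in> ?U" and i: "i \<in> {1..N}" for v i
  proof -
    have W: "\<omega> i \<times> {0<..<T} \<in> sets lebesgue" "\<omega> i \<times> {0<..<T} \<subseteq> \<Omega> \<times> {0<..<T}"
      using sets_lebesgue_Times[OF \<omega>(1)[OF i] I] \<omega>(2)[OF i] by auto
    have vi: "v i \<in> L2 (?M i)" using v i by (simp add: controls_def)
    have g: "v i p * indicator (\<omega> i) (fst p) = v i p * indicator (\<omega> i \<times> {0<..<T}) p" if "p \<in> \<Omega> \<times> {0<..<T}" for p
      using that by (auto simp: indicator_def)
    show "(\<lambda>p. v i p * indicator (\<omega> i) (fst p)) \<in> L2 ?Q"
      "(LINT p|?Q. (v i p * indicator (\<omega> i) (fst p))\<^sup>2) = (LINT p|?M i. (v i p)\<^sup>2)"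
      using extend_by_zero[OF W(1) Q W(2) vi g] by auto
  qed
  define F where "F v p = (\<Sum>i=1..N. v i p * indicator (\<omega> i) (fst p))"
    for v :: "nat \<Rightarrow> (real ^ 'd) \<times> real \<Rightarrow> real" and p
  have F_zero: "F zero p = 0" for p by (simp add: F_def zero_def)
  have F: "F v \<in> L2 ?Q" if "v \<in> ?U" for v
    unfolding F_def[abs_def] using that by (intro L2_sum ctrl) auto
  have F_norm: "(LINT p|?Q. (F v p)\<^sup>2) \<le> real N * (\<Sum>i=1..N. LINT p|?M i. (v i p)\<^sup>2)" if v: "v \<in> ?U" for v
  proof -
    have int: "integrable ?Q (\<lambda>p. (v i p * indicator (\<omega> i) (fst p))\<^sup>2)" if "i \<in> {1..N}" for i
      by (rule L2_integrable_real[OF ctrl(1)[OF v that]])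
    have "(LINT p|?Q. (F v p)\<^sup>2) \<le> (LINT p|?Q. real N * (\<Sum>i=1..N. (v i p * indicator (\<omega> i) (fst p))\<^sup>2))"
    proof (rule integral_mono)
      show "integrable ?Q (\<lambda>p. (F v p)\<^sup>2)" by (rule L2_integrable_real[OF F[OF v]])
      show "integrable ?Q (\<lambda>p. real N * (\<Sum>i=1..N. (v i p * indicator (\<omega> i) (fst p))\<^sup>2))"
        by (intro integrable_mult_right Bochner_Integration.integrable_sum int)
      show "(F v p)\<^sup>2 \<le> real N * (\<Sum>i=1..N. (v i p * indicator (\<omega> i) (fst p))\<^sup>2)" for p
        unfolding F_def
        using sum_squared_le_sum_of_squares[of "\<lambda>i. v i p * indicator (\<omega> i) (fst p)" "{1..N}"]
        by (simp add: mult.commute)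
    qed
    also have "\<dots> = real N * (\<Sum>i=1..N. LINT p|?M i. (v i p)\<^sup>2)"
      using int ctrl(2)[OF v] by simp
    finally show ?thesis .
  qed
  have cs: "controlled_source N \<omega> f v = (\<lambda>p. f p + F v p)" for v
    by (simp add: controlled_source_def F_def case_prod_unfold fun_eq_iff)
  have csL2: "controlled_source N \<omega> f v \<in> L2 ?Q" if "v \<in> ?U" for v
    unfolding cs using L2_comb_real[OF data(1) F[OF that], of 1 1] by simp
  have sol: "heat_weak_solution \<Omega> \<Gamma>1 \<Gamma>2 T (controlled_source N \<omega> f v)
      (\<lambda>p. 1 * g1 p) (\<lambda>p. 1 * g2 p) (\<lambda>x. 1 * y0 x) (y v)" if "v \<in> ?U" for v
    using state[OF that] by simp
  have yC: "y v \<in> C_L2 \<Omega> T" if "v \<in> ?U" for v using state[OF that] by (simp add: heat_weak_solution_def)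
  have TT: "T \<in> {0..T}" using T by simp
  have yQ: "(\<lambda>p. y v (snd p) (fst p)) \<in> L2 ?Q" if "v \<in> ?U" for v
    using C_L2_space_time_L2[OF T \<Omega>(2) yC[OF that]] by (simp add: case_prod_unfold)
  have yT': "y v T \<in> L2 ?L" if "v \<in> ?U" for v using C_L2_L2[OF yC[OF that] TT] .
  define H where "H = (L2 ?Q \<times> L2 ?L :: (((real ^ 'd) \<times> real \<Rightarrow> real) \<times> (real ^ 'd \<Rightarrow> real)) set)"
  define lc :: "real \<Rightarrow> ((real ^ 'd) \<times> real \<Rightarrow> real) \<times> (real ^ 'd \<Rightarrow> real) \<Rightarrow> real
      \<Rightarrow> ((real ^ 'd) \<times> real \<Rightarrow> real) \<times> (real ^ 'd \<Rightarrow> real) \<Rightarrow> ((real ^ 'd) \<times> real \<Rightarrow> real) \<times> (real ^ 'd \<Rightarrow> real)"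
    where "lc = (\<lambda>s u t v. (\<lambda>p. s * fst u p + t * fst v p, \<lambda>x. s * snd u x + t * snd v x))"
  define B :: "((real ^ 'd) \<times> real \<Rightarrow> real) \<times> (real ^ 'd \<Rightarrow> real) \<Rightarrow> ((real ^ 'd) \<times> real \<Rightarrow> real) \<times> (real ^ 'd \<Rightarrow> real) \<Rightarrow> real"
    where "B = (\<lambda>u v. (LINT p|?Q. \<rho> (fst p) * fst u p * fst v p) + (LINT x|?L. \<eta> x * snd u x * snd v x))"
  have \<rho>Q: "(\<lambda>p. \<rho> (fst p)) \<in> Linf ?Q" by (rule Linf_fst[OF \<Omega>(2) I weights(1)])
  have HB: "semi_inner H lc B"
    unfolding H_def lc_def B_def
    by (rule semi_inner_prod[OF weighted_semi_inner weighted_semi_inner])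
      (rule \<rho>Q AE_lebesgue_on_fst[OF \<Omega>(2) I weights(2)] weights)+
  define obs where "obs v = (\<lambda>p. y v (snd p) (fst p), y v T)" for v
  have obs: "obs v \<in> H" if "v \<in> ?U" for v using yQ[OF that] yT'[OF that] by (simp add: obs_def H_def)
  define S where "S v = lc 1 (obs v) (-1) (obs zero)" for v
  define d where "d i = lc 1 (yd i, yT i) (-1) (obs zero)" for i
  have SH: "S v \<in> H" if "v \<in> ?U" for v unfolding S_def by (rule semi_inner.lc[OF HB obs[OF that] obs[OF zero]])
  have dH: "d i \<in> H" if i: "i \<in> {1..N}" for i
    unfolding d_def by (rule semi_inner.lc[OF HB _ obs[OF zero]]) (use targets i in \<open>simp add: H_def\<close>)
  have affine: "AE x in ?L. y v t x = (s * y v1 t x + r * y v2 t x) + (1 - s - r) * y zero t x"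
    if v: "v \<in> ?U" "v1 \<in> ?U" "v2 \<in> ?U" and comb: "\<And>i p. i \<in> {1..N} \<Longrightarrow> v i p = s * v1 i p + r * v2 i p"
      and t: "t \<in> {0..T}" for v v1 v2 s r t
  proof -
    have h1: "heat_weak_solution \<Omega> \<Gamma>1 \<Gamma>2 T
        (\<lambda>p. s * controlled_source N \<omega> f v1 p + r * controlled_source N \<omega> f v2 p)
        (\<lambda>p. (s + r) * g1 p) (\<lambda>p. (s + r) * g2 p) (\<lambda>x. (s + r) * y0 x) (\<lambda>t x. s * y v1 t x + r * y v2 t x)"
      by (rule heat_weak_solution_comb[OF \<Omega> csL2[OF v(2)] csL2[OF v(3)] sol[OF v(2)] sol[OF v(3)]]) simp
    have h2: "heat_weak_solution \<Omega> \<Gamma>1 \<Gamma>2 T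
        (\<lambda>p. 1 * (s * controlled_source N \<omega> f v1 p + r * controlled_source N \<omega> f v2 p) + (1 - s - r) * controlled_source N \<omega> f zero p)
        (\<lambda>p. 1 * g1 p) (\<lambda>p. 1 * g2 p) (\<lambda>x. 1 * y0 x)
        (\<lambda>t x. 1 * (s * y v1 t x + r * y v2 t x) + (1 - s - r) * y zero t x)"
      by (rule heat_weak_solution_comb[OF \<Omega> L2_comb_real[OF csL2[OF v(2)] csL2[OF v(3)]] csL2[OF zero] h1 sol[OF zero]]) simp
    have Fv: "F v p = s * F v1 p + r * F v2 p" for p
      unfolding F_def sum_distrib_left sum.distrib[symmetric]
      by (intro sum.cong) (auto simp: comb algebra_simps)
    have "(\<lambda>p. 1 * (s * controlled_source N \<omega> f v1 p + r * controlled_source N \<omega> f v2 p) + (1 - s - r) * controlled_source N \<omega> f zero p)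
        = controlled_source N \<omega> f v"
      unfolding cs Fv by (simp add: F_zero fun_eq_iff algebra_simps)
    then have "heat_weak_solution \<Omega> \<Gamma>1 \<Gamma>2 T (controlled_source N \<omega> f v) g1 g2 y0
        (\<lambda>t x. (s * y v1 t x + r * y v2 t x) + (1 - s - r) * y zero t x)"
      using h2 by simp
    from state_unique[OF v(1) this t] show ?thesis by eventually_elim simp
  qed
  have S_lin: "B (S v) h = s * B (S v1) h + r * B (S v2) h"
    if v: "v \<in> ?U" "v1 \<in> ?U" "v2 \<in> ?U" and comb: "\<And>i p. i \<in> {1..N} \<Longrightarrow> v i p = s * v1 i p + r * v2 i p"
      and h: "h \<in> H" for v v1 v2 s r h
  proof -
    have aff: "AE x in ?L. y v t x = (s * y v1 t x + r * y v2 t x) + (1 - s - r) * y zero t x" if "t \<in> {0..T}" for t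
      by (rule affine[OF v _ that]) (rule comb)
    define R where "R = lc s (S v1) r (S v2)"
    have RH: "R \<in> H" unfolding R_def by (rule semi_inner.lc[OF HB SH[OF v(2)] SH[OF v(3)]])
    have zC: "(\<lambda>t x. 1 * (s * y v1 t x + r * y v2 t x) + (1 - s - r) * y zero t x) \<in> C_L2 \<Omega> T"
      by (intro C_L2_comb yC v zero)
    have aeQ: "AE p in ?Q. fst (S v) p = fst R p"
    proof -
      have "AE p in ?Q. (case p of (x, t) \<Rightarrow> y v t x)
          = (case p of (x, t) \<Rightarrow> 1 * (s * y v1 t x + r * y v2 t x) + (1 - s - r) * y zero t x)"
      proof (rule C_L2_AE_eq[OF T \<Omega>(2) yC[OF v(1)] zC])
        fix t assume "t \<in> {0..T}"
        from aff[OF this]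
        show "AE x in ?L. y v t x = 1 * (s * y v1 t x + r * y v2 t x) + (1 - s - r) * y zero t x"
          by eventually_elim simp
      qed
      then show ?thesis
        by eventually_elim (simp add: R_def S_def lc_def obs_def case_prod_unfold algebra_simps)
    qed
    have aeT: "AE x in ?L. snd (S v) x = snd R x"
      using aff[OF TT] by eventually_elim (simp add: R_def S_def lc_def obs_def algebra_simps)
    have L: "fst (S v) \<in> L2 ?Q" "fst R \<in> L2 ?Q" "fst h \<in> L2 ?Q" "snd (S v) \<in> L2 ?L" "snd R \<in> L2 ?L" "snd h \<in> L2 ?L"
      using SH[OF v(1)] RH h by (auto simp: H_def)
    have "(LINT p|?Q. \<rho> (fst p) * fst (S v) p * fst h p) = (LINT p|?Q. \<rho> (fst p) * fst R p * fst h p)"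
    proof (rule integral_cong_AE)
      show "(\<lambda>p. \<rho> (fst p) * fst (S v) p * fst h p) \<in> borel_measurable ?Q"
        "(\<lambda>p. \<rho> (fst p) * fst R p * fst h p) \<in> borel_measurable ?Q"
        using weighted_integrable[OF \<rho>Q L(1,3)] weighted_integrable[OF \<rho>Q L(2,3)]
        by (auto intro: borel_measurable_integrable)
      show "AE p in ?Q. \<rho> (fst p) * fst (S v) p * fst h p = \<rho> (fst p) * fst R p * fst h p"
        using aeQ by eventually_elim simp
    qed
    moreover have "(LINT x|?L. \<eta> x * snd (S v) x * snd h x) = (LINT x|?L. \<eta> x * snd R x * snd h x)"
    proof (rule integral_cong_AE)
      show "(\<lambda>x. \<eta> x * snd (S v) x * snd h x) \<in> borel_measurable ?L"
        "(\<lambda>x. \<eta> x * snd R x * snd h x) \<in> borel_measurable ?L"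
        using weighted_integrable[OF weights(3) L(4,6)] weighted_integrable[OF weights(3) L(5,6)]
        by (auto intro: borel_measurable_integrable)
      show "AE x in ?L. \<eta> x * snd (S v) x * snd h x = \<eta> x * snd R x * snd h x"
        using aeT by eventually_elim simp
    qed
    ultimately have "B (S v) h = B R h" by (simp add: B_def)
    then show ?thesis
      unfolding R_def using semi_inner.lin[OF HB SH[OF v(2)] SH[OF v(3)] h] by simp
  qed
  obtain C\<rho> where C\<rho>: "C\<rho> \<ge> 0" "\<And>k. k \<in> L2 ?Q \<Longrightarrow> (LINT p|?Q. \<rho> (fst p) * k p * k p) \<le> C\<rho> * (LINT p|?Q. (k p)\<^sup>2)"
    by (rule weighted_bound[OF \<rho>Q]) blast
  obtain C\<eta> where C\<eta>: "C\<eta> \<ge> 0" "\<And>k. k \<in> L2 ?L \<Longrightarrow> (LINT x|?L. \<eta> x * k x * k x) \<le> C\<eta> * (LINT x|?L. (k x)\<^sup>2)"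
    by (rule weighted_bound[OF weights(3)]) blast
  \<comment> \<open>\<open>4 T\<close> is the constant of the energy estimate; \<open>N\<close> comes from \<open>(\<Sum>\<^sub>i x\<^sub>i)\<^sup>2 \<le> N \<Sum>\<^sub>i x\<^sub>i\<^sup>2\<close>\<close>
  define K where "K = (C\<rho> * T + C\<eta>) * (4 * T * real N)"
  have S_bound: "B (S v) (S v) \<le> K * (\<Sum>i=1..N. LINT p|?M i. (v i p)\<^sup>2)" if v: "v \<in> ?U" for v
  proof -
    let ?z = "\<lambda>t x. 1 * y v t x + (-1) * y zero t x"
    define E where "E = 4 * T * (LINT p|?Q. (F v p)\<^sup>2)"
    have "heat_weak_solution \<Omega> \<Gamma>1 \<Gamma>2 T (\<lambda>p. 1 * controlled_source N \<omega> f v p + (-1) * controlled_source N \<omega> f zero p)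
        (\<lambda>p. 0 * g1 p) (\<lambda>p. 0 * g2 p) (\<lambda>x. 0 * y0 x) ?z"
      by (rule heat_weak_solution_comb[OF \<Omega> csL2[OF v] csL2[OF zero] sol[OF v] sol[OF zero]]) simp
    moreover have "(\<lambda>p. 1 * controlled_source N \<omega> f v p + (-1) * controlled_source N \<omega> f zero p) = F v"
      unfolding cs by (simp add: F_zero fun_eq_iff)
    ultimately have "heat_weak_solution \<Omega> \<Gamma>1 \<Gamma>2 T (F v) (\<lambda>_. 0) (\<lambda>_. 0) (\<lambda>_. 0) ?z" by simp
    then have zE: "(LINT x|?L. (?z t x)\<^sup>2) \<le> E" if "t \<in> {0..T}" for t
      unfolding E_def by (rule heat_energy_estimate[OF T \<Omega> F[OF v] _ that])
    have zC: "?z \<in> C_L2 \<Omega> T" by (intro C_L2_comb yC v zero)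
    have E0: "0 \<le> E" using T by (simp add: E_def)
    have zE': "(LINT x|?L. (?z t x)\<^sup>2) \<le> E" if "t \<in> {0<..<T}" for t using zE[of t] that by simp
    have L: "fst (S v) \<in> L2 ?Q" "snd (S v) \<in> L2 ?L" using SH[OF v] by (auto simp: H_def)
    have "(LINT p|?Q. (fst (S v) p)\<^sup>2) \<le> T * E"
      using C_L2_space_time_bound(2)[OF T \<Omega>(2) zC zE' E0] by (simp add: S_def lc_def obs_def case_prod_unfold)
    moreover have "(LINT x|?L. (snd (S v) x)\<^sup>2) \<le> E"
      using zE[OF TT] by (simp add: S_def lc_def obs_def)
    ultimately have "B (S v) (S v) \<le> C\<rho> * (T * E) + C\<eta> * E"
      unfolding B_def using C\<rho>(2)[OF L(1)] C\<eta>(2)[OF L(2)] C\<rho>(1) C\<eta>(1)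
      by (meson add_mono mult_left_mono order_trans)
    also have "\<dots> = (C\<rho> * T + C\<eta>) * (4 * T) * (LINT p|?Q. (F v p)\<^sup>2)" by (simp add: E_def algebra_simps)
    also have "\<dots> \<le> (C\<rho> * T + C\<eta>) * (4 * T) * (real N * (\<Sum>i=1..N. LINT p|?M i. (v i p)\<^sup>2))"
      using F_norm[OF v] T C\<rho>(1) C\<eta>(1) by (intro mult_left_mono) auto
    finally show ?thesis by (simp add: K_def mult.assoc)
  qed
  interpret common_observation_game H lc B N ?M \<alpha> K S d J ?U
  proof (intro common_observation_game.intro common_observation_game_axioms.intro HB)
    show "0 \<le> K" using T C\<rho>(1) C\<eta>(1) by (simp add: K_def)
    show "J i v = \<alpha> i / 2 * (LINT p|?M i. (v i p)\<^sup>2) + 1 / 2 * B (lc 1 (S v) (-1) (d i)) (lc 1 (S v) (-1) (d i))"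
      if "i \<in> {1..N}" "v \<in> ?U" for i v
      by (simp add: J cost_def B_def S_def d_def lc_def obs_def case_prod_unfold power2_eq_square mult.assoc
          distrib_left)
    show "B (S v) h = s * B (S v1) h + t * B (S v2) h"
      if "v \<in> ?U" "v1 \<in> ?U" "v2 \<in> ?U" "\<And>i p. i \<in> {1..N} \<Longrightarrow> v i p = s * v1 i p + t * v2 i p" "h \<in> H"
      for v v1 v2 s t h
      by (rule S_lin[OF that(1-3) _ that(5)]) (rule that(4))
    show "?U = {v. \<forall>i\<in>{1..N}. v i \<in> L2 (?M i)}" by (simp add: controls_def)
  qed (rule \<alpha> SH dH S_bound; assumption)+
  show ?thesis by (rule exists_unique_nash)
qed

end
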